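(* Let $u\in\mathrm{BMOA}(\mathbb T)$, let $G_uf=P(u\cdot Jf)$ on $\mathcal H^2(\mathbb T)$, and let $s>0$ be a singular value of $G_u$, i.e. $\operatorname{Ker}(G_u^*G_u-s^2I)\ne\{0\}$. Then there exist an inner function $\theta$ and an isometric multiplier $p$ on $\operatorname{Ran}H_\theta$ such that $$\operatorname{Ker}(G_u^*G_u-s^2I)=\mathbf C(p\operatorname{Ran}H_\theta),\qquad \operatorname{Ker}(G_uG_u^*-s^2I)=p\operatorname{Ran}H_\theta,$$ and the action $G_u:\operatorname{Ker}(G_u^*G_u-s^2I)\to\operatorname{Ker}(G_uG_u^*-s^2I)$ is given by $$G_u\mathbf C(pf)=s\,p\,\theta\overline f,\qquad f\in\operatorname{Ran}H_\theta.$$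
   Context: $\mathcal H^2=\mathcal H^2(\mathbb T)$, $P$ the Szegő projection. $J$ is the linear involution $Jf(z)=f(\overline z)$ on $L^2(\mathbb T)$ and $\mathbf C$ the anti-linear involution $\mathbf Cf(z)=\overline{f(\overline z)}$ on $\mathcal H^2$; $G_u$ is the linear Hankel operator with matrix $(G_uz^n,z^m)=\widehat u(n+m)$. For inner $\theta$, $H_\theta f=P(\theta\overline f)$ and $\operatorname{Ran}H_\theta=\{f\in\mathcal H^2:\theta\overline f\in\mathcal H^2\}$. A holomorphic $p$ on $\mathbb D$ is an isometric multiplier on a closed subspace $F$ if $pf\in\mathcal H^2$ and $\|pf\|=\|f\|$ for all $f\in F$; $pF=\{pf:f\in F\}$. *)

theory Defs
  imports "HOL-Analysis.Analysis"
begin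

text \<open>Coefficient model: an element of H^2 is identified with its sequence of
Taylor/Fourier coefficients (n >= 0); H^2 = square-summable sequences.\<close>

definition H2 :: "(nat \<Rightarrow> complex) set" where
  "H2 = {f. summable (\<lambda>n. (norm (f n))\<^sup>2)}"

definition h2norm :: "(nat \<Rightarrow> complex) \<Rightarrow> real" where
  "h2norm f = sqrt (\<Sum>n. (norm (f n))\<^sup>2)"

definition h2inner :: "(nat \<Rightarrow> complex) \<Rightarrow> (nat \<Rightarrow> complex) \<Rightarrow> complex" where
  "h2inner f g = (\<Sum>n. f n * cnj (g n))"

definition adj :: "((nat \<Rightarrow> complex) \<Rightarrow> (nat \<Rightarrow> complex)) \<Rightarrow> (nat \<Rightarrow> complex) \<Rightarrow> (nat \<Rightarrow> complex)" where
  "adj T g = (THE h. h \<in> H2 \<and> (\<forall>f\<in>H2. h2inner (T f) g = h2inner f h))"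

definition fourier_coeff :: "(real \<Rightarrow> complex) \<Rightarrow> int \<Rightarrow> complex" where
  "fourier_coeff g n = (LINT t:{0..2*pi}|lborel. g t * cis (- (of_int n * t))) / (2 * pi)"

definition boundary_fn :: "(nat \<Rightarrow> complex) \<Rightarrow> (real \<Rightarrow> complex) \<Rightarrow> bool" where
  "boundary_fn u g \<longleftrightarrow> g \<in> borel_measurable lborel \<and> (\<forall>t. g (t + 2*pi) = g t) \<and>
     set_integrable lborel {0..2*pi} (\<lambda>t. (norm (g t))\<^sup>2) \<and>
     (\<forall>n::int. fourier_coeff g n = (if n \<ge> 0 then u (nat n) else 0))"

definition BMO_circle :: "(real \<Rightarrow> complex) \<Rightarrow> bool" where
  "BMO_circle g \<longleftrightarrow> (\<exists>M. \<forall>a h. 0 < h \<and> h \<le> 2*pi \<longrightarrow>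
      (LINT t:{a..a+h}|lborel. norm (g t - (LINT x:{a..a+h}|lborel. g x) / h)) / h \<le> M)"

definition BMOA :: "(nat \<Rightarrow> complex) \<Rightarrow> bool" where
  "BMOA u \<longleftrightarrow> u \<in> H2 \<and> (\<exists>g. boundary_fn u g \<and> BMO_circle g)"

definition inner_fn :: "(nat \<Rightarrow> complex) \<Rightarrow> bool" where
  "inner_fn \<theta> \<longleftrightarrow> (\<exists>g. boundary_fn \<theta> g \<and> (AE t in lborel. t \<in> {0..2*pi} \<longrightarrow> norm (g t) = 1))"

text \<open>Hankel operator G_u f = P(u Jf): coefficients sum_k u(n+k) f(k).\<close>
definition Gop :: "(nat \<Rightarrow> complex) \<Rightarrow> (nat \<Rightarrow> complex) \<Rightarrow> (nat \<Rightarrow> complex)" where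
  "Gop u f = (\<lambda>n. \<Sum>k. u (n + k) * f k)"

text \<open>Anti-linear involution C f(z) = conj (f (conj z)).\<close>
definition Cc :: "(nat \<Rightarrow> complex) \<Rightarrow> (nat \<Rightarrow> complex)" where
  "Cc f = (\<lambda>n. cnj (f n))"

text \<open>Fourier coefficient of theta * conj f at the integer m.\<close>
definition theta_bar_coeff :: "(nat \<Rightarrow> complex) \<Rightarrow> (nat \<Rightarrow> complex) \<Rightarrow> int \<Rightarrow> complex" where
  "theta_bar_coeff \<theta> f m = (\<Sum>k. (if m + int k \<ge> 0 then \<theta> (nat (m + int k)) else 0) * cnj (f k))"

definition theta_bar :: "(nat \<Rightarrow> complex) \<Rightarrow> (nat \<Rightarrow> complex) \<Rightarrow> (nat \<Rightarrow> complex)" where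
  "theta_bar \<theta> f = (\<lambda>n. theta_bar_coeff \<theta> f (int n))"

definition RanH :: "(nat \<Rightarrow> complex) \<Rightarrow> (nat \<Rightarrow> complex) set" where
  "RanH \<theta> = {f \<in> H2. (\<forall>m<0. theta_bar_coeff \<theta> f m = 0) \<and> theta_bar \<theta> f \<in> H2}"

definition taylor_coeff :: "(complex \<Rightarrow> complex) \<Rightarrow> nat \<Rightarrow> complex" where
  "taylor_coeff p n = (deriv ^^ n) p 0 / of_nat (fact n)"

definition mult :: "(complex \<Rightarrow> complex) \<Rightarrow> (nat \<Rightarrow> complex) \<Rightarrow> (nat \<Rightarrow> complex)" where
  "mult p f = (\<lambda>n. \<Sum>k\<le>n. taylor_coeff p (n - k) * f k)"

definition isometric_multiplier :: "(complex \<Rightarrow> complex) \<Rightarrow> (nat \<Rightarrow> complex) set \<Rightarrow> bool" where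
  "isometric_multiplier p F \<longleftrightarrow> p holomorphic_on ball 0 1 \<and>
     (\<forall>f\<in>F. mult p f \<in> H2 \<and> h2norm (mult p f) = h2norm f)"

definition ker_star :: "(nat \<Rightarrow> complex) \<Rightarrow> real \<Rightarrow> (nat \<Rightarrow> complex) set" where
  "ker_star u s = {f \<in> H2. adj (Gop u) (Gop u f) = (\<lambda>n. complex_of_real (s\<^sup>2) * f n)}"

definition ker_nostar :: "(nat \<Rightarrow> complex) \<Rightarrow> real \<Rightarrow> (nat \<Rightarrow> complex) set" where
  "ker_nostar u s = {g \<in> H2. Gop u (adj (Gop u) g) = (\<lambda>n. complex_of_real (s\<^sup>2) * g n)}"

end

theory Submission
  imports Defs "HOL-Complex_Analysis.Conformal_Mappings"
begin

text \<open>
  Let \<open>H f = P(u f\<^sup>*)\<close> be the antilinear Hankel operator, so that \<open>G\<^sub>u\<close> is \<open>H\<close> composed with \<open>C\<close> and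
  \<open>G\<^sub>u G\<^sub>u\<^sup>* = H\<^sup>2\<close>, and let \<open>S\<close> be the shift, for which \<open>H S = S\<^sup>* H\<close>. The space
  \<open>E = Ker (H\<^sup>2 - s\<^sup>2)\<close> is nearly \<open>S\<^sup>*\<close>-invariant: dividing by \<open>z\<close> an element of \<open>E\<close> that lacks the lowest
  order term occurring in \<open>E\<close> gives an element of \<open>E\<close>. With \<open>p\<close> the unit vector of \<open>E\<close> orthogonal to all
  these, each \<open>f\<close> in \<open>E\<close> is \<open>a(f) p + S R f\<close> with \<open>R f\<close> in \<open>E\<close>, and iterating this gives \<open>f = p V f\<close>
  where \<open>V f\<close> has the coefficients \<open>a(R\<^sup>j f)\<close>. Since \<open>H/s\<close> is an antiunitary involution on \<open>E\<close> and
  \<open>H S = S\<^sup>* H\<close>, the function \<open>\<theta> = V (H p / s)\<close> is inner, \<open>V\<close> is isometric onto \<open>Ran H\<^sub>\<theta>\<close>, and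
  \<open>V (H f / s) = \<theta> (V f)\<^sup>*\<close>.

  Boundedness of \<open>G\<^sub>u\<close> for \<open>u\<close> in BMOA is obtained for the Fejer means of \<open>u\<close>, which have no larger mean
  oscillation. For a polynomial \<open>u\<close> let \<open>B\<close> be the best bound of the Hankel form, and let \<open>X\<close> and \<open>M\<close> be
  the suprema over the disc of the Poisson averages at \<open>w\<close> of \<open>|u - u(w)|\<^sup>2\<close> and \<open>|u - u(w)|\<close>. The
  sub-mean value property of a suitable subharmonic function gives \<open>B\<^sup>2 \<le> 4 e X\<close>. The Poisson average of
  \<open>|u - u(w)|\<^sup>4\<close> is at most \<open>2 B\<^sup>2\<close> times that of \<open>|u - u(w)|\<^sup>2\<close>, hence \<open>X \<le> 4 B M\<close>. Together \<open>B \<le> 16 e M\<close>,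
  which replaces an appeal to the John-Nirenberg inequality.
\<close>

section \<open>The Hilbert space of square-summable sequences\<close>

text \<open>Two functions in H^2 need not have their product in H^2, and \<open>p\<close> need not
  be bounded. Identities between products are therefore read as identities of formal power series,
  and statements about the modulus on the circle as statements about inner products with shifts.
  Boundary functions enter only to produce \<open>inner_fn\<close> and in the BMOA estimate.

  That \<open>V\<close> is isometric amounts to the powers of \<open>R\<close> tending to 0 strongly
  on E. This comes out of the innerness of \<theta>: the norms of \<theta> and of \<open>B p\<close>
  are both 1, which leaves no remainder for \<open>B p\<close>, and the vectors
  \<open>(R ^^ j) (B p)\<close> span a dense subspace of E. Hence \<theta> is shown to be inner
  before \<open>V\<close> is known to be isometric.

  In the BMOA part, passing from B^2 <= 16 e B M to B <= 16 e M divides by B, so some finite bound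
  must be known in advance; polynomial symbols supply one. The factor e is the price of a weight
  e^\<phi> that is bounded below by 1/e only.\<close>

lemma H2_iff: "f \<in> H2 \<longleftrightarrow> summable (\<lambda>n. (norm (f n))\<^sup>2)"
  by (simp add: H2_def)

lemma norm_mult_le_sum_squares: "norm (a * b :: complex) \<le> (norm a)\<^sup>2 + (norm b)\<^sup>2"
proof -
  have "0 \<le> (norm a - norm b)\<^sup>2" by simp
  then have "2 * (norm a * norm b) \<le> (norm a)\<^sup>2 + (norm b)\<^sup>2"
    by (simp add: power2_diff)
  moreover have "0 \<le> norm a * norm b" by simp
  ultimately show ?thesis unfolding norm_mult by linarith
qed

lemma H2_summable_mult:
  assumes "f \<in> H2" "g \<in> H2"
  shows "summable (\<lambda>n. norm (f n * g n))"
  by (rule summable_comparison_test'[where g = "\<lambda>n. (norm (f n))\<^sup>2 + (norm (g n))\<^sup>2"])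
    (use assms in \<open>auto simp: H2_iff norm_mult_le_sum_squares intro!: summable_add\<close>)

lemma H2_cnj: "f \<in> H2 \<Longrightarrow> (\<lambda>n. cnj (f n)) \<in> H2"
  by (simp add: H2_iff)

lemma H2_add: "f \<in> H2 \<Longrightarrow> g \<in> H2 \<Longrightarrow> (\<lambda>n. f n + g n) \<in> H2"
proof -
  assume *: "f \<in> H2" "g \<in> H2"
  have "norm ((norm (f n + g n))\<^sup>2) \<le> 2 * (norm (f n))\<^sup>2 + 2 * (norm (g n))\<^sup>2" for n
  proof -
    have "(norm (f n + g n))\<^sup>2 \<le> (norm (f n) + norm (g n))\<^sup>2"
      by (intro power_mono norm_triangle_ineq) auto
    moreover have "0 \<le> (norm (f n) - norm (g n))\<^sup>2" by simp
    ultimately show ?thesis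
      unfolding power2_sum power2_diff by simp
  qed
  moreover have "summable (\<lambda>n. 2 * (norm (f n))\<^sup>2 + 2 * (norm (g n))\<^sup>2)"
    using * by (intro summable_add summable_mult) (auto simp: H2_iff)
  ultimately show ?thesis
    unfolding H2_iff by (rule summable_comparison_test'[rotated])
qed

lemma H2_mult: "f \<in> H2 \<Longrightarrow> (\<lambda>n. c * f n) \<in> H2"
  unfolding H2_iff norm_mult power_mult_distrib by (rule summable_mult)

lemma H2_diff: "f \<in> H2 \<Longrightarrow> g \<in> H2 \<Longrightarrow> (\<lambda>n. f n - g n) \<in> H2"
  using H2_add[of f "\<lambda>n. (-1) * g n"] H2_mult[of g "-1"] by simp

lemma H2_finite: "finite {n. f n \<noteq> 0} \<Longrightarrow> f \<in> H2"
  unfolding H2_iff by (rule summable_finite[of "{n. f n \<noteq> 0}"]) auto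

text \<open>A type rather than a set, so that the theory of real inner product spaces and bounded
  linear maps applies; the complex structure is added afterwards through \<open>cmul\<close> and
  \<open>cip\<close>.\<close>

typedef l2 = H2 morphisms coef l2_of
  by (rule exI[of _ "\<lambda>_. 0"]) (simp add: H2_iff)

lemma coef_H2 [simp]: "coef x \<in> H2"
  by (rule coef)

lemma l2_eqI: "(\<And>n. coef x n = coef y n) \<Longrightarrow> x = y"
  using coef_inject by blast

lemma coef_l2_of [simp]: "f \<in> H2 \<Longrightarrow> coef (l2_of f) = f"
  by (rule l2_of_inverse)

instantiation l2 :: real_inner
begin

definition "0 = l2_of (\<lambda>_. 0)"
definition "x + y = l2_of (\<lambda>n. coef x n + coef y n)"
definition "x - y = l2_of (\<lambda>n. coef x n - coef y n)"
definition "- x = l2_of (\<lambda>n. - coef x n)"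
definition "scaleR r x = l2_of (\<lambda>n. r *\<^sub>R coef x n)"
definition "inner x y = (\<Sum>n. inner (coef x n) (coef y n))"
definition norm_l2_def: "norm x = sqrt (inner x (x::l2))"
definition sgn_l2_def: "sgn (x::l2) = scaleR (inverse (norm x)) x"
definition dist_l2_def: "dist x y = norm (x - (y::l2))"
definition uniformity_l2_def: "(uniformity :: (l2 \<times> l2) filter) = (INF e\<in>{0<..}. principal {(x, y). dist x y < e})"
definition open_l2_def: "open (U :: l2 set) \<longleftrightarrow> (\<forall>x\<in>U. eventually (\<lambda>(x', y). x' = x \<longrightarrow> y \<in> U) uniformity)"

lemma coef_zero_aux: "coef 0 n = 0"
  unfolding zero_l2_def by (subst coef_l2_of) (auto simp: H2_iff)

lemma coef_add_aux: "coef (x + y) n = coef x n + coef y n"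
  unfolding plus_l2_def by (subst coef_l2_of) (auto intro: H2_add)

lemma coef_diff_aux: "coef (x - y) n = coef x n - coef y n"
  unfolding minus_l2_def by (subst coef_l2_of) (auto intro: H2_diff)

lemma coef_minus_aux: "coef (- x) n = - coef x n"
  unfolding uminus_l2_def using H2_mult[of "coef x" "-1"] by (subst coef_l2_of) auto

lemma coef_scaleR_aux: "coef (scaleR r x) n = r *\<^sub>R coef x n"
  unfolding scaleR_l2_def scaleR_conv_of_real by (subst coef_l2_of) (auto intro: H2_mult)

lemmas coef_aux = coef_zero_aux coef_add_aux coef_diff_aux coef_minus_aux coef_scaleR_aux

lemma summable_inner_aux: "summable (\<lambda>n. inner (coef x n) (coef y n))"
proof (rule summable_comparison_test')
  show "summable (\<lambda>n. norm (coef x n * coef y n))"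
    by (rule H2_summable_mult) auto
  show "norm (inner (coef x n) (coef y n)) \<le> norm (coef x n * coef y n)" for n
    using Cauchy_Schwarz_ineq2[of "coef x n" "coef y n"] by (simp add: norm_mult)
qed

instance
proof
  fix x y z :: l2 and a b r :: real
  show "x + y + z = x + (y + z)" "x + y = y + x" "0 + x = x" "- x + x = 0" "x - y = x + - y"
    "a *\<^sub>R (x + y) = a *\<^sub>R x + a *\<^sub>R y" "(a + b) *\<^sub>R x = a *\<^sub>R x + b *\<^sub>R x"
    "a *\<^sub>R b *\<^sub>R x = (a * b) *\<^sub>R x" "1 *\<^sub>R x = x"
    by (rule l2_eqI; simp add: coef_aux algebra_simps)+
  show "dist x y = norm (x - y)" "norm x = sqrt (inner x x)"
    by (simp_all add: dist_l2_def norm_l2_def)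
  show "sgn x = inverse (norm x) *\<^sub>R x"
    by (simp add: sgn_l2_def)
  show "(uniformity :: (l2 \<times> l2) filter) = (INF e\<in>{0<..}. principal {(x, y). dist x y < e})"
    by (rule uniformity_l2_def)
  show "open U \<longleftrightarrow> (\<forall>x\<in>U. eventually (\<lambda>(x', y). x' = x \<longrightarrow> y \<in> U) uniformity)" for U :: "l2 set"
    by (rule open_l2_def)
  show "inner x y = inner y x"
    by (simp add: inner_l2_def inner_commute)
  show "inner (x + y) z = inner x z + inner y z"
    unfolding inner_l2_def coef_aux inner_add_left
    by (rule suminf_add[symmetric]) (rule summable_inner_aux)+
  show "inner (r *\<^sub>R x) y = r * inner x y"
    unfolding inner_l2_def coef_aux inner_scaleR_left
    by (rule suminf_mult) (rule summable_inner_aux)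
  show "0 \<le> inner x x"
    unfolding inner_l2_def by (rule suminf_nonneg) (auto intro: summable_inner_aux)
  show "inner x x = 0 \<longleftrightarrow> x = 0"
    unfolding inner_l2_def
    by (subst suminf_eq_zero_iff) (auto intro: summable_inner_aux l2_eqI simp: coef_aux)
qed

end

lemma coef_zero [simp]: "coef 0 n = 0"
  and coef_add [simp]: "coef (x + y) n = coef x n + coef y n"
  and coef_diff [simp]: "coef (x - y) n = coef x n - coef y n"
  and coef_minus [simp]: "coef (- x) n = - coef x n"
  and coef_scaleR [simp]: "coef (r *\<^sub>R x) n = r *\<^sub>R coef x n"
  by (rule coef_aux)+

lemma coef_sum [simp]: "coef (\<Sum>i\<in>A. f i) n = (\<Sum>i\<in>A. coef (f i) n)"
  by (induction A rule: infinite_finite_induct) auto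

lemma l2_norm_sq: "(norm x)\<^sup>2 = (\<Sum>n. (norm (coef x n))\<^sup>2)"
  unfolding power2_norm_eq_inner inner_l2_def ..

lemma summable_coef_sq: "summable (\<lambda>n. (norm (coef x n))\<^sup>2)"
  using coef_H2[of x] by (simp add: H2_iff)

lemma h2norm_coef [simp]: "h2norm (coef x) = norm x"
  unfolding h2norm_def by (simp flip: l2_norm_sq)

lemma sum_coef_sq_le: "finite A \<Longrightarrow> (\<Sum>n\<in>A. (norm (coef x n))\<^sup>2) \<le> (norm x)\<^sup>2"
  unfolding l2_norm_sq by (rule sum_le_suminf) (auto intro: summable_coef_sq)

lemma norm_coef_le: "norm (coef x n) \<le> norm x"
  using sum_coef_sq_le[of "{n}" x] by (simp add: power2_le_iff_abs_le)

lemma bounded_linear_coef: "bounded_linear (\<lambda>x. coef x n)"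
  by (rule bounded_linear_intro[where K = 1]) (auto simp: norm_coef_le)

lemmas tendsto_coef = bounded_linear.tendsto[OF bounded_linear_coef]

lemma H2_bounded_sums:
  assumes "\<And>N. (\<Sum>n<N. (norm (f n))\<^sup>2) \<le> C"
  shows "f \<in> H2" "(\<Sum>n. (norm (f n))\<^sup>2) \<le> C"
proof -
  show "f \<in> H2"
    unfolding H2_iff by (rule summableI_nonneg_bounded[where x = C]) (use assms in auto)
  then show "(\<Sum>n. (norm (f n))\<^sup>2) \<le> C"
    by (intro suminf_le_const assms) (simp add: H2_iff)
qed

instance l2 :: complete_space
proof
  fix X :: "nat \<Rightarrow> l2"
  assume X: "Cauchy X"
  define f where "f n = lim (\<lambda>k. coef (X k) n)" for n
  have lim: "(\<lambda>k. coef (X k) n) \<longlonglongrightarrow> f n" for n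
    unfolding f_def using bounded_linear.Cauchy[OF bounded_linear_coef X]
    by (simp add: Cauchy_convergent_iff convergent_LIMSEQ_iff)
  have key: "\<exists>M. \<forall>m\<ge>M. \<forall>N. (\<Sum>n<N. (norm (coef (X m) n - f n))\<^sup>2) \<le> e\<^sup>2" if e: "e > 0" for e
  proof -
    obtain M where M: "\<And>m k. m \<ge> M \<Longrightarrow> k \<ge> M \<Longrightarrow> norm (X m - X k) < e"
      using X e unfolding Cauchy_def dist_norm by meson
    have "(\<Sum>n<N. (norm (coef (X m) n - f n))\<^sup>2) \<le> e\<^sup>2" if "m \<ge> M" for m N
    proof (rule tendsto_upperbound)
      show "(\<lambda>k. \<Sum>n<N. (norm (coef (X m) n - coef (X k) n))\<^sup>2) \<longlonglongrightarrow> (\<Sum>n<N. (norm (coef (X m) n - f n))\<^sup>2)"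
        by (intro tendsto_intros lim)
      show "\<forall>\<^sub>F k in sequentially. (\<Sum>n<N. (norm (coef (X m) n - coef (X k) n))\<^sup>2) \<le> e\<^sup>2"
        using eventually_ge_at_top[of M]
      proof eventually_elim
        case (elim k)
        have "(\<Sum>n<N. (norm (coef (X m) n - coef (X k) n))\<^sup>2) \<le> (norm (X m - X k))\<^sup>2"
          using sum_coef_sq_le[of "{..<N}" "X m - X k"] by simp
        also have "\<dots> \<le> e\<^sup>2"
          using M[OF that elim] by (intro power_mono) auto
        finally show ?case .
      qed
    qed auto
    then show ?thesis by blast
  qed
  obtain M where "\<And>N. (\<Sum>n<N. (norm (coef (X M) n - f n))\<^sup>2) \<le> 1\<^sup>2"
    using key[of 1] by force
  then have "(\<lambda>n. coef (X M) n - f n) \<in> H2"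
    by (rule H2_bounded_sums)
  from H2_diff[OF _ this, of "coef (X M)"] have f: "f \<in> H2" by simp
  have "X \<longlonglongrightarrow> l2_of f"
    unfolding lim_sequentially
  proof (intro allI impI)
    fix e :: real assume "e > 0"
    then obtain M where M: "\<And>m N. m \<ge> M \<Longrightarrow> (\<Sum>n<N. (norm (coef (X m) n - f n))\<^sup>2) \<le> (e/2)\<^sup>2"
      using key[of "e/2"] by auto
    have "dist (X m) (l2_of f) < e" if "m \<ge> M" for m
    proof -
      have "(norm (X m - l2_of f))\<^sup>2 \<le> (e/2)\<^sup>2"
        unfolding l2_norm_sq by (rule H2_bounded_sums) (use M[OF that] f in simp)
      then have "norm (X m - l2_of f) \<le> e/2"
        using \<open>e > 0\<close> by (simp add: power2_le_iff_abs_le)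
      then show ?thesis
        using \<open>e > 0\<close> by (simp add: dist_norm)
    qed
    then show "\<exists>M. \<forall>m\<ge>M. dist (X m) (l2_of f) < e" by blast
  qed
  then show "convergent X" by (auto simp: convergent_def)
qed

section \<open>Complex scalars and the complex inner product\<close>

definition cip :: "l2 \<Rightarrow> l2 \<Rightarrow> complex" where
  "cip x y = (\<Sum>n. coef x n * cnj (coef y n))"

definition cmul :: "complex \<Rightarrow> l2 \<Rightarrow> l2" (infixr "*\<^sub>c" 75) where
  "c *\<^sub>c x = l2_of (\<lambda>n. c * coef x n)"

lemma coef_cmul [simp]: "coef (c *\<^sub>c x) n = c * coef x n"
  unfolding cmul_def by (subst coef_l2_of) (auto intro: H2_mult)

lemma cip_sums: "(\<lambda>n. coef x n * cnj (coef y n)) sums cip x y"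
  unfolding cip_def
  by (rule summable_sums, rule summable_norm_cancel, rule H2_summable_mult) (auto intro: H2_cnj)

lemma Re_cip: "Re (cip x y) = inner x y"
proof -
  have "(\<lambda>n. Re (coef x n * cnj (coef y n))) sums Re (cip x y)"
    using cip_sums by (rule sums_Re)
  then show ?thesis
    by (simp add: inner_l2_def inner_complex_def sums_iff)
qed

lemma cip_add_left: "cip (x + y) z = cip x z + cip y z"
  using sums_unique2[OF cip_sums[of "x + y" z], of "cip x z + cip y z"] sums_add[OF cip_sums[of x z] cip_sums[of y z]]
  by (simp add: algebra_simps)

lemma cip_cmul_left [simp]: "cip (c *\<^sub>c x) y = c * cip x y"
  using sums_unique2[OF cip_sums[of "c *\<^sub>c x" y], of "c * cip x y"] sums_mult[OF cip_sums[of x y], of c]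
  by (simp add: algebra_simps)

lemma cnj_cip: "cnj (cip x y) = cip y x"
  using sums_unique2[OF cip_sums[of y x], of "cnj (cip x y)"] cip_sums[of x y, THEN sums_cnj[THEN iffD2]]
  by (simp add: mult.commute)

lemma cip_cmul_right [simp]: "cip x (c *\<^sub>c y) = cnj c * cip x y"
  by (metis cip_cmul_left cnj_cip complex_cnj_mult)

lemma cip_add_right: "cip z (x + y) = cip z x + cip z y"
  by (metis cip_add_left cnj_cip complex_cnj_add)

lemma scaleR_eq_cmul: "r *\<^sub>R x = complex_of_real r *\<^sub>c x"
  by (rule l2_eqI) (simp add: scaleR_conv_of_real)

lemma norm_cmul [simp]: "norm (c *\<^sub>c x) = norm c * norm x"
proof -
  have "(norm (c *\<^sub>c x))\<^sup>2 = (norm c * norm x)\<^sup>2"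
    unfolding power_mult_distrib l2_norm_sq
    by (simp add: norm_mult power_mult_distrib suminf_mult summable_coef_sq)
  then show ?thesis by simp
qed

lemma norm_cip_le: "norm (cip x y) \<le> norm x * norm y"
proof (cases "cip x y = 0")
  case False
  \<comment> \<open>A unimodular factor that makes the inner product real and nonnegative, so that
    the real Cauchy-Schwarz inequality suffices.\<close>
  define c where "c = cnj (cip x y) / norm (cip x y)"
  have c: "norm c = 1" using False by (simp add: c_def norm_divide)
  have "c * cip x y = norm (cip x y)"
    unfolding c_def using False complex_norm_square[of "cip x y"]
    by (simp add: field_simps power2_eq_square)
  then have "norm (cip x y) = Re (cip (c *\<^sub>c x) y)" by simp
  also have "\<dots> \<le> norm (c *\<^sub>c x) * norm y"
    unfolding Re_cip by (rule norm_cauchy_schwarz)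
  finally show ?thesis using c by simp
qed auto

lemma bounded_bilinear_cip: "bounded_bilinear cip"
  by (standard; (intro exI[of _ 1])?)
    (auto simp: cip_add_left cip_add_right scaleR_eq_cmul norm_cip_le scaleR_conv_of_real)

interpretation cip: bounded_bilinear cip by (rule bounded_bilinear_cip)

declare cip.zero_left [simp] cip.zero_right [simp]

lemma cip_self: "cip x x = complex_of_real ((norm x)\<^sup>2)"
proof (rule complex_eqI)
  show "Im (cip x x) = Im (complex_of_real ((norm x)\<^sup>2))"
    using arg_cong[OF cnj_cip[of x x], of Im] by simp
qed (simp add: Re_cip power2_norm_eq_inner)

lemma bounded_bilinear_cmul: "bounded_bilinear cmul"
proof
  show "\<exists>K. \<forall>a b. norm (a *\<^sub>c b) \<le> norm a * norm b * K"
    by (intro exI[of _ 1]) simp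
qed (auto intro!: l2_eqI simp: algebra_simps)

interpretation cmul: bounded_bilinear cmul by (rule bounded_bilinear_cmul)

declare cmul.zero_left [simp] cmul.zero_right [simp]

lemma cmul_1 [simp]: "1 *\<^sub>c x = x"
  and cmul_cmul [simp]: "a *\<^sub>c b *\<^sub>c x = (a * b) *\<^sub>c x"
  by (rule l2_eqI; simp)+

lemma cmul_eq_0_iff [simp]: "c *\<^sub>c x = 0 \<longleftrightarrow> c = 0 \<or> x = 0"
  using norm_cmul[of c x] by (metis mult_eq_0_iff norm_eq_zero)

lemma norm_diff_sq: "(norm (x - y))\<^sup>2 = (norm x)\<^sup>2 + (norm y)\<^sup>2 - 2 * Re (cip x y)" for x y :: l2
  unfolding Re_cip power2_norm_eq_inner by (simp add: inner_diff inner_commute algebra_simps)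

lemma norm_add_sq: "(norm (x + y))\<^sup>2 = (norm x)\<^sup>2 + (norm y)\<^sup>2 + 2 * Re (cip x y)" for x y :: l2
  unfolding Re_cip power2_norm_eq_inner by (simp add: inner_add inner_commute algebra_simps)

section \<open>Complex subspaces and orthogonal projection\<close>

definition csub :: "l2 set \<Rightarrow> bool" where
  "csub V \<longleftrightarrow> 0 \<in> V \<and> (\<forall>x\<in>V. \<forall>y\<in>V. x + y \<in> V) \<and> (\<forall>c. \<forall>x\<in>V. c *\<^sub>c x \<in> V)"

lemma csubD:
  assumes "csub V"
  shows "0 \<in> V" "x \<in> V \<Longrightarrow> y \<in> V \<Longrightarrow> x + y \<in> V" "x \<in> V \<Longrightarrow> c *\<^sub>c x \<in> V" "x \<in> V \<Longrightarrow> r *\<^sub>R x \<in> V"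
    "x \<in> V \<Longrightarrow> y \<in> V \<Longrightarrow> x - y \<in> V"
proof -
  show [intro]: "0 \<in> V" "x \<in> V \<Longrightarrow> y \<in> V \<Longrightarrow> x + y \<in> V" "x \<in> V \<Longrightarrow> c *\<^sub>c x \<in> V" for x y c
    using assms by (auto simp: csub_def)
  then show "x \<in> V \<Longrightarrow> r *\<^sub>R x \<in> V" by (simp add: scaleR_eq_cmul)
  have eq: "x - y = x + (-1) *\<^sub>c y" by (rule l2_eqI) simp
  show "x - y \<in> V" if "x \<in> V" "y \<in> V"
    unfolding eq using that assms unfolding csub_def by blast
qed

lemma csub_sum: "csub V \<Longrightarrow> (\<And>i. i \<in> A \<Longrightarrow> f i \<in> V) \<Longrightarrow> (\<Sum>i\<in>A. f i) \<in> V"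
  by (induction A rule: infinite_finite_induct) (auto simp: csubD)

text \<open>\<open>V\<close> need not be closed, so the projection is a limit of elements of \<open>V\<close>.\<close>

lemma orthogonal_decomposition:
  assumes V: "csub V"
  obtains v r where "\<And>k::nat. v k \<in> V" "v \<longlonglongrightarrow> f - r" "\<And>x. x \<in> V \<Longrightarrow> cip r x = 0"
proof -
  define d where "d = (INF v\<in>V. (norm (f - v))\<^sup>2)"
  have bdd: "bdd_below ((\<lambda>v. (norm (f - v))\<^sup>2) ` V)"
    by (rule bdd_belowI[of _ 0]) auto
  have d_le: "d \<le> (norm (f - v))\<^sup>2" if "v \<in> V" for v
    unfolding d_def using bdd that by (rule cINF_lower)
  have ne: "V \<noteq> {}" using csubD(1)[OF V] by auto
  have "\<exists>v\<in>V. (norm (f - v))\<^sup>2 < d + 1 / Suc k" for k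
  proof -
    have "d < d + 1 / Suc k" by simp
    then show ?thesis unfolding d_def using cINF_less_iff[OF ne bdd] by blast
  qed
  then obtain v where v: "\<And>k. v k \<in> V" "\<And>k. (norm (f - v k))\<^sup>2 < d + 1 / Suc k"
    by metis
  \<comment> \<open>Parallelogram law: the midpoint of \<open>v i\<close> and \<open>v j\<close> is
    again in \<open>V\<close>, so its distance to \<open>f\<close> is not below the infimum, which
    forces the two points together.\<close>
  have near: "(norm (v i - v j))\<^sup>2 \<le> 2 / Suc i + 2 / Suc j" for i j
  proof -
    have "(1/2) *\<^sub>R (v i + v j) \<in> V" using v(1) V by (simp add: csubD)
    then have "d \<le> (norm (f - (1/2) *\<^sub>R (v i + v j)))\<^sup>2" by (rule d_le)
    also have "f - (1/2) *\<^sub>R (v i + v j) = (1/2) *\<^sub>R ((f - v i) + (f - v j))"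
      by (simp add: algebra_simps flip: scaleR_add_left)
    finally have "4 * d \<le> (norm ((f - v i) + (f - v j)))\<^sup>2" by (simp add: power_divide)
    moreover have "(norm (a - b))\<^sup>2 = 2 * (norm a)\<^sup>2 + 2 * (norm b)\<^sup>2 - (norm (a + b))\<^sup>2" for a b :: l2
      unfolding norm_diff_sq norm_add_sq by linarith
    note this[of "f - v i" "f - v j"]
    moreover have "(f - v i) - (f - v j) = v j - v i" by simp
    ultimately show ?thesis using v(2)[of i] v(2)[of j] by (simp add: norm_minus_commute)
  qed
  have "Cauchy v"
    unfolding Cauchy_altdef2 dist_norm
  proof (intro allI impI)
    fix e :: real assume "e > 0"
    then obtain N where N: "4 / Suc N < e\<^sup>2"
      using reals_Archimedean[of "e\<^sup>2/4"] by (auto simp: field_simps)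
    have "norm (v n - v N) < e" if "n \<ge> N" for n
    proof -
      have "(norm (v n - v N))\<^sup>2 \<le> 2 / Suc n + 2 / Suc N" by (rule near)
      also have "\<dots> \<le> 2 / Suc N + 2 / Suc N" using that by (intro add_mono divide_left_mono) auto
      finally have "(norm (v n - v N))\<^sup>2 < e\<^sup>2" using N by simp
      then show ?thesis using \<open>e > 0\<close> by (simp add: power2_less_imp_less)
    qed
    then show "\<exists>N. \<forall>n\<ge>N. norm (v n - v N) < e" by blast
  qed
  then obtain w where w: "v \<longlonglongrightarrow> w" using Cauchy_convergent_iff convergent_def by blast
  have "(\<lambda>k. d + 1 / Suc k) \<longlonglongrightarrow> d + 0"
    by (intro tendsto_intros LIMSEQ_inverse_real_of_nat[unfolded inverse_eq_divide])
  then have dw: "(norm (f - w))\<^sup>2 \<le> d"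
    using v(2) w by (intro LIMSEQ_le[OF _ _ , of "\<lambda>k. (norm (f - v k))\<^sup>2" _ "\<lambda>k. d + 1 / Suc k" d])
      (auto intro!: tendsto_intros less_imp_le)
  have orth: "cip (f - w) x = 0" if x: "x \<in> V" for x
  proof (rule ccontr)
    assume nz: "cip (f - w) x \<noteq> 0"
    define N where "N = (norm x)\<^sup>2"
    have "x \<noteq> 0" using nz by (metis cip.zero_right)
    then have N: "N > 0" by (simp add: N_def)
    define t where "t = cip (f - w) x"
    \<comment> \<open>The coefficient of \<open>f - w\<close> along \<open>x\<close>; subtracting
      this multiple would push the squared distance below \<open>d\<close> by |t|^2 / N.\<close>
    define c where "c = t / N"
    have "d \<le> (norm (f - w - c *\<^sub>c x))\<^sup>2"
    proof (rule tendsto_lowerbound)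
      show "(\<lambda>k. (norm (f - (v k + c *\<^sub>c x)))\<^sup>2) \<longlonglongrightarrow> (norm (f - w - c *\<^sub>c x))\<^sup>2"
        unfolding diff_diff_add by (intro tendsto_intros w)
      show "\<forall>\<^sub>F k in sequentially. d \<le> (norm (f - (v k + c *\<^sub>c x)))\<^sup>2"
        by (intro always_eventually allI d_le csubD(2)[OF V] csubD(3)[OF V] v x)
    qed auto
    also have "\<dots> = (norm (f - w))\<^sup>2 + (norm c)\<^sup>2 * N - 2 * Re (cnj c * t)"
      by (simp add: norm_diff_sq N_def power_mult_distrib t_def)
    also have "cnj c * t = (norm t)\<^sup>2 / N"
      using complex_norm_square[of t] by (simp add: c_def mult.commute)
    also have "(norm c)\<^sup>2 * N = (norm t)\<^sup>2 / N"
      using N by (simp add: c_def norm_divide power_divide power2_eq_square)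
    finally have "(norm t)\<^sup>2 / N \<le> 0" using dw by simp
    then show False using N nz by (auto simp: t_def divide_le_0_iff)
  qed
  show ?thesis
    by (rule that[of v "f - w"]) (use v(1) w orth in auto)
qed

section \<open>The shift, its adjoint and truncation\<close>

definition shift :: "l2 \<Rightarrow> l2" where
  "shift x = l2_of (\<lambda>n. case n of 0 \<Rightarrow> 0 | Suc m \<Rightarrow> coef x m)"

definition bshift :: "l2 \<Rightarrow> l2" where
  "bshift x = l2_of (\<lambda>n. coef x (Suc n))"

definition one2 :: l2 where
  "one2 = l2_of (\<lambda>n. if n = 0 then 1 else 0)"

lemma coef_one2: "coef one2 n = (if n = 0 then 1 else 0)"
  unfolding one2_def by (subst coef_l2_of) (auto intro: H2_finite)

lemma coef_bshift [simp]: "coef (bshift x) n = coef x (Suc n)"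
proof -
  have "(\<lambda>n. coef x (Suc n)) \<in> H2"
    using summable_coef_sq[of x] summable_Suc_iff[of "\<lambda>n. (norm (coef x n))\<^sup>2"] by (simp add: H2_iff)
  then show ?thesis
    unfolding bshift_def by simp
qed

lemma coef_shift: "coef (shift x) n = (case n of 0 \<Rightarrow> 0 | Suc m \<Rightarrow> coef x m)"
proof -
  have "summable (\<lambda>n. (norm (case Suc n of 0 \<Rightarrow> 0 | Suc m \<Rightarrow> coef x m))\<^sup>2)"
    using summable_coef_sq[of x] by simp
  then show ?thesis
    unfolding shift_def summable_Suc_iff[of "\<lambda>n. (norm (case n of 0 \<Rightarrow> 0 | Suc m \<Rightarrow> coef x m))\<^sup>2"]
    by (subst coef_l2_of) (simp_all add: H2_iff)
qed

lemma coef_shift_0 [simp]: "coef (shift x) 0 = 0"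
  and coef_shift_Suc [simp]: "coef (shift x) (Suc n) = coef x n"
  by (simp_all add: coef_shift)

lemma bshift_shift [simp]: "bshift (shift x) = x"
  by (rule l2_eqI) simp

lemma shift_bshift: "shift (bshift x) = x - coef x 0 *\<^sub>c one2"
  by (rule l2_eqI) (auto simp: coef_shift coef_one2 split: nat.splits)

lemma shift_add [simp]: "shift (x + y) = shift x + shift y"
  and shift_cmul [simp]: "shift (c *\<^sub>c x) = c *\<^sub>c shift x"
  and bshift_add [simp]: "bshift (x + y) = bshift x + bshift y"
  and bshift_diff [simp]: "bshift (x - y) = bshift x - bshift y"
  and bshift_cmul [simp]: "bshift (c *\<^sub>c x) = c *\<^sub>c bshift x"
  by (rule l2_eqI; auto simp: coef_shift split: nat.splits)+

lemma cip_shift_left: "cip (shift x) y = cip x (bshift y)"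
proof -
  have "(\<lambda>n. coef (shift x) n * cnj (coef y n)) sums cip (shift x) y" by (rule cip_sums)
  then have "(\<lambda>n. coef (shift x) (Suc n) * cnj (coef y (Suc n))) sums cip (shift x) y"
    by (subst sums_Suc_iff) simp
  moreover have "(\<lambda>n. coef x n * cnj (coef (bshift y) n)) sums cip x (bshift y)" by (rule cip_sums)
  ultimately show ?thesis by (simp add: sums_unique2)
qed

lemma cip_shift_shift [simp]: "cip (shift x) (shift y) = cip x y"
  by (simp add: cip_shift_left)

lemma norm_eqI_cip: "cip x x = cip y y \<Longrightarrow> norm x = norm y"
  unfolding cip_self of_real_eq_iff by simp

lemma norm_shift [simp]: "norm (shift x) = norm x"
  by (rule norm_eqI_cip) simp

lemma cip_bshift_bshift: "cip (bshift x) (bshift y) = cip x y - coef x 0 * cnj (coef y 0)"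
proof -
  have "cip x one2 = coef x 0" for x
    unfolding cip_def by (subst suminf_finite[of "{0}"]) (auto simp: coef_one2)
  then have *: "cip one2 y = cnj (coef y 0)" by (metis cnj_cip)
  have "cip (bshift x) (bshift y) = cip (shift (bshift x)) y" by (rule cip_shift_left[symmetric])
  then show ?thesis by (simp add: shift_bshift cip.diff_left *)
qed

lemma norm_bshift_le: "norm (bshift x) \<le> norm x"
proof -
  have "(norm (bshift x))\<^sup>2 = (norm x)\<^sup>2 - (norm (coef x 0))\<^sup>2"
    using cip_bshift_bshift[of x x]
    unfolding cip_self complex_norm_square[symmetric] of_real_diff[symmetric] of_real_eq_iff .
  then have "(norm (bshift x))\<^sup>2 \<le> (norm x)\<^sup>2" by simp
  then show ?thesis by (simp add: power2_le_iff_abs_le)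
qed

lemma bounded_linear_shift: "bounded_linear shift"
  by (rule bounded_linear_intro[where K = 1]) (auto simp: scaleR_eq_cmul)

lemmas tendsto_shift = bounded_linear.tendsto[OF bounded_linear_shift]

definition trunc :: "nat \<Rightarrow> l2 \<Rightarrow> l2" where
  "trunc N x = l2_of (\<lambda>n. if n < N then coef x n else 0)"

lemma coef_trunc [simp]: "coef (trunc N x) n = (if n < N then coef x n else 0)"
proof -
  have "finite {n. (if n < N then coef x n else 0) \<noteq> 0}"
    by (rule finite_subset[of _ "{..<N}"]) auto
  then show ?thesis
    unfolding trunc_def by (subst coef_l2_of) (auto intro: H2_finite)
qed

lemma norm_trunc_sq: "(norm (trunc N x))\<^sup>2 = (\<Sum>n<N. (norm (coef x n))\<^sup>2)"
  unfolding l2_norm_sq by (subst suminf_finite[of "{..<N}"]) auto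

lemma tendsto_trunc: "(\<lambda>N. trunc N x) \<longlonglongrightarrow> x"
proof -
  have eq: "(norm (x - trunc N x))\<^sup>2 = (norm x)\<^sup>2 - (\<Sum>n<N. (norm (coef x n))\<^sup>2)" for N
  proof -
    have "coef (x - trunc N x) n * cnj (coef (trunc N x) n) = 0" for n
      by simp
    then have "cip (x - trunc N x) (trunc N x) = 0"
      unfolding cip_def by (simp only: suminf_zero)
    then have "(norm ((x - trunc N x) + trunc N x))\<^sup>2 = (norm (x - trunc N x))\<^sup>2 + (norm (trunc N x))\<^sup>2"
      unfolding norm_add_sq by simp
    then show ?thesis by (simp add: norm_trunc_sq)
  qed
  have "(\<lambda>N. \<Sum>n<N. (norm (coef x n))\<^sup>2) \<longlonglongrightarrow> (norm x)\<^sup>2"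
    unfolding l2_norm_sq using summable_coef_sq summable_LIMSEQ by blast
  then have "(\<lambda>N. (norm (x - trunc N x))\<^sup>2) \<longlonglongrightarrow> (norm x)\<^sup>2 - (norm x)\<^sup>2"
    unfolding eq by (intro tendsto_intros)
  then have "(\<lambda>N. sqrt ((norm (x - trunc N x))\<^sup>2)) \<longlonglongrightarrow> sqrt 0"
    by (intro tendsto_real_sqrt) simp
  then have "(\<lambda>N. norm (trunc N x - x)) \<longlonglongrightarrow> 0"
    by (simp add: norm_minus_commute)
  then show ?thesis by (simp add: tendsto_norm_zero_iff LIM_zero_iff)
qed

section \<open>Integration over the circle\<close>

text \<open>One period with unnormalised Lebesgue measure, matching the set integral in
  \<open>fourier_coeff\<close>; its total mass is the source of the factors 2 pi below.\<close>

definition Circ :: "real measure" where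
  "Circ = restrict_space lborel {0..2*pi}"

lemma space_Circ [simp]: "space Circ = {0..2*pi}"
  by (simp add: Circ_def space_restrict_space)

lemma measurable_Circ [measurable_dest]: "f \<in> borel_measurable borel \<Longrightarrow> f \<in> borel_measurable Circ"
  unfolding Circ_def by (rule measurable_restrict_space1) simp

lemma finite_measure_Circ: "finite_measure Circ"
  by (rule finite_measureI) (simp add: Circ_def emeasure_restrict_space space_restrict_space)

interpretation Circ: finite_measure Circ by (rule finite_measure_Circ)

lemma measure_Circ: "measure Circ (space Circ) = 2 * pi"
  unfolding Circ_def by (subst measure_restrict_space) (auto simp: space_restrict_space)

lemma integrable_Circ_iff: "integrable Circ f \<longleftrightarrow> set_integrable lborel {0..2*pi} f"
  for f :: "real \<Rightarrow> 'a :: {banach, second_countable_topology}"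
  unfolding Circ_def set_integrable_def by (subst integrable_restrict_space) auto

lemma integral_Circ_eq: "integral\<^sup>L Circ f = (LINT t:{0..2*pi}|lborel. f t)"
  for f :: "real \<Rightarrow> 'a :: {banach, second_countable_topology}"
  unfolding Circ_def set_lebesgue_integral_def by (subst integral_restrict_space) auto

lemma AE_Circ_iff: "(AE t in Circ. P t) \<longleftrightarrow> (AE t in lborel. t \<in> {0..2*pi} \<longrightarrow> P t)"
  unfolding Circ_def by (subst AE_restrict_space_iff) auto

lemma integrable_Circ_continuous:
  fixes f :: "real \<Rightarrow> 'a :: euclidean_space"
  assumes "continuous_on UNIV f"
  shows "integrable Circ f"
  unfolding integrable_Circ_iff
  by (rule borel_integrable_atLeastAtMost') (rule continuous_on_subset[OF assms], simp)

lemma integral_Circ_cis: "(\<integral>t. cis (real_of_int k * t) \<partial>Circ) = (if k = 0 then 2 * pi else 0)"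
proof (cases "k = 0")
  case True
  then show ?thesis
    using measure_Circ by (simp add: scaleR_conv_of_real)
next
  case False
  have "(\<integral>t. indicator {0..2*pi} t *\<^sub>R cis (real_of_int k * t) \<partial>lborel) =
      cis (real_of_int k * (2*pi)) / (\<i> * k) - cis (real_of_int k * 0) / (\<i> * k)"
  proof (rule integral_FTC_Icc)
    fix t :: real
    show "((\<lambda>t. cis (real_of_int k * t) / (\<i> * k)) has_vector_derivative cis (real_of_int k * t)) (at t within {0..2*pi})"
      unfolding cis_conv_exp of_real_mult of_real_of_int_eq using False
      by (intro has_vector_derivative_real_field[of "\<lambda>z. exp (\<i> * (of_int k * z)) / (\<i> * of_int k)"])
        (auto intro!: derivative_eq_intros simp: field_simps)
  qed (auto intro!: continuous_intros)
  moreover have "cis (real_of_int k * (2*pi)) = 1"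
    using cis_multiple_2pi[of k] by (simp add: mult_ac)
  ultimately show ?thesis
    using False by (simp add: integral_Circ_eq set_lebesgue_integral_def)
qed

definition tp :: "nat \<Rightarrow> l2 \<Rightarrow> real \<Rightarrow> complex" where
  "tp N x t = (\<Sum>n<N. coef x n * cis (real n * t))"

lemma continuous_tp [continuous_intros]: "continuous_on A (tp N x)"
  unfolding tp_def by (intro continuous_intros)

lemma tp_periodic: "tp N x (t + 2 * pi) = tp N x t"
proof -
  have "cis (real n * (t + 2 * pi)) = cis (real n * t)" for n
    using cis_multiple_2pi[of "real n"] by (simp add: distrib_left cis_mult[symmetric] mult_ac)
  then show ?thesis by (simp add: tp_def)
qed

lemma measurable_tp [measurable]: "tp N x \<in> borel_measurable borel"
  by (intro borel_measurable_continuous_onI continuous_tp)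

lemma integral_tp_cis: "(\<integral>t. tp N x t * cis (- (real_of_int k * t)) \<partial>Circ) =
  2 * pi * (if 0 \<le> k \<and> k < int N then coef x (nat k) else 0)"
proof -
  have "(\<integral>t. tp N x t * cis (- (real_of_int k * t)) \<partial>Circ) =
      (\<integral>t. (\<Sum>n<N. coef x n * cis (real_of_int (int n - k) * t)) \<partial>Circ)"
    unfolding tp_def sum_distrib_right
    by (intro Bochner_Integration.integral_cong sum.cong refl) (simp add: mult.assoc cis_mult left_diff_distrib)
  also have "\<dots> = (\<Sum>n<N. coef x n * (\<integral>t. cis (real_of_int (int n - k) * t) \<partial>Circ))"
    by (subst Bochner_Integration.integral_sum)
      (auto intro!: integrable_Circ_continuous continuous_intros sum.cong Bochner_Integration.integral_mult_right)
  also have "\<dots> = (\<Sum>n<N. if int n = k then 2 * pi * coef x n else 0)"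
    unfolding integral_Circ_cis by (intro sum.cong) auto
  also have "\<dots> = 2 * pi * (if 0 \<le> k \<and> k < int N then coef x (nat k) else 0)"
  proof (cases "0 \<le> k")
    case True
    then obtain j where "k = int j" using nonneg_int_cases by blast
    then show ?thesis by simp
  next
    case False
    then have "int n \<noteq> k" for n by simp
    then show ?thesis using False by simp
  qed
  finally show ?thesis .
qed

lemma integral_mult_cnj_tp:
  assumes g: "integrable Circ g"
  shows "(\<integral>t. g t * cnj (tp N x t) \<partial>Circ) = (\<Sum>n<N. cnj (coef x n) * (\<integral>t. g t * cis (- (real_of_int (int n) * t)) \<partial>Circ))"
proof -
  have int: "integrable Circ (\<lambda>t. g t * cis (- (real_of_int (int n) * t)))" for n
  proof (rule Bochner_Integration.integrable_bound[OF g])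
    have "(\<lambda>t. cis (- (real_of_int (int n) * t))) \<in> borel_measurable Circ"
      by (intro measurable_Circ borel_measurable_continuous_onI continuous_intros)
    then show "(\<lambda>t. g t * cis (- (real_of_int (int n) * t))) \<in> borel_measurable Circ"
      using borel_measurable_times[OF borel_measurable_integrable[OF g]] by blast
  qed (simp add: norm_mult)
  have "(\<integral>t. g t * cnj (tp N x t) \<partial>Circ) = (\<integral>t. (\<Sum>n<N. cnj (coef x n) * (g t * cis (- (real_of_int (int n) * t)))) \<partial>Circ)"
    by (rule Bochner_Integration.integral_cong) (auto simp: tp_def sum_distrib_left cis_cnj mult_ac)
  also have "\<dots> = (\<Sum>n<N. cnj (coef x n) * (\<integral>t. g t * cis (- (real_of_int (int n) * t)) \<partial>Circ))"
    by (subst Bochner_Integration.integral_sum) (auto intro!: Bochner_Integration.integrable_mult_right sum.cong Bochner_Integration.integral_mult_right_zero simp: int simp del: of_int_of_nat_eq)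
  finally show ?thesis .
qed

lemma integral_tp_norm_sq: "(\<integral>t. (norm (tp N x t))\<^sup>2 \<partial>Circ) = 2 * pi * (norm (trunc N x))\<^sup>2"
proof -
  have "complex_of_real (\<integral>t. (norm (tp N x t))\<^sup>2 \<partial>Circ) = (\<integral>t. tp N x t * cnj (tp N x t) \<partial>Circ)"
    unfolding integral_complex_of_real[symmetric] by (simp only: complex_norm_square)
  also have "\<dots> = (\<Sum>n<N. cnj (coef x n) * (2 * pi * coef x n))"
    by (subst integral_mult_cnj_tp) (auto intro!: integrable_Circ_continuous continuous_intros sum.cong simp: integral_tp_cis simp del: of_int_of_nat_eq)
  also have "\<dots> = complex_of_real (2 * pi * (norm (trunc N x))\<^sup>2)"
    unfolding norm_trunc_sq of_real_mult of_real_sum complex_norm_square sum_distrib_left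
    by (intro sum.cong) (auto simp: mult_ac)
  finally show ?thesis unfolding of_real_eq_iff .
qed

section \<open>Formal products and spans\<close>

text \<open>Formal series carry the products that may leave H^2: no convergence has to be discussed,
  and \<open>ps\<close> is injective, so equations can be pulled back.\<close>

definition ps :: "l2 \<Rightarrow> complex fps" where
  "ps x = Abs_fps (coef x)"

lemma fps_nth_ps [simp]: "fps_nth (ps x) n = coef x n"
  by (simp add: ps_def)

lemma ps_inject [simp]: "ps x = ps y \<longleftrightarrow> x = y"
  by (auto simp: fps_eq_iff intro: l2_eqI)

lemma ps_add [simp]: "ps (x + y) = ps x + ps y"
  and ps_cmul [simp]: "ps (c *\<^sub>c x) = fps_const c * ps x"
  and ps_shift [simp]: "ps (shift x) = fps_X * ps x"
  by (rule fps_ext; auto simp: coef_shift split: nat.splits)+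

lemma ps_0 [simp]: "ps 0 = 0"
  by (rule fps_ext) simp

lemma ps_sum [simp]: "ps (\<Sum>i\<in>A. f i) = (\<Sum>i\<in>A. ps (f i))"
  by (induction A rule: infinite_finite_induct) auto

lemma ps_shift_pow [simp]: "ps ((shift ^^ i) x) = fps_X ^ i * ps x"
  by (induction i) (auto simp: mult.assoc)

lemma shift_pow_cmul [simp]: "(shift ^^ n) (c *\<^sub>c x) = c *\<^sub>c (shift ^^ n) x"
  by (induction n) auto

lemma bshift_pow_cmul [simp]: "(bshift ^^ n) (c *\<^sub>c x) = c *\<^sub>c (bshift ^^ n) x"
  by (induction n) auto

lemma shift_pow_sum: "(shift ^^ n) (\<Sum>i\<in>A. f i) = (\<Sum>i\<in>A. (shift ^^ n) (f i))"
proof -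
  have "shift (\<Sum>i\<in>A. f i) = (\<Sum>i\<in>A. shift (f i))" for f :: "_ \<Rightarrow> l2"
    by (rule linear_sum) (rule bounded_linear.linear[OF bounded_linear_shift])
  then show ?thesis by (induction n) auto
qed

lemma coef_bshift_pow [simp]: "coef ((bshift ^^ n) x) k = coef x (n + k)"
  by (induction n arbitrary: k) auto

lemma coef_shift_pow: "coef ((shift ^^ n) x) k = (if k < n then 0 else coef x (k - n))"
proof (induction n arbitrary: k)
  case (Suc n)
  then show ?case by (cases k) auto
qed simp

lemma cip_shift_pow_left: "cip ((shift ^^ n) x) y = cip x ((bshift ^^ n) y)"
proof (induction n arbitrary: y)
  case (Suc n)
  have "cip ((shift ^^ Suc n) x) y = cip x ((bshift ^^ n) (bshift y))"
    by (simp add: cip_shift_left Suc)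
  then show ?case by (simp add: funpow_swap1)
qed simp

lemma cip_shift_pow_right: "cip x ((shift ^^ n) y) = cip ((bshift ^^ n) x) y"
  by (metis cip_shift_pow_left cnj_cip)

lemma cip_shift_pow_cancel:
  "cip ((shift ^^ i) x) ((shift ^^ j) y) =
    (if i \<le> j then cip x ((shift ^^ (j - i)) y) else cip ((shift ^^ (i - j)) x) y)"
proof -
  have *: "cip ((shift ^^ n) x) ((shift ^^ n) y) = cip x y" for n x y
    by (induction n) auto
  show ?thesis
  proof (cases "i \<le> j")
    case True
    then have "(shift ^^ j) y = (shift ^^ i) ((shift ^^ (j - i)) y)"
      by (simp flip: funpow_add o_apply[of "shift ^^ i"])
    then show ?thesis using True by (simp add: *)
  next
    case False
    then have "(shift ^^ i) x = (shift ^^ j) ((shift ^^ (i - j)) x)"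
      by (simp flip: funpow_add o_apply[of "shift ^^ j"])
    then show ?thesis using False by (simp add: *)
  qed
qed

lemma tendsto_shift_pow: "(X \<longlongrightarrow> x) F \<Longrightarrow> ((\<lambda>k. (shift ^^ n) (X k)) \<longlongrightarrow> (shift ^^ n) x) F"
  by (induction n) (auto intro: tendsto_shift)

text \<open>The algebraic span, not its closure: elements are finite sums, to which maps apply term
  by term, and closures enter only through the limits in
  \<open>orthogonal_decomposition\<close>.\<close>

definition cspan :: "(nat \<Rightarrow> l2) \<Rightarrow> l2 set" where
  "cspan X = {x. \<exists>N c. x = (\<Sum>i<N. c i *\<^sub>c X i)}"

lemma cspanI: "(\<Sum>i<N. c i *\<^sub>c X i) \<in> cspan X"
  unfolding cspan_def by blast

lemma csub_cspan: "csub (cspan X)"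
proof -
  have pad: "(\<Sum>i<N. c i *\<^sub>c X i) = (\<Sum>i<N+M. (if i \<in> {..<N} then c i else 0) *\<^sub>c X i)" for N M :: nat and c
    by (rule sum.mono_neutral_cong_left) auto
  have "x + y \<in> cspan X" if xy: "x \<in> cspan X" "y \<in> cspan X" for x y
  proof -
    obtain N c M d where "x = (\<Sum>i<N. c i *\<^sub>c X i)" "y = (\<Sum>i<M. d i *\<^sub>c X i)"
      using xy by (auto simp: cspan_def)
    then have "x + y = (\<Sum>i<N+M. ((if i \<in> {..<N} then c i else 0) + (if i \<in> {..<M} then d i else 0)) *\<^sub>c X i)"
      unfolding cmul.add_left sum.distrib
      using pad[where N = N and M = M and c = c] pad[where N = M and M = N and c = d]
      by (simp only: add.commute[of M N])
    then show ?thesis by (simp only: cspanI)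
  qed
  moreover have "a *\<^sub>c x \<in> cspan X" if x: "x \<in> cspan X" for a x
  proof -
    obtain N c where "x = (\<Sum>i<N. c i *\<^sub>c X i)" using x by (auto simp: cspan_def)
    then have "a *\<^sub>c x = (\<Sum>i<N. (a * c i) *\<^sub>c X i)" by (simp add: cmul.sum_right)
    then show ?thesis by (simp only: cspanI)
  qed
  moreover have "0 \<in> cspan X" unfolding cspan_def by (auto intro!: exI[of _ 0])
  ultimately show ?thesis by (simp add: csub_def)
qed

lemma cspan_base: "X i \<in> cspan X"
proof -
  have "X i = (\<Sum>j<Suc i. (if j = i then 1 else 0) *\<^sub>c X j)"
    by (subst sum.lessThan_Suc) simp
  then show ?thesis by (metis cspanI)
qed

lemma cspan_subset: "csub V \<Longrightarrow> (\<And>i. X i \<in> V) \<Longrightarrow> cspan X \<subseteq> V"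
  by (auto simp: cspan_def intro!: csub_sum csubD(3))

section \<open>Inner functions\<close>

text \<open>The inner product of \<open>a\<close> and \<open>z\<^sup>n a\<close> is a Fourier coefficient of \<open>|a|\<^sup>2\<close>, so this says that \<open>|a| = 1\<close>
  on the circle.\<close>

definition inner2 :: "l2 \<Rightarrow> bool" where
  "inner2 a \<longleftrightarrow> (\<forall>n. cip a ((shift ^^ n) a) = (if n = 0 then 1 else 0))"

lemma inner2_orth:
  assumes "inner2 a"
  shows "cip ((shift ^^ i) a) ((shift ^^ j) a) = (if i = j then 1 else 0)"
proof -
  have *: "cip a ((shift ^^ n) a) = (if n = 0 then 1 else 0)" for n
    using assms by (simp add: inner2_def)
  have "cip ((shift ^^ n) a) a = (if n = 0 then 1 else 0)" for n
    using arg_cong[OF *[of n], of cnj] by (simp add: cnj_cip split: if_splits)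
  then show ?thesis using *[of 0] by (auto simp: cip_shift_pow_cancel *)
qed

lemma inner2_norm: "inner2 a \<Longrightarrow> norm a = 1"
proof -
  assume "inner2 a"
  then have "cip a a = 1" unfolding inner2_def by (metis funpow_0)
  then have "(norm a)\<^sup>2 = 1" unfolding cip_self of_real_eq_1_iff .
  then show ?thesis by (simp add: power2_eq_1_iff)
      (metis add.inverse_inverse abs_norm_cancel abs_minus_cancel abs_one norm_ge_zero)
qed

text \<open>The translates of \<open>a\<close> are orthonormal, so the sum of the
  \<open>coef x i *\<^sub>c (shift ^^ i) a\<close> converges and depends isometrically on
  \<open>x\<close>. Each coefficient of the partial sums is eventually constant, which identifies
  the limit with the formal product.\<close>

lemma inner2_multiplier:
  assumes "inner2 a"
  obtains Y where "\<And>x. ps (Y x) = ps a * ps x" "\<And>x y. cip (Y x) (Y y) = cip x y"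
proof -
  define P where "P x N = (\<Sum>i<N. coef x i *\<^sub>c (shift ^^ i) a)" for x and N :: nat
  have cip_P: "cip (P x N) (P y M) = cip (trunc N x) (trunc M y)" for x y N M
  proof -
    have "cip (P x N) (P y M) = (\<Sum>i<N. \<Sum>j<M. if j = i then coef x i * cnj (coef y j) else 0)"
      unfolding P_def cip.sum_left unfolding cip.sum_right
      by (intro sum.cong refl) (auto simp: inner2_orth[OF assms])
    also have "\<dots> = (\<Sum>i<N. coef x i * cnj (coef (trunc M y) i))"
      by (simp add: sum.delta if_distrib cong: if_cong)
    also have "\<dots> = cip (trunc N x) (trunc M y)"
      unfolding cip_def by (subst suminf_finite[of "{..<N}"]) auto
    finally show ?thesis .
  qed
  have "norm (P x N - P x M) = norm (trunc N x - trunc M x)" for x and N M :: nat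
    by (rule norm_eqI_cip) (simp add: cip.diff_left cip.diff_right cip_P)
  moreover have "Cauchy (\<lambda>N. trunc N x)" for x
    using tendsto_trunc LIMSEQ_imp_Cauchy by blast
  ultimately have "Cauchy (P x)" for x
    by (simp add: Cauchy_def dist_norm)
  then have "\<forall>x. \<exists>y. P x \<longlonglongrightarrow> y"
    using Cauchy_convergent_iff convergent_def by blast
  then obtain Y where Y: "\<And>x. P x \<longlonglongrightarrow> Y x" by metis
  show ?thesis
  proof
    fix x y
    have "(\<lambda>N. cip (P x N) (P y N)) \<longlonglongrightarrow> cip (Y x) (Y y)"
      by (intro cip.tendsto Y)
    moreover have "(\<lambda>N. cip (trunc N x) (trunc N y)) \<longlonglongrightarrow> cip x y"
      by (intro cip.tendsto tendsto_trunc)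
    ultimately show "cip (Y x) (Y y) = cip x y"
      unfolding cip_P by (rule LIMSEQ_unique)
    show "ps (Y x) = ps a * ps x"
    proof (rule fps_ext)
      fix n
      have "coef (P x N) n = fps_nth (ps a * ps x) n" if "N > n" for N
      proof -
        have "coef (P x N) n = (\<Sum>i<N. coef x i * (if n < i then 0 else coef a (n - i)))"
          by (simp add: P_def coef_shift_pow)
        also have "\<dots> = (\<Sum>i=0..n. coef x i * coef a (n - i))"
          using that by (intro sum.mono_neutral_cong_right) auto
        finally show ?thesis by (simp add: fps_mult_nth mult.commute[of "ps a"])
      qed
      then have "(\<lambda>N. coef (P x N) n) \<longlonglongrightarrow> fps_nth (ps a * ps x) n"
        by (intro tendsto_eventually eventually_mono[OF eventually_gt_at_top[of n]])
      moreover have "(\<lambda>N. coef (P x N) n) \<longlonglongrightarrow> coef (Y x) n"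
        by (intro tendsto_coef Y)
      ultimately show "fps_nth (ps (Y x)) n = fps_nth (ps a * ps x) n"
        by (simp add: LIMSEQ_unique)
    qed
  qed
qed

text \<open>The two-sided translates of an inner function span; approximating \<open>z\<^sup>N\<close> by
  \<open>\<theta> \<sigma>\<close> with \<open>\<sigma>\<close> the reversed truncation of \<open>\<theta>\<close> avoids leaving \<open>H\<^sup>2\<close>.\<close>

lemma inner2_total:
  assumes a: "inner2 a" and 1: "\<And>n. cip ((shift ^^ n) a) x = 0" and 2: "\<And>n. cip ((bshift ^^ n) a) x = 0"
  shows "x = 0"
proof (rule l2_eqI)
  fix n
  have key: "norm (coef x n) \<le> sqrt (1 - (norm (trunc N a))\<^sup>2) * norm x" if N: "N > n" for N
  proof -
    define y where "y = (\<Sum>k<N. cnj (coef a k) *\<^sub>c (shift ^^ (N - k)) a)"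
    define e where "e = (shift ^^ N) one2"
    have cy: "coef y N = (norm (trunc N a))\<^sup>2"
    proof -
      have "coef y N = (\<Sum>k<N. of_real ((norm (coef a k))\<^sup>2))"
        unfolding y_def coef_sum
        unfolding complex_norm_square
        by (intro sum.cong refl) (auto simp: coef_shift_pow mult.commute)
      then show ?thesis by (simp add: norm_trunc_sq)
    qed
    have one2: "cip z one2 = coef z 0" for z
      unfolding cip_def by (subst suminf_finite[of "{0}"]) (auto simp: coef_one2)
    have ye: "cip y e = (norm (trunc N a))\<^sup>2"
      by (simp add: e_def cip_shift_pow_right one2 cy)
    have ee: "cip e e = 1"
      by (simp add: e_def cip_shift_pow_cancel one2 coef_one2)
    have yy: "cip y y = (norm (trunc N a))\<^sup>2"
    proof -
      have "cip y y = (\<Sum>i<N. \<Sum>j<N. if j = i then of_real ((norm (coef a i))\<^sup>2) else 0)"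
        unfolding y_def cip.sum_left cip.sum_right complex_norm_square
        by (intro sum.cong refl) (auto simp: inner2_orth[OF a] mult.commute)
      then show ?thesis by (simp add: norm_trunc_sq)
    qed
    have "complex_of_real ((norm (e - y))\<^sup>2) = cip e e - cip y e - cnj (cip y e) + cip y y"
      unfolding cip_self[symmetric] by (simp add: cip.diff_left cip.diff_right cnj_cip)
    also have "\<dots> = complex_of_real (1 - (norm (trunc N a))\<^sup>2)"
      unfolding ye yy ee by simp
    finally have "(norm (e - y))\<^sup>2 = 1 - (norm (trunc N a))\<^sup>2"
      unfolding of_real_eq_iff .
    then have ney: "norm (e - y) = sqrt (1 - (norm (trunc N a))\<^sup>2)"
      by (metis norm_ge_zero real_sqrt_unique)
    \<comment> \<open>Cancelling the common power turns each pairing into one of the two hypotheses.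
      Thus \<open>y\<close> is orthogonal to the translate of \<open>x\<close>, while
      \<open>e\<close>, which is z^N, picks out its coefficient \<open>n\<close>; that coefficient
      is controlled by the distance from \<open>e\<close> to \<open>y\<close>.\<close>
    have "cip ((shift ^^ i) a) ((shift ^^ j) x) = 0" for i j
      using 1[of "i - j"] 2[of "j - i"] by (simp add: cip_shift_pow_cancel[of i a] cip_shift_pow_right[of a])
    then have "cip y ((shift ^^ (N - n)) x) = 0"
      by (simp add: y_def cip.sum_left)
    moreover have "cip e ((shift ^^ (N - n)) x) = cnj (coef x n)"
    proof -
      have "cip ((shift ^^ (N - n)) x) e = coef x n"
        using N by (simp add: e_def cip_shift_pow_right one2 coef_shift_pow)
      then show ?thesis by (metis cnj_cip)
    qed
    ultimately have "cnj (coef x n) = cip (e - y) ((shift ^^ (N - n)) x)"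
      by (simp add: cip.diff_left)
    then have "norm (coef x n) \<le> norm (e - y) * norm ((shift ^^ (N - n)) x)"
      by (metis complex_mod_cnj norm_cip_le)
    moreover have "norm ((shift ^^ j) x) = norm x" for j
      by (induction j) auto
    ultimately show ?thesis using ney by simp
  qed
  have "(\<lambda>N. sqrt (1 - (norm (trunc N a))\<^sup>2) * norm x) \<longlonglongrightarrow> sqrt (1 - (norm a)\<^sup>2) * norm x"
    by (intro tendsto_intros tendsto_trunc)
  then have "norm (coef x n) \<le> sqrt (1 - (norm a)\<^sup>2) * norm x"
    by (rule tendsto_lowerbound) (auto intro!: eventually_mono[OF eventually_gt_at_top[of n]] key)
  then show "coef x n = coef 0 n" by (simp add: inner2_norm[OF a])
qed

text \<open>With the next lemma this makes the Fourier coefficients of a times the conjugate of x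
  pairings of x with two-sided translates of a: backward shifts for nonnegative frequencies, forward
  shifts for negative ones. Membership in \<open>RanH\<close> becomes orthogonality to the forward
  shifts.\<close>

lemma theta_bar_coeff_nonneg: "theta_bar_coeff (coef a) (coef x) (int n) = cip ((bshift ^^ n) a) x"
  unfolding theta_bar_coeff_def cip_def by (simp add: nat_add_distrib)

lemma theta_bar_coeff_nonpos: "theta_bar_coeff (coef a) (coef x) (- int n) = cip ((shift ^^ n) a) x"
  unfolding theta_bar_coeff_def cip_def coef_shift_pow
  by (rule arg_cong[where f = suminf]) (auto simp: fun_eq_iff nat_diff_distrib' nat_int_add)

section \<open>The fixed space of an antilinear Hankel operator\<close>

text \<open>Abstracts the operator H / s, so that the eigenvalue s^2 of the square becomes 1.
  \<open>B_sym\<close> is the symmetry of the Hankel matrix and \<open>B_shift\<close> its constancy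
  along antidiagonals.\<close>

locale antilinear_hankel =
  fixes B :: "l2 \<Rightarrow> l2"
  assumes B_add: "B (x + y) = B x + B y"
    and B_cmul: "B (c *\<^sub>c x) = cnj c *\<^sub>c B x"
    and B_bounded: "\<exists>K. \<forall>x. norm (B x) \<le> norm x * K"
    and B_sym: "cip (B x) y = cip (B y) x"
    and B_shift: "B (shift x) = bshift (B x)"
begin

lemma bounded_linear_B: "bounded_linear B"
proof -
  obtain K where "\<And>x. norm (B x) \<le> norm x * K" using B_bounded by blast
  then show ?thesis
    by (intro bounded_linear_intro[where K = K]) (auto simp: B_add scaleR_eq_cmul B_cmul)
qed

lemmas tendsto_B = bounded_linear.tendsto[OF bounded_linear_B]

lemma B_diff: "B (x - y) = B x - B y"
  using bounded_linear_B by (simp add: linear_simps)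

definition E :: "l2 set" where
  "E = {x. B (B x) = x}"

lemma E_iff: "x \<in> E \<longleftrightarrow> B (B x) = x"
  by (simp add: E_def)

lemma BB_E [simp]: "x \<in> E \<Longrightarrow> B (B x) = x"
  by (simp add: E_def)

lemma csub_E: "csub E"
  using linear_0[OF bounded_linear.linear[OF bounded_linear_B]]
  by (auto simp: csub_def E_iff B_add B_cmul)

lemmas E_intros [intro] = csubD[OF csub_E]

lemma B_in_E [intro]: "x \<in> E \<Longrightarrow> B x \<in> E"
  by (simp add: E_iff)

lemma E_lim: "(\<And>k. v k \<in> E) \<Longrightarrow> v \<longlonglongrightarrow> x \<Longrightarrow> x \<in> E"
proof -
  assume v: "\<And>k. v k \<in> E" "v \<longlonglongrightarrow> x"
  have "(\<lambda>k. B (B (v k))) \<longlonglongrightarrow> B (B x)" by (intro tendsto_B v)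
  then show "x \<in> E"
    using v LIMSEQ_unique by (simp add: E_iff)
qed

lemma cip_B_B: "x \<in> E \<Longrightarrow> cip (B x) (B y) = cip y x"
  by (metis B_sym BB_E cnj_cip)

text \<open>Since B S = S^* B and S S^* is the identity minus the projection onto constants, the
  defect of \<open>bshift x\<close> from being fixed is a multiple of the single vector
  \<open>B one2\<close>. Membership in \<open>E\<close> is thereby reduced to the vanishing of one
  scalar.\<close>

lemma BB_bshift:
  assumes "x \<in> E" "coef x 0 = 0"
  shows "B (B (bshift x)) = bshift x + cnj (coef (B (bshift x)) 0) *\<^sub>c B one2"
proof -
  define g where "g = bshift x"
  have sg: "shift g = x" using assms(2) by (simp add: g_def shift_bshift)
  have "g = bshift (B (B (shift g)))"
    using assms(1) by (simp only: sg BB_E) (simp add: g_def)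
  also have "\<dots> = B (shift (bshift (B g)))"
    by (simp add: B_shift)
  also have "\<dots> = B (B g) - cnj (coef (B g) 0) *\<^sub>c B one2"
    by (simp add: shift_bshift B_diff B_cmul)
  finally show ?thesis by (simp add: g_def algebra_simps)
qed

lemma coef_B_0: "coef (B x) 0 = cip (B one2) x"
proof -
  have "coef (B x) 0 = cip (B x) one2"
    unfolding cip_def by (subst suminf_finite[of "{0}"]) (auto simp: coef_one2)
  then show ?thesis by (simp add: B_sym)
qed

end

section \<open>Near invariance and the extremal vector\<close>

locale schmidt = antilinear_hankel +
  assumes E_ne: "E \<noteq> {0}"
begin

text \<open>The common order of vanishing at the origin. It can be positive: all of E may vanish at
  0, and then the constant term cannot single out an extremal vector.\<close>

definition m :: nat where
  "m = (LEAST n. \<exists>x\<in>E. coef x n \<noteq> 0)"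

lemma ex_coef_m: "\<exists>x\<in>E. coef x m \<noteq> 0"
proof -
  obtain x where "x \<in> E" "x \<noteq> 0" using E_ne E_intros(1) by blast
  then have "\<exists>n. \<exists>x\<in>E. coef x n \<noteq> 0" by (metis coef_zero l2_eqI)
  then show ?thesis unfolding m_def by (rule LeastI_ex)
qed

lemma coef_less_m: "x \<in> E \<Longrightarrow> n < m \<Longrightarrow> coef x n = 0"
  unfolding m_def using not_less_Least by blast

lemma coef_0_E:
  assumes "x \<in> E" "coef x m = 0"
  shows "coef x 0 = 0"
  using assms coef_less_m[of x 0] by (cases m) auto

lemma B_one2_nonzero:
  assumes "m = 0" shows "B one2 \<noteq> 0"
proof
  assume "B one2 = 0"
  then have "coef (B x) 0 = 0" for x by (simp add: coef_B_0)
  then show False using ex_coef_m assms by (metis BB_E)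
qed

text \<open>For \<open>m > 0\<close> the space of \<open>x \<in> E\<close> with \<open>bshift x \<in> E\<close> has codimension at most one in \<open>E\<close>
  and is contained in the space of those with \<open>coef x m = 0\<close>, so both coincide.\<close>

lemma nearly_invariant:
  assumes x: "x \<in> E" "coef x m = 0"
  shows "bshift x \<in> E"
proof -
  have *: "bshift y \<in> E" if "y \<in> E" "coef y 0 = 0" "coef (B (bshift y)) 0 = 0" for y
    using BB_bshift[of y] that by (simp add: E_iff)
  have x0: "coef x 0 = 0" using coef_0_E x .
  have "coef (B (bshift x)) 0 = 0"
  proof (cases "m = 0")
    case True
    define g where "g = bshift x"
    define l where "l = coef (B g) 0"
    obtain y where y: "y \<in> E" "coef y 0 \<noteq> 0" using ex_coef_m True by auto
    \<comment> \<open>Pairing the rank one identity with \<open>B y\<close> cancels \<open>g\<close>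
      by symmetry and leaves the defect scalar times the constant term of \<open>y\<close>, which is
      nonzero.\<close>
    have "cip (B (B g)) (B y) = cip y (B g)"
      using B_sym[of "B g" "B y"] y by simp
    also have "\<dots> = cip g (B y)"
      by (metis B_sym cnj_cip)
    finally have "cnj l * cip (B one2) (B y) = 0"
      using BB_bshift[OF x(1) x0] by (simp add: g_def l_def cip.add_left)
    moreover have "cip (B one2) (B y) = coef y 0"
      using coef_B_0[of "B y"] y by simp
    ultimately show ?thesis using y by (simp add: l_def g_def)
  next
    case False
    obtain y where y: "y \<in> E" "coef y m \<noteq> 0" using ex_coef_m by auto
    show ?thesis
    proof (rule ccontr)
      define l l' where "l = coef (B (bshift x)) 0" and "l' = coef (B (bshift y)) 0"
      assume "coef (B (bshift x)) 0 \<noteq> 0"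
      \<comment> \<open>The combination of \<open>x\<close> and \<open>y\<close> whose defect scalar
        vanishes. Its backward shift lies in \<open>E\<close> yet has a nonzero coefficient at
        \<open>m - 1\<close>, against the minimality of \<open>m\<close>.\<close>
      define z where "z = y - cnj (l' / l) *\<^sub>c x"
      have z: "z \<in> E" unfolding z_def using x y by auto
      have "coef (B (bshift z)) 0 = l' - l' / l * l"
        by (simp add: z_def B_diff B_cmul l_def l'_def)
      then have "coef (B (bshift z)) 0 = 0"
        using \<open>coef (B (bshift x)) 0 \<noteq> 0\<close> by (simp add: l_def)
      moreover have "coef z 0 = 0" using coef_less_m[OF z] False by simp
      ultimately have "bshift z \<in> E" using * z by blast
      then have "coef (bshift z) (m - 1) = 0" by (rule coef_less_m) (use False in simp)
      then show False using False x y by (simp add: z_def)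
    qed
  qed
  then show ?thesis using * x(1) x0 by blast
qed

definition p :: l2 where
  "p = (SOME p. p \<in> E \<and> norm p = 1 \<and> (\<forall>x\<in>E. coef x m = 0 \<longrightarrow> cip x p = 0))"

lemma p_props: "p \<in> E" "norm p = 1" "x \<in> E \<Longrightarrow> coef x m = 0 \<Longrightarrow> cip x p = 0"
proof -
  define E0 where "E0 = {x\<in>E. coef x m = 0}"
  have "csub E0" using csub_E by (auto simp: csub_def E0_def)
  obtain y where y: "y \<in> E" "coef y m \<noteq> 0" using ex_coef_m by auto
  obtain v r where v: "\<And>k. v k \<in> E0" "v \<longlonglongrightarrow> y - r" and r: "\<And>x. x \<in> E0 \<Longrightarrow> cip r x = 0"
    using orthogonal_decomposition[OF \<open>csub E0\<close>, where f = y] by metis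
  have "y - r \<in> E" using E_lim[of v] v by (auto simp: E0_def)
  then have rE: "r \<in> E" using E_intros(5)[OF y(1)] by fastforce
  have "(\<lambda>k. coef (v k) m) \<longlonglongrightarrow> coef (y - r) m" by (intro tendsto_coef v)
  moreover have "coef (v k) m = 0" for k using v(1) by (simp add: E0_def)
  \<comment> \<open>The projection \<open>y - r\<close> is a limit of elements with vanishing
    coefficient \<open>m\<close>, so \<open>r\<close> inherits that of \<open>y\<close> and cannot
    be zero.\<close>
  ultimately have "coef y m = coef r m" using LIMSEQ_unique[of "\<lambda>_. 0" "coef (y - r) m" 0] by auto
  then have "r \<noteq> 0" using y by auto
  define q where "q = inverse (norm r) *\<^sub>R r"
  have "q \<in> E \<and> norm q = 1 \<and> (\<forall>x\<in>E. coef x m = 0 \<longrightarrow> cip x q = 0)"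
  proof (intro conjI ballI impI)
    show "q \<in> E" unfolding q_def using rE by auto
    show "norm q = 1" using \<open>r \<noteq> 0\<close> by (simp add: q_def)
    show "cip x q = 0" if "x \<in> E" "coef x m = 0" for x
      using r[of x] that cnj_cip[of r x] by (simp add: E0_def q_def cip.scaleR_right)
  qed
  then have "p \<in> E \<and> norm p = 1 \<and> (\<forall>x\<in>E. coef x m = 0 \<longrightarrow> cip x p = 0)"
    unfolding p_def by (rule someI)
  then show "p \<in> E" "norm p = 1" "x \<in> E \<Longrightarrow> coef x m = 0 \<Longrightarrow> cip x p = 0" by auto
qed

lemma cip_p_p [simp]: "cip p p = 1"
  by (simp add: cip_self p_props)

lemma coef_p_m: "coef p m \<noteq> 0"
  using p_props(3)[OF p_props(1)] by auto

lemma cip_p_eq: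
  assumes "x \<in> E"
  shows "cip x p = coef x m / coef p m"
proof -
  have "x - (coef x m / coef p m) *\<^sub>c p \<in> E" using assms p_props by auto
  then have "cip (x - (coef x m / coef p m) *\<^sub>c p) p = 0"
    by (rule p_props) (use coef_p_m in simp)
  then show ?thesis by (simp add: cip.diff_left)
qed

lemma cip_p_eq_0_iff: "x \<in> E \<Longrightarrow> cip x p = 0 \<longleftrightarrow> coef x m = 0"
  using cip_p_eq coef_p_m by simp

section \<open>Iterated division by p and the quotient map V\<close>

definition R :: "l2 \<Rightarrow> l2" where
  "R x = bshift (x - cip x p *\<^sub>c p)"

lemma R_add: "R (x + y) = R x + R y"
  and R_cmul: "R (c *\<^sub>c x) = c *\<^sub>c R x"
  by (simp_all add: R_def cip.add_left cmul.add_left cmul.diff_right algebra_simps)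

lemma R_pow_add: "(R ^^ n) (x + y) = (R ^^ n) x + (R ^^ n) y"
  and R_pow_cmul: "(R ^^ n) (c *\<^sub>c x) = c *\<^sub>c (R ^^ n) x"
  by (induction n) (auto simp: R_add R_cmul)

lemma R_pow_diff: "(R ^^ n) (x - y) = (R ^^ n) x - (R ^^ n) y"
  using R_pow_add[of n "x - y" y] by simp

lemma R_pow_sum: "(R ^^ n) (\<Sum>i\<in>A. f i) = (\<Sum>i\<in>A. (R ^^ n) (f i))"
proof -
  have "(R ^^ n) 0 = 0" using R_pow_diff[of n 0 0] by simp
  then show ?thesis by (induction A rule: infinite_finite_induct) (auto simp: R_pow_add)
qed

lemma diff_p_in_E:
  assumes "x \<in> E"
  shows "x - cip x p *\<^sub>c p \<in> E" "coef (x - cip x p *\<^sub>c p) m = 0"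
  using assms p_props coef_p_m by (auto simp: cip_p_eq)

lemma shift_R: "x \<in> E \<Longrightarrow> shift (R x) = x - cip x p *\<^sub>c p"
  unfolding R_def shift_bshift using coef_0_E[OF diff_p_in_E] by simp

lemma R_in_E [intro]: "x \<in> E \<Longrightarrow> R x \<in> E"
  unfolding R_def by (intro nearly_invariant diff_p_in_E)

lemma R_pow_in_E [intro]: "x \<in> E \<Longrightarrow> (R ^^ n) x \<in> E"
  by (induction n) auto

lemma cip_R_R:
  assumes "x \<in> E" "y \<in> E"
  shows "cip (R x) (R y) = cip x y - cip x p * cnj (cip y p)"
proof -
  have "cip (R x) (R y) = cip (x - cip x p *\<^sub>c p) (y - cip y p *\<^sub>c p)"
    using assms by (simp flip: shift_R)
  then show ?thesis
    by (simp add: cip.diff_left cip.diff_right cnj_cip)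
qed

text \<open>Telescopes \<open>cip_R_R\<close>. The last term is the only thing that keeps
  \<open>V\<close> from being isometric.\<close>

lemma sum_cip_R:
  assumes "x \<in> E" "y \<in> E"
  shows "(\<Sum>j<N. cip ((R ^^ j) x) p * cnj (cip ((R ^^ j) y) p)) = cip x y - cip ((R ^^ N) x) ((R ^^ N) y)"
  using assms by (induction N) (auto simp: cip_R_R R_pow_in_E)

lemma sum_norm_R:
  assumes "x \<in> E"
  shows "(\<Sum>j<N. (norm (cip ((R ^^ j) x) p))\<^sup>2) = (norm x)\<^sup>2 - (norm ((R ^^ N) x))\<^sup>2"
proof -
  have "complex_of_real (\<Sum>j<N. (norm (cip ((R ^^ j) x) p))\<^sup>2) = of_real ((norm x)\<^sup>2 - (norm ((R ^^ N) x))\<^sup>2)"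
    using sum_cip_R[OF assms assms, of N] unfolding cip_self of_real_sum complex_norm_square of_real_diff .
  then show ?thesis unfolding of_real_eq_iff .
qed

lemma norm_R_pow_le: "x \<in> E \<Longrightarrow> norm ((R ^^ N) x) \<le> norm x"
proof -
  assume "x \<in> E"
  from sum_norm_R[OF this, of N] have "(norm ((R ^^ N) x))\<^sup>2 \<le> (norm x)\<^sup>2"
    by (metis diff_ge_0_iff_ge sum_nonneg zero_le_power2)
  then show ?thesis by (simp add: power2_le_iff_abs_le)
qed

definition V :: "l2 \<Rightarrow> l2" where
  "V x = l2_of (\<lambda>n. cip ((R ^^ n) x) p)"

lemma coef_V: "x \<in> E \<Longrightarrow> coef (V x) n = cip ((R ^^ n) x) p"
proof -
  assume x: "x \<in> E"
  have "(\<lambda>n. cip ((R ^^ n) x) p) \<in> H2"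
    by (rule H2_bounded_sums[of _ "(norm x)\<^sup>2"]) (simp add: sum_norm_R[OF x])
  then show ?thesis by (simp add: V_def)
qed

lemma V_R_pow: "x \<in> E \<Longrightarrow> V ((R ^^ n) x) = (bshift ^^ n) (V x)"
proof (rule l2_eqI)
  fix k assume "x \<in> E"
  then show "coef (V ((R ^^ n) x)) k = coef ((bshift ^^ n) (V x)) k"
    by (simp add: coef_V R_pow_in_E add.commute[of n] funpow_add)
qed

lemma V_add: "x \<in> E \<Longrightarrow> y \<in> E \<Longrightarrow> V (x + y) = V x + V y"
  and V_cmul: "x \<in> E \<Longrightarrow> V (c *\<^sub>c x) = c *\<^sub>c V x"
  by (rule l2_eqI, simp add: coef_V E_intros R_pow_add R_pow_cmul cip.add_left)+

lemma V_diff: "x \<in> E \<Longrightarrow> y \<in> E \<Longrightarrow> V (x - y) = V x - V y"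
  using V_add[of "x - y" y] E_intros(5)[of x y] by simp

text \<open>In x = a(x) p + z R x the factor z lowers the index, so induction on the coefficient
  with \<open>x\<close> replaced by \<open>R x\<close> works and no remainder has to be
  estimated.\<close>

lemma ps_V: "x \<in> E \<Longrightarrow> ps x = ps p * ps (V x)"
proof (rule fps_ext)
  fix n
  show "x \<in> E \<Longrightarrow> fps_nth (ps x) n = fps_nth (ps p * ps (V x)) n"
  proof (induction n arbitrary: x)
    case 0
    have "coef x 0 = coef (cip x p *\<^sub>c p + shift (R x)) 0" using 0 by (simp add: shift_R)
    then show ?case using 0 by (simp add: coef_V fps_mult_nth)
  next
    case (Suc n)
    have "coef x (Suc n) = coef (cip x p *\<^sub>c p + shift (R x)) (Suc n)" using Suc.prems by (simp add: shift_R)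
    also have "\<dots> = cip x p * coef p (Suc n) + fps_nth (ps (V (R x)) * ps p) n"
      using Suc.IH[of "R x"] Suc.prems by (auto simp: mult.commute)
    also have "\<dots> = coef (V x) 0 * coef p (Suc n) + (\<Sum>i=0..n. coef (V x) (Suc i) * coef p (n - i))"
      using Suc.prems V_R_pow[of x 1] by (simp add: fps_mult_nth coef_V)
    also have "\<dots> = (\<Sum>i=0..Suc n. coef (V x) i * coef p (Suc n - i))"
      unfolding sum.atLeast0_atMost_Suc_shift by simp
    also have "\<dots> = fps_nth (ps (V x) * ps p) (Suc n)"
      by (simp only: fps_mult_nth fps_nth_ps)
    finally show ?case by (simp add: mult.commute)
  qed
qed

text \<open>For \<open>m = 0\<close> this is \<open>BB_bshift\<close> read backwards:
  \<open>R x\<close> is fixed and \<open>B one2\<close> is nonzero, so the scalar in front of it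
  vanishes. For \<open>m > 0\<close> the backward shift of \<open>B (R x)\<close> lies in
  \<open>E\<close> and hence has no coefficient at \<open>m - 1\<close>.\<close>

lemma coef_B_R:
  assumes x: "x \<in> E"
  shows "coef (B (R x)) m = 0"
proof (cases "m = 0")
  case True
  define y where "y = x - cip x p *\<^sub>c p"
  have y: "y \<in> E" "coef y 0 = 0" using diff_p_in_E[OF x] True by (simp_all add: y_def)
  have "bshift y = R x" by (simp add: y_def R_def)
  then have "cnj (coef (B (R x)) 0) *\<^sub>c B one2 = 0"
    using BB_bshift[OF y] R_in_E[OF x] by simp
  then show ?thesis using B_one2_nonzero True by simp
next
  case False
  have "bshift (B (R x)) = B (x - cip x p *\<^sub>c p)"
    using x by (simp add: shift_R flip: B_shift)
  then have "bshift (B (R x)) \<in> E" using diff_p_in_E[OF x] by auto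
  then have "coef (bshift (B (R x))) (m - 1) = 0" by (rule coef_less_m) (use False in simp)
  then show ?thesis using False by simp
qed

lemma cip_B_R_p: "x \<in> E \<Longrightarrow> cip (B (R x)) p = 0"
  using coef_B_R[of x] cip_p_eq_0_iff[of "B (R x)"] by auto

lemma B_decomp: "x \<in> E \<Longrightarrow> B x = cnj (cip x p) *\<^sub>c B p + R (B (R x))"
proof -
  assume x: "x \<in> E"
  have "R (B (R x)) = B (shift (R x))"
    unfolding R_def[of "B (R x)"] cip_B_R_p[OF x] by (simp add: B_shift)
  then show ?thesis using x by (simp add: shift_R B_diff B_cmul)
qed

text \<open>On \<open>E\<close> this reads B R = R^* B, the counterpart of B S = S^* B. In
  \<open>B_decomp\<close> the component along \<open>B p\<close> drops out because
  \<open>B p\<close> is orthogonal to the range of \<open>R\<close>.\<close>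

lemma cip_B_R:
  assumes "x \<in> E" "y \<in> E"
  shows "cip (B x) (R y) = cip (B (R x)) y"
proof -
  have "cip (B p) (R y) = 0" using cip_B_R_p[OF assms(2)] B_sym by metis
  then have "cip (B x) (R y) = cip (R (B (R x))) (R y)"
    using assms by (subst B_decomp) (auto simp: cip.add_left)
  also have "\<dots> = cip (B (R x)) y"
    using assms by (simp add: cip_R_R R_in_E B_in_E cip_B_R_p)
  finally show ?thesis .
qed

lemma cip_B_R_pow: "x \<in> E \<Longrightarrow> y \<in> E \<Longrightarrow> cip (B x) ((R ^^ n) y) = cip (B ((R ^^ n) x)) y"
proof (induction n arbitrary: x)
  case (Suc n)
  then show ?case using cip_B_R[of x "(R ^^ n) y"] Suc.IH[of "R x"]
    by (simp add: R_pow_in_E R_in_E funpow_swap1)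
qed simp

text \<open>Writes the coefficients of \<open>V (B x)\<close> as pairings of \<open>x\<close> with
  the fixed vectors \<open>(R ^^ n) (B p)\<close>; under \<open>V\<close> these become the backward
  shifts of \<theta>.\<close>

lemma cip_R_pow_Bp: "x \<in> E \<Longrightarrow> cip ((R ^^ n) (B x)) p = cip ((R ^^ n) (B p)) x"
proof -
  assume x: "x \<in> E"
  have "cip x ((R ^^ n) (B p)) = cip (B (B x)) ((R ^^ n) (B p))" using x by simp
  also have "\<dots> = cip (B ((R ^^ n) (B x))) (B p)"
    using x p_props(1) by (intro cip_B_R_pow) auto
  also have "\<dots> = cip p ((R ^^ n) (B x))"
    using x by (simp add: cip_B_B R_pow_in_E B_in_E)
  finally show ?thesis by (metis cnj_cip)
qed

end

section \<open>The inner function and the identification of the range of V\<close>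

context schmidt
begin

definition \<theta> :: l2 where
  "\<theta> = V (B p)"

lemma B_p_in_E: "B p \<in> E"
  using p_props(1) by auto

lemma ps_B_p: "ps (B p) = ps p * ps \<theta>"
  unfolding \<theta>_def by (rule ps_V[OF B_p_in_E])

text \<open>Since \<open>B\<close> turns powers of S into powers of S^*, the symmetry of
  \<open>B\<close> moves each power from \<open>B p\<close> to \<open>p\<close>. Equality of these
  autocorrelations is the equality of |B p| and |p| on the circle.\<close>

lemma cip_shift_B_p: "cip ((shift ^^ i) (B p)) ((shift ^^ j) (B p)) = cip ((shift ^^ i) p) ((shift ^^ j) p)"
proof -
  have B_shift_pow: "B ((shift ^^ n) x) = (bshift ^^ n) (B x)" for n x
    by (induction n) (auto simp: B_shift)
  have *: "cip (B p) ((shift ^^ n) (B p)) = cip p ((shift ^^ n) p)" for n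
  proof -
    have "cip (B p) ((shift ^^ n) (B p)) = cip (B ((shift ^^ n) p)) (B p)"
      by (simp add: cip_shift_pow_right B_shift_pow)
    also have "\<dots> = cip (B (B p)) ((shift ^^ n) p)" by (rule B_sym)
    finally show ?thesis using p_props(1) by simp
  qed
  have "cip ((shift ^^ n) (B p)) (B p) = cip ((shift ^^ n) p) p" for n
    using *[of n] by (metis cnj_cip)
  then show ?thesis by (simp add: cip_shift_pow_cancel *)
qed

text \<open>\<open>B p\<close> and \<open>p\<close> have the same modulus on the circle, so multiplication by \<open>\<theta>\<close> is an isometry
  from the shift-invariant subspace generated by \<open>p\<close> onto the one generated by \<open>B p\<close>. It maps
  the inner generator \<open>r\<close> of the former to the inner function \<open>\<theta> r\<close>, hence \<open>\<theta>\<close> is inner.\<close>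

lemma inner2_theta: "inner2 \<theta>"
proof -
  \<comment> \<open>As in the Wold decomposition, \<open>r\<close> is the part of \<open>p\<close>
    orthogonal to the span of z p, z^2 p, and so on.\<close>
  define X where "X i = (shift ^^ Suc i) p" for i
  obtain v r where v: "\<And>k::nat. v k \<in> cspan X" "v \<longlonglongrightarrow> p - r"
    and r: "\<And>x. x \<in> cspan X \<Longrightarrow> cip r x = 0"
    using orthogonal_decomposition[OF csub_cspan, where f = p] by metis
  from v(1) have "\<forall>k. \<exists>N c. v k = (\<Sum>i<N. c i *\<^sub>c X i)" by (simp add: cspan_def)
  then obtain N c where vk: "\<And>k. v k = (\<Sum>i<N k. c k i *\<^sub>c X i)" by metis
  \<comment> \<open>Rewrites \<open>p - v k\<close> as a polynomial in the shift applied to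
    \<open>p\<close>, so that the same polynomial can be applied to \<open>B p\<close>.\<close>
  define d where "d k i = (case i of 0 \<Rightarrow> 1 | Suc j \<Rightarrow> - c k j)" for k i
  define w where "w k x = (\<Sum>i<Suc (N k). d k i *\<^sub>c (shift ^^ i) x)" for k x
  have wp: "w k p = p - v k" for k
    unfolding w_def sum.lessThan_Suc_shift vk
    by (simp add: d_def X_def sum_negf cmul.minus_left)
  have lim: "(\<lambda>k. w k p) \<longlonglongrightarrow> r"
  proof -
    have "(\<lambda>k. p - v k) \<longlonglongrightarrow> p - (p - r)" by (intro tendsto_intros v)
    then show ?thesis by (simp add: wp)
  qed
  have cip_w: "cip (w k (B p)) ((shift ^^ n) (w l (B p))) = cip (w k p) ((shift ^^ n) (w l p))" for k l n
  proof -
    have "(shift ^^ n) ((shift ^^ i) x) = (shift ^^ (n + i)) x" for i x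
      by (simp add: funpow_add)
    then show ?thesis
      by (simp only: w_def shift_pow_sum cip.sum_left cip.sum_right shift_pow_cmul cip_cmul_left
          cip_cmul_right cip_shift_B_p)
  qed
  have "norm (w k (B p) - w l (B p)) = norm (w k p - w l p)" for k l
    using cip_w[of _ 0] by (intro norm_eqI_cip) (simp add: cip.diff_left cip.diff_right)
  moreover have "Cauchy (\<lambda>k. w k p)" using lim LIMSEQ_imp_Cauchy by blast
  ultimately have "Cauchy (\<lambda>k. w k (B p))" by (simp add: Cauchy_def dist_norm)
  then obtain q where q: "(\<lambda>k. w k (B p)) \<longlonglongrightarrow> q"
    using Cauchy_convergent_iff convergent_def by blast
  have q_r: "cip q ((shift ^^ n) q) = cip r ((shift ^^ n) r)" for n
  proof -
    have "(\<lambda>k. cip (w k (B p)) ((shift ^^ n) (w k (B p)))) \<longlonglongrightarrow> cip q ((shift ^^ n) q)"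
      by (intro cip.tendsto tendsto_shift_pow q)
    moreover have "(\<lambda>k. cip (w k p) ((shift ^^ n) (w k p))) \<longlonglongrightarrow> cip r ((shift ^^ n) r)"
      by (intro cip.tendsto tendsto_shift_pow lim)
    ultimately show ?thesis unfolding cip_w by (rule LIMSEQ_unique)
  qed
  have r_orth: "cip r ((shift ^^ n) r) = 0" if "n > 0" for n
  proof -
    have "cip r ((shift ^^ n) (w k p)) = 0" for k
    proof -
      \<comment> \<open>For n > 0 every term of z^n times the polynomial multiple of
        \<open>p\<close> lies in the span to which \<open>r\<close> is orthogonal.\<close>
      have "(shift ^^ n) ((shift ^^ i) p) = X (n + i - 1)" for i
      proof -
        have "(shift ^^ n) ((shift ^^ i) p) = (shift ^^ (n + i)) p" by (simp add: funpow_add)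
        also have "n + i = Suc (n + i - 1)" using that by simp
        finally show ?thesis unfolding X_def .
      qed
      then show ?thesis
        by (simp only: w_def shift_pow_sum cip.sum_right shift_pow_cmul cip_cmul_right
            r[OF cspan_base] mult_zero_right sum.neutral_const)
    qed
    moreover have "(\<lambda>k. cip r ((shift ^^ n) (w k p))) \<longlonglongrightarrow> cip r ((shift ^^ n) r)"
      by (intro cip.tendsto tendsto_shift_pow lim tendsto_const)
    ultimately show ?thesis by (simp add: LIMSEQ_const_iff)
  qed
  have r0: "r \<noteq> 0"
  proof
    assume "r = 0"
    \<comment> \<open>Proper shifts of \<open>p\<close> vanish at index \<open>m\<close>, as
      \<open>p\<close> has no lower coefficients; so their combinations cannot converge to
      \<open>p\<close>.\<close>
    have "coef (v k) m = 0" for k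
      unfolding vk coef_sum using coef_less_m[OF p_props(1)]
      by (intro sum.neutral ballI) (auto simp: X_def coef_shift_pow simp del: funpow.simps)
    moreover have "(\<lambda>k. coef (v k) m) \<longlonglongrightarrow> coef (p - r) m" by (intro tendsto_coef v)
    ultimately show False using \<open>r = 0\<close> coef_p_m by (simp add: LIMSEQ_const_iff)
  qed
  have q_ps: "ps q = ps r * ps \<theta>"
  proof (rule fps_ext)
    fix n
    have "ps (w k (B p)) = ps (w k p) * ps \<theta>" for k
      by (simp add: w_def sum_distrib_right ps_B_p mult.assoc del: sum.lessThan_Suc)
    then have "fps_nth (ps (w k (B p))) n = fps_nth (ps (w k p) * ps \<theta>) n" for k
      by simp
    then have "coef (w k (B p)) n = (\<Sum>i=0..n. coef (w k p) i * coef \<theta> (n - i))" for k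
      by (simp only: fps_mult_nth fps_nth_ps)
    moreover have "(\<lambda>k. \<Sum>i=0..n. coef (w k p) i * coef \<theta> (n - i)) \<longlonglongrightarrow> (\<Sum>i=0..n. coef r i * coef \<theta> (n - i))"
      by (intro tendsto_intros tendsto_coef lim)
    moreover have "(\<lambda>k. coef (w k (B p)) n) \<longlonglongrightarrow> coef q n" by (intro tendsto_coef q)
    ultimately have "coef q n = (\<Sum>i=0..n. coef r i * coef \<theta> (n - i))"
      by (simp add: LIMSEQ_unique)
    then show "fps_nth (ps q) n = fps_nth (ps r * ps \<theta>) n" by (simp add: fps_mult_nth)
  qed
  define t where "t = complex_of_real (1 / norm r)"
  have t: "cnj t * t * cip r r = 1"
    using r0 unfolding t_def cip_self by (simp add: power2_eq_square)
  define a where "a = t *\<^sub>c r"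
  have inner_a: "inner2 a"
    unfolding inner2_def a_def using r_orth t by (auto simp: mult_ac)
  obtain Y where Y: "\<And>x. ps (Y x) = ps a * ps x" "\<And>x y. cip (Y x) (Y y) = cip x y"
    using inner2_multiplier[OF inner_a] by blast
  \<comment> \<open>Because a \<theta> = t q, the isometric multiplication by \<open>a\<close>
    carries the autocorrelation of \<theta> to that of \<open>t *\<^sub>c q\<close>, which equals
    that of \<open>a\<close>.\<close>
  have "cip \<theta> ((shift ^^ n) \<theta>) = cip a ((shift ^^ n) a)" for n
  proof -
    have "ps (Y ((shift ^^ n) \<theta>)) = ps (t *\<^sub>c (shift ^^ n) q)"
      by (simp add: Y a_def q_ps mult_ac)
    then have 1: "Y ((shift ^^ n) \<theta>) = t *\<^sub>c (shift ^^ n) q" by (simp only: ps_inject)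
    have "ps (Y \<theta>) = ps (t *\<^sub>c q)"
      by (simp add: Y a_def q_ps mult_ac)
    then have 2: "Y \<theta> = t *\<^sub>c q" by (simp only: ps_inject)
    have "cip \<theta> ((shift ^^ n) \<theta>) = cip (t *\<^sub>c q) (t *\<^sub>c (shift ^^ n) q)"
      using Y(2)[of \<theta> "(shift ^^ n) \<theta>"] unfolding 1 2 ..
    then show ?thesis by (simp add: a_def q_r)
  qed
  then show ?thesis using inner_a by (simp add: inner2_def)
qed

lemma norm_B_p: "norm (B p) = 1"
  using cip_shift_B_p[of 0 0] p_props(2) by (metis funpow_0 norm_eqI_cip)

lemma R_pow_B_p: "(\<lambda>N. (R ^^ N) (B p)) \<longlonglongrightarrow> 0"
proof -
  have eq: "(norm ((R ^^ N) (B p)))\<^sup>2 = 1 - (norm (trunc N \<theta>))\<^sup>2" for N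
    using sum_norm_R[OF B_p_in_E, of N] unfolding norm_trunc_sq
    by (simp add: norm_B_p \<theta>_def coef_V[OF B_p_in_E])
  have "(\<lambda>N. (norm ((R ^^ N) (B p)))\<^sup>2) \<longlonglongrightarrow> 1 - (norm \<theta>)\<^sup>2"
    unfolding eq by (intro tendsto_intros tendsto_trunc)
  then have "(\<lambda>N. sqrt ((norm ((R ^^ N) (B p)))\<^sup>2)) \<longlonglongrightarrow> sqrt 0"
    by (intro tendsto_real_sqrt) (simp add: inner2_norm[OF inner2_theta])
  then have "(\<lambda>N. norm ((R ^^ N) (B p))) \<longlonglongrightarrow> 0" by simp
  then show ?thesis by (rule tendsto_norm_zero_cancel)
qed

text \<open>The powers of \<open>R\<close> are contractions on \<open>E\<close>, so convergence on a
  dense set is enough. The vectors \<open>(R ^^ j) (B p)\<close> span such a set: for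
  \<open>r\<close> orthogonal to all of them \<open>V (B r) = 0\<close>, and \<open>ps_V\<close>
  then gives \<open>B r = 0\<close>.\<close>

lemma R_pow_lim:
  assumes x: "x \<in> E"
  shows "(\<lambda>N. (R ^^ N) x) \<longlonglongrightarrow> 0"
proof -
  define X where "X j = (R ^^ j) (B p)" for j
  have X_E: "cspan X \<subseteq> E"
    by (rule cspan_subset[OF csub_E]) (auto simp: X_def B_p_in_E)
  obtain v r where v: "\<And>k::nat. v k \<in> cspan X" "v \<longlonglongrightarrow> x - r"
    and r: "\<And>x. x \<in> cspan X \<Longrightarrow> cip r x = 0"
    using orthogonal_decomposition[OF csub_cspan, where f = x] by metis
  have "x - r \<in> E" using E_lim[of v] v X_E by auto
  then have rE: "r \<in> E" using E_intros(5)[OF x] by fastforce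
  have "coef (V (B r)) n = coef 0 n" for n
  proof -
    have "cip r ((R ^^ n) (B p)) = 0" using r cspan_base[of X n] by (simp add: X_def)
    then show ?thesis using rE cip_R_pow_Bp[OF rE] cnj_cip[of r "(R ^^ n) (B p)"]
      by (simp add: coef_V B_in_E)
  qed
  then have "V (B r) = 0" by (rule l2_eqI)
  then have "ps (B r) = 0" using ps_V[OF B_in_E[OF rE]] by simp
  then have "B r = 0" unfolding ps_0[symmetric] ps_inject .
  then have "r = 0" using BB_E[OF rE] B_diff[of 0 0] by simp
  then have vx: "v \<longlonglongrightarrow> x" using v by simp
  have null: "(\<lambda>N. (R ^^ N) y) \<longlonglongrightarrow> 0" if y_span: "y \<in> cspan X" for y
  proof -
    obtain M c where y: "y = (\<Sum>i<M. c i *\<^sub>c X i)" using y_span unfolding cspan_def by blast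
    have "(R ^^ N) y = (\<Sum>i<M. c i *\<^sub>c (R ^^ (N + i)) (B p))" for N
      by (simp add: y R_pow_sum R_pow_cmul X_def funpow_add)
    moreover have "(\<lambda>N. \<Sum>i<M. c i *\<^sub>c (R ^^ (N + i)) (B p)) \<longlonglongrightarrow> (\<Sum>i<M. c i *\<^sub>c 0)"
      by (intro tendsto_sum cmul.tendsto tendsto_const LIMSEQ_ignore_initial_segment R_pow_B_p)
    ultimately show ?thesis by simp
  qed
  show ?thesis
  proof (rule LIMSEQ_I)
    fix e :: real assume "e > 0"
    then obtain k where k: "norm (v k - x) < e / 2"
      using LIMSEQ_D[OF vx, of "e / 2"] by auto
    obtain M where M: "\<And>N. N \<ge> M \<Longrightarrow> norm ((R ^^ N) (v k)) < e / 2"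
      using LIMSEQ_D[OF null[OF v(1)[of k]], of "e / 2"] \<open>e > 0\<close> by auto
    have "norm ((R ^^ N) x) < e" if "N \<ge> M" for N
    proof -
      have "norm ((R ^^ N) (v k) - (R ^^ N) x) \<le> norm (v k - x)"
        unfolding R_pow_diff[symmetric] using v(1) X_E x by (intro norm_R_pow_le) auto
      then show ?thesis
        using k M[OF that] norm_triangle_ineq4[of "(R ^^ N) (v k)" "(R ^^ N) (v k) - (R ^^ N) x"] by simp
    qed
    then show "\<exists>no. \<forall>n\<ge>no. norm ((R ^^ n) x - 0) < e" by auto
  qed
qed

lemma cip_V:
  assumes "x \<in> E" "y \<in> E"
  shows "cip (V x) (V y) = cip x y"
proof -
  have "(\<lambda>N. \<Sum>j<N. coef (V x) j * cnj (coef (V y) j)) \<longlonglongrightarrow> cip (V x) (V y)"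
    using cip_sums[of "V x" "V y"] by (simp add: sums_def)
  moreover have "(\<lambda>N. cip x y - cip ((R ^^ N) x) ((R ^^ N) y)) \<longlonglongrightarrow> cip x y - cip 0 0"
    by (intro tendsto_intros cip.tendsto R_pow_lim assms)
  ultimately show ?thesis
    using LIMSEQ_unique by (simp add: coef_V assms sum_cip_R)
qed

lemma norm_V: "x \<in> E \<Longrightarrow> norm (V x) = norm x"
  by (rule norm_eqI_cip) (rule cip_V)

lemma coef_V_B:
  assumes "x \<in> E"
  shows "coef (V (B x)) n = cip ((bshift ^^ n) \<theta>) (V x)"
  using assms by (simp add: coef_V B_in_E cip_R_pow_Bp \<theta>_def cip_V R_pow_in_E B_p_in_E flip: V_R_pow)

text \<open>\<open>V\<close> transports to \<theta> the fact that \<open>B p\<close> is orthogonal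
  to the range of \<open>R\<close>; this kills the negative Fourier coefficients of \<theta> times
  the conjugate of \<open>V x\<close>.\<close>

lemma cip_theta_V:
  assumes "x \<in> E"
  shows "cip ((shift ^^ Suc n) \<theta>) (V x) = 0"
proof -
  have "cip ((shift ^^ Suc n) \<theta>) (V x) = cip (V (B p)) (V ((R ^^ Suc n) x))"
    using assms by (simp only: cip_shift_pow_left V_R_pow \<theta>_def)
  also have "\<dots> = cip (B p) (R ((R ^^ n) x))"
    using assms by (simp add: cip_V B_p_in_E R_in_E R_pow_in_E)
  also have "\<dots> = 0"
    using cip_B_R_p[of "(R ^^ n) x"] B_sym[of p "R ((R ^^ n) x)"] assms by (simp add: R_pow_in_E)
  finally show ?thesis .
qed

lemma V_in_RanH: "x \<in> E \<Longrightarrow> coef (V x) \<in> RanH (coef \<theta>)"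
  and theta_bar_V: "x \<in> E \<Longrightarrow> theta_bar (coef \<theta>) (coef (V x)) = coef (V (B x))"
proof -
  assume x: "x \<in> E"
  show *: "theta_bar (coef \<theta>) (coef (V x)) = coef (V (B x))"
    unfolding theta_bar_def by (simp add: fun_eq_iff theta_bar_coeff_nonneg coef_V_B[OF x])
  have "theta_bar_coeff (coef \<theta>) (coef (V x)) j = 0" if "j < 0" for j
  proof -
    define n where "n = nat (- j) - 1"
    have "j = - int (Suc n)" using that by (simp add: n_def)
    then show ?thesis using theta_bar_coeff_nonpos[of \<theta> "V x" "Suc n"] cip_theta_V[OF x, of n] by simp
  qed
  then show "coef (V x) \<in> RanH (coef \<theta>)" by (simp add: RanH_def *)
qed

text \<open>For the hard inclusion project \<open>g\<close> onto the span of the backward shifts of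
  \<theta>, which are values of \<open>V\<close>. The remainder is orthogonal to these, and to the
  forward shifts since both \<open>g\<close> and the values of \<open>V\<close> are, so it vanishes
  by \<open>inner2_total\<close>.\<close>

lemma RanH_theta: "RanH (coef \<theta>) = (\<lambda>x. coef (V x)) ` E"
proof (intro equalityI subsetI)
  fix f assume f: "f \<in> RanH (coef \<theta>)"
  define g where "g = l2_of f"
  have fg: "f = coef g" using f by (simp add: g_def RanH_def)
  have g_orth: "cip ((shift ^^ Suc n) \<theta>) g = 0" for n
    using f theta_bar_coeff_nonpos[of \<theta> g "Suc n"] by (simp add: RanH_def fg del: funpow.simps)
  define X where "X j = (R ^^ j) (B p)" for j
  define X' where "X' j = (bshift ^^ j) \<theta>" for j
  have XX: "V (X j) = X' j" and XE: "X j \<in> E" for j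
    by (auto simp: X_def X'_def \<theta>_def V_R_pow B_p_in_E)
  obtain v r where v: "\<And>k::nat. v k \<in> cspan X'" "v \<longlonglongrightarrow> g - r"
    and r: "\<And>x. x \<in> cspan X' \<Longrightarrow> cip r x = 0"
    using orthogonal_decomposition[OF csub_cspan, where f = g] by metis
  have "\<exists>y\<in>E. V y = z" if z: "z \<in> cspan X'" for z
  proof -
    have V0: "V 0 = 0" using V_diff[of 0 0] E_intros(1) by simp
    have VV: "csub (V ` E)"
      unfolding csub_def
    proof (intro conjI ballI allI)
      show "0 \<in> V ` E" using V0 E_intros(1) by (metis imageI)
    next
      fix x y assume "x \<in> V ` E" "y \<in> V ` E"
      then obtain x' y' where "x' \<in> E" "y' \<in> E" "x = V x'" "y = V y'" by blast
      then show "x + y \<in> V ` E" by (simp add: E_intros(2) flip: V_add)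
    next
      fix c x assume "x \<in> V ` E"
      then obtain x' where "x' \<in> E" "x = V x'" by blast
      then show "c *\<^sub>c x \<in> V ` E" by (simp add: E_intros(3) flip: V_cmul)
    qed
    have "cspan X' \<subseteq> V ` E"
      by (rule cspan_subset[OF VV]) (metis XX XE imageI)
    then show ?thesis using z by auto
  qed
  then have "\<forall>k. \<exists>y. y \<in> E \<and> V y = v k" using v(1) by blast
  then obtain y where y: "\<And>k. y k \<in> E" "\<And>k. V (y k) = v k" by metis
  have "r = 0"
  proof (rule inner2_total[OF inner2_theta])
    fix n
    have r2: "cip ((bshift ^^ n) \<theta>) r = 0" for n
      using r[OF cspan_base[of X' n]] cnj_cip[of r "X' n"] by (simp add: X'_def)
    then show "cip ((bshift ^^ n) \<theta>) r = 0" .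
    show "cip ((shift ^^ n) \<theta>) r = 0"
    proof (cases n)
      case 0
      then show ?thesis using r2[of 0] by simp
    next
      case (Suc k)
      have "(\<lambda>i. cip ((shift ^^ n) \<theta>) (g - v i)) \<longlonglongrightarrow> cip ((shift ^^ n) \<theta>) (g - (g - r))"
        by (intro cip.tendsto tendsto_intros v)
      moreover have "cip ((shift ^^ n) \<theta>) (g - v i) = 0" for i
        using cip_theta_V[OF y(1)[of i], of k] g_orth[of k] unfolding Suc by (simp only: cip.diff_right y diff_self)
      ultimately show ?thesis by (simp add: LIMSEQ_const_iff)
    qed
  qed
  then have vg: "v \<longlonglongrightarrow> g" using v by simp
  \<comment> \<open>The range of \<open>V\<close> is closed: preimages of a convergent sequence are
    Cauchy because \<open>V\<close> preserves norms.\<close>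
  have "norm (y k - y l) = norm (v k - v l)" for k l
    using norm_V[OF E_intros(5)[OF y(1) y(1)]] by (simp add: V_diff y)
  moreover have "Cauchy v" using vg LIMSEQ_imp_Cauchy by blast
  ultimately have "Cauchy y" by (simp add: Cauchy_def dist_norm)
  then obtain x where yx: "y \<longlonglongrightarrow> x" using Cauchy_convergent_iff convergent_def by blast
  have xE: "x \<in> E" using E_lim y yx by blast
  have "(\<lambda>k. norm (y k - x)) \<longlonglongrightarrow> 0" using yx by (simp add: LIM_zero tendsto_norm_zero)
  moreover have "norm (v k - V x) = norm (y k - x)" for k
    using norm_V[OF E_intros(5)[OF y(1) xE]] by (simp add: V_diff y xE)
  ultimately have "(\<lambda>k. norm (v k - V x)) \<longlonglongrightarrow> 0" by simp
  then have "(\<lambda>k. v k - V x) \<longlonglongrightarrow> 0" by (rule tendsto_norm_zero_cancel)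
  then have "v \<longlonglongrightarrow> V x" by (simp add: LIM_zero_iff)
  then have "V x = g" using vg LIMSEQ_unique by blast
  then show "f \<in> (\<lambda>x. coef (V x)) ` E" using xE fg by blast
qed (auto intro: V_in_RanH)

end

section \<open>Boundary values of inner functions\<close>

text \<open>Presents a product of two trigonometric polynomials as one whose coefficient vector is a
  sum of shifts, so that its mean square can be computed in \<open>l2\<close>.\<close>

lemma tp_mult:
  "tp N x t * tp M y t = tp (N + M) (\<Sum>i<M. coef y i *\<^sub>c (shift ^^ i) (trunc N x)) t"
proof -
  have s: "tp L ((shift ^^ i) (trunc N x)) t = cis (real i * t) * tp N x t" if "N + i \<le> L" for i L
  proof -
    have "tp L ((shift ^^ i) (trunc N x)) t = (\<Sum>n\<in>{i..<N+i}. coef x (n - i) * cis (real n * t))"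
      unfolding tp_def using that by (intro sum.mono_neutral_cong_right) (auto simp: coef_shift_pow)
    also have "\<dots> = (\<Sum>n<N. coef x n * cis (real (n + i) * t))"
      by (rule sum.reindex_bij_witness[of _ "\<lambda>n. n + i" "\<lambda>n. n - i"]) auto
    also have "\<dots> = cis (real i * t) * tp N x t"
    proof -
      have "cis (real (n + i) * t) = cis (real i * t) * cis (real n * t)" for n
        by (simp add: cis_mult distrib_right add.commute)
      then show ?thesis by (simp add: tp_def sum_distrib_left mult_ac)
    qed
    finally show ?thesis .
  qed
  have sum_cmul: "tp L (\<Sum>i<M. c i *\<^sub>c f i) t = (\<Sum>i<M. c i * tp L (f i) t)" for L c and f :: "nat \<Rightarrow> l2"
    unfolding tp_def coef_sum coef_cmul sum_distrib_right sum_distrib_left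
    by (subst sum.swap) (simp add: mult_ac)
  have "tp N x t * tp M y t = (\<Sum>i<M. coef y i * (cis (real i * t) * tp N x t))"
    unfolding tp_def[of M] sum_distrib_left by (intro sum.cong refl) (simp add: mult_ac)
  also have "\<dots> = tp (N + M) (\<Sum>i<M. coef y i *\<^sub>c (shift ^^ i) (trunc N x)) t"
    unfolding sum_cmul by (intro sum.cong refl) (simp add: s)
  finally show ?thesis .
qed

lemma Fatou_Circ:
  fixes f :: "nat \<Rightarrow> real \<Rightarrow> real"
  assumes lim: "AE t in Circ. (\<lambda>k. f k t) \<longlonglongrightarrow> h t" and int: "\<And>k. integrable Circ (f k)"
    and pos: "\<And>k t. f k t \<ge> 0" and bound: "\<And>k. (\<integral>t. f k t \<partial>Circ) \<le> b k" "b \<longlonglongrightarrow> C"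
    and h: "h \<in> borel_measurable Circ" "\<And>t. h t \<ge> 0"
  shows "integrable Circ h" "(\<integral>t. h t \<partial>Circ) \<le> C"
proof -
  have b0: "0 \<le> b k" for k
  proof -
    have "0 \<le> (\<integral>t. f k t \<partial>Circ)" by (rule Bochner_Integration.integral_nonneg) (rule pos)
    then show ?thesis using bound(1)[of k] by linarith
  qed
  have "(\<integral>\<^sup>+t. ennreal (h t) \<partial>Circ) = (\<integral>\<^sup>+t. liminf (\<lambda>k. ennreal (f k t)) \<partial>Circ)"
  proof (rule nn_integral_cong_AE)
    show "AE t in Circ. ennreal (h t) = liminf (\<lambda>k. ennreal (f k t))"
      using lim by eventually_elim (metis lim_imp_Liminf tendsto_ennrealI sequentially_bot)
  qed
  also have "\<dots> \<le> liminf (\<lambda>k. \<integral>\<^sup>+t. ennreal (f k t) \<partial>Circ)"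
    by (rule nn_integral_liminf) (use int in \<open>auto intro: borel_measurable_integrable\<close>)
  also have "\<dots> \<le> liminf (\<lambda>k. ennreal (b k))"
    by (intro Liminf_mono always_eventually allI)
      (simp add: nn_integral_eq_integral[OF int] pos ennreal_leI bound)
  also have "\<dots> = ennreal C"
    using bound(2) by (intro lim_imp_Liminf tendsto_ennrealI) auto
  finally have le: "(\<integral>\<^sup>+t. ennreal (h t) \<partial>Circ) \<le> ennreal C" .
  have "(\<integral>\<^sup>+t. ennreal (h t) \<partial>Circ) < \<infinity>"
    using le by (rule order_le_less_trans) simp
  then show "integrable Circ h"
    using h by (intro integrableI_nonneg) auto
  then have "ennreal (\<integral>t. h t \<partial>Circ) \<le> ennreal C"
    using le h by (simp add: nn_integral_eq_integral)
  moreover have "C \<ge> 0" using bound(2) by (rule tendsto_lowerbound) (auto simp: b0)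
  ultimately show "(\<integral>t. h t \<partial>Circ) \<le> C" by (simp add: ennreal_le_iff)
qed

text \<open>A rapidly convergent subsequence of the partial sums converges almost everywhere, and
  the sum of its increments gives a majorant \<open>W\<close> under which Fourier coefficients pass
  to the limit.\<close>

lemma Riesz_Fischer:
  obtains g r W where "g \<in> borel_measurable borel" "\<And>t. g (t + 2 * pi) = g t"
    "filterlim r at_top sequentially"
    "AE t in Circ. (\<lambda>k. tp (r k) x t) \<longlonglongrightarrow> g t"
    "integrable Circ W" "\<And>k. AE t in Circ. norm (tp (r k) x t) \<le> W t"
proof -
  have "Cauchy (\<lambda>N. trunc N x)" using tendsto_trunc LIMSEQ_imp_Cauchy by blast
  have "\<exists>M\<ge>k. \<forall>N\<ge>M. norm (trunc N x - trunc M x) \<le> (1/2) ^ k" for k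
  proof -
    obtain M where M: "\<And>m n. m \<ge> M \<Longrightarrow> n \<ge> M \<Longrightarrow> norm (trunc m x - trunc n x) < (1/2) ^ k"
    proof -
      have "(0::real) < (1/2) ^ k" by simp
      then show ?thesis using \<open>Cauchy _\<close> that unfolding Cauchy_def dist_norm by meson
    qed
    have "norm (trunc N x - trunc (max M k) x) \<le> (1/2) ^ k" if "N \<ge> max M k" for N
      using M[of N "max M k"] that by simp
    then show ?thesis by (meson max.cobounded2)
  qed
  then obtain r0 where r0: "\<And>k. r0 k \<ge> k" "\<And>k N. N \<ge> r0 k \<Longrightarrow> norm (trunc N x - trunc (r0 k) x) \<le> (1/2) ^ k"
    by metis
  \<comment> \<open>Partial sums make the indices monotone while keeping each one beyond
    \<open>r0 k\<close>.\<close>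
  define r where "r k = (\<Sum>j\<le>k. r0 j)" for k
  have r_ge: "r k \<ge> r0 k" for k unfolding r_def by (rule member_le_sum) auto
  have r_mono: "r k \<le> r (Suc k)" for k by (simp add: r_def)
  define D where "D k t = tp (r (Suc k)) x t - tp (r k) x t" for k t
  have D_tp: "D k t = tp (r (Suc k)) (x - trunc (r k) x) t" for k t
  proof -
    have "tp (r k) x t = tp (r (Suc k)) (trunc (r k) x) t"
      unfolding tp_def using r_mono[of k] by (intro sum.mono_neutral_cong_left) auto
    then show ?thesis by (simp add: D_def tp_def sum_subtractf algebra_simps)
  qed
  have D_int: "integrable Circ (\<lambda>t. norm (D k t))" for k
    unfolding D_tp by (intro integrable_Circ_continuous continuous_intros)
  have D_bound: "(\<integral>t. norm (D k t) \<partial>Circ) \<le> (4 * pi + 8 * pi) * (1/2) ^ k" for k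
  proof -
    define q :: real where "q = (1/2) ^ k"
    have q: "q > 0" by (simp add: q_def)
    \<comment> \<open>With \<open>q\<close> of the order of the L^2 size of the increment, this
      elementary inequality turns a mean square bound into an L^1 bound of order
      \<open>q\<close>.\<close>
    have le: "norm (D k t) \<le> q + (norm (D k t))\<^sup>2 / q" for t
    proof (cases "norm (D k t) \<le> q")
      case False
      then have "norm (D k t) * q \<le> norm (D k t) * norm (D k t)" by (intro mult_left_mono) auto
      then have "norm (D k t) \<le> (norm (D k t))\<^sup>2 / q"
        using q by (simp add: pos_le_divide_eq power2_eq_square)
      then show ?thesis using q by linarith
    next
      case True
      moreover have "0 \<le> (norm (D k t))\<^sup>2 / q" using q by simp
      ultimately show ?thesis by linarith
    qed
    have sq: "integrable Circ (\<lambda>t. (norm (D k t))\<^sup>2)"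
      unfolding D_tp by (intro integrable_Circ_continuous continuous_intros)
    have "trunc (r (Suc k)) (x - trunc (r k) x) = trunc (r (Suc k)) x - trunc (r k) x"
      using r_mono[of k] by (intro l2_eqI) auto
    then have "(\<integral>t. (norm (D k t))\<^sup>2 \<partial>Circ) = 2 * pi * (norm (trunc (r (Suc k)) x - trunc (r k) x))\<^sup>2"
      unfolding D_tp integral_tp_norm_sq by simp
    also have "norm (trunc (r (Suc k)) x - trunc (r k) x) \<le> norm (trunc (r (Suc k)) x - trunc (r0 k) x) + norm (trunc (r k) x - trunc (r0 k) x)"
      using norm_triangle_ineq4[of "trunc (r (Suc k)) x - trunc (r0 k) x" "trunc (r k) x - trunc (r0 k) x"] by simp
    then have "norm (trunc (r (Suc k)) x - trunc (r k) x) \<le> 2 * q"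
      using r0(2)[of k "r (Suc k)"] r0(2)[of k "r k"] r_ge[of k] r_mono[of k] unfolding q_def by linarith
    then have "2 * pi * (norm (trunc (r (Suc k)) x - trunc (r k) x))\<^sup>2 \<le> 2 * pi * (2 * q)\<^sup>2"
      by (intro mult_left_mono power_mono) auto
    finally have 2: "(\<integral>t. (norm (D k t))\<^sup>2 \<partial>Circ) \<le> 8 * pi * q * q" by (simp add: power2_eq_square mult_ac)
    have "(\<integral>t. norm (D k t) \<partial>Circ) \<le> (\<integral>t. q + (norm (D k t))\<^sup>2 / q \<partial>Circ)"
      by (rule integral_mono) (use D_int sq le in auto)
    also have "\<dots> = 2 * pi * q + (\<integral>t. (norm (D k t))\<^sup>2 \<partial>Circ) / q"
      using sq measure_Circ by (subst Bochner_Integration.integral_add) auto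
    also have "\<dots> \<le> 2 * pi * q + 8 * pi * q"
      using 2 q by (simp add: divide_le_eq mult_ac)
    also have "\<dots> \<le> (4 * pi + 8 * pi) * q" using q by (simp add: algebra_simps)
    finally show ?thesis by (simp add: q_def)
  qed
  have Dn: "(\<integral>\<^sup>+t. ennreal (norm (D k t)) \<partial>Circ) \<le> ennreal ((4 * pi + 8 * pi) * (1/2) ^ k)" for k
    using D_bound[of k] by (subst nn_integral_eq_integral[OF D_int]) (auto intro: ennreal_leI)
  have meas: "(\<lambda>t. ennreal (norm (D k t))) \<in> borel_measurable Circ" for k
    using D_int[of k] by (auto dest: borel_measurable_integrable)
  have sum1: "summable (\<lambda>k. (4 * pi + 8 * pi) * (1/2) ^ k)"
    by (intro summable_mult summable_geometric) simp
  have "(\<integral>\<^sup>+t. (\<Sum>k. ennreal (norm (D k t))) \<partial>Circ) = (\<Sum>k. \<integral>\<^sup>+t. ennreal (norm (D k t)) \<partial>Circ)"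
    by (rule nn_integral_suminf) (rule meas)
  also have "\<dots> \<le> (\<Sum>k. ennreal ((4 * pi + 8 * pi) * (1/2) ^ k))"
    by (intro suminf_le Dn) auto
  also have "\<dots> = ennreal (\<Sum>k. (4 * pi + 8 * pi) * (1/2) ^ k)"
    by (rule suminf_ennreal2) (auto intro: sum1)
  finally have fin: "(\<integral>\<^sup>+t. (\<Sum>k. ennreal (norm (D k t))) \<partial>Circ) < \<infinity>"
    by (rule order_le_less_trans) simp
  define W0 where "W0 t = (\<Sum>k. norm (D k t))" for t
  have "AE t in Circ. (\<Sum>k. ennreal (norm (D k t))) \<noteq> \<infinity>"
    using fin by (intro nn_integral_noteq_infinite) (auto intro: borel_measurable_suminf_order meas)
  then have AEsum: "AE t in Circ. summable (\<lambda>k. norm (D k t))"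
    by eventually_elim (auto intro: summable_suminf_not_top)
  have W0_meas: "W0 \<in> borel_measurable Circ"
    unfolding W0_def using D_int by (intro borel_measurable_suminf) (auto dest: borel_measurable_integrable)
  have W0_int: "integrable Circ W0"
  proof (rule integrableI_nonneg[OF W0_meas])
    show "AE t in Circ. 0 \<le> W0 t"
      using AEsum by eventually_elim (auto simp: W0_def intro: suminf_nonneg)
    have "(\<integral>\<^sup>+t. ennreal (W0 t) \<partial>Circ) = (\<integral>\<^sup>+t. (\<Sum>k. ennreal (norm (D k t))) \<partial>Circ)"
      by (rule nn_integral_cong_AE) (use AEsum in \<open>eventually_elim, auto simp: W0_def suminf_ennreal2\<close>)
    then show "(\<integral>\<^sup>+t. ennreal (W0 t) \<partial>Circ) < \<infinity>" using fin by simp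
  qed
  have tel: "tp (r k) x t = tp (r 0) x t + (\<Sum>j<k. D j t)" for k t
    by (induction k) (auto simp: D_def)
  define W where "W t = norm (tp (r 0) x t) + W0 t" for t
  \<comment> \<open>Defined by \<open>lim\<close> at every point: even where the sums diverge,
    \<open>t\<close> and \<open>t + 2 * pi\<close> give the same sequence, so the periodicity is
    exact.\<close>
  define g where "g t = lim (\<lambda>k. tp (r k) x t)" for t
  show ?thesis
  proof (rule that[of g r W])
    show "g \<in> borel_measurable borel"
      unfolding g_def by (intro borel_measurable_lim_metric measurable_tp)
    show "g (t + 2 * pi) = g t" for t by (simp add: g_def tp_periodic)
    have "k \<le> r k" for k using r0(1)[of k] r_ge[of k] by simp
    then show "filterlim r at_top sequentially"
      by (intro filterlim_at_top_mono[OF filterlim_ident]) auto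
    show "AE t in Circ. (\<lambda>k. tp (r k) x t) \<longlonglongrightarrow> g t"
      using AEsum
    proof eventually_elim
      case (elim t)
      then have "summable (\<lambda>k. D k t)" by (rule summable_norm_cancel)
      then have "convergent (\<lambda>k. tp (r 0) x t + (\<Sum>j<k. D j t))"
        by (intro convergent_add convergent_const) (simp add: summable_iff_convergent)
      moreover have "(\<lambda>k. tp (r k) x t) = (\<lambda>k. tp (r 0) x t + (\<Sum>j<k. D j t))"
        by (rule ext) (rule tel)
      ultimately have "convergent (\<lambda>k. tp (r k) x t)" by (simp only:)
      then show ?case by (simp add: g_def convergent_LIMSEQ_iff)
    qed
    show "integrable Circ W"
      unfolding W_def
      by (rule Bochner_Integration.integrable_add[OF integrable_Circ_continuous W0_int]) (intro continuous_intros)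
    show "AE t in Circ. norm (tp (r k) x t) \<le> W t" for k
      using AEsum
    proof eventually_elim
      case (elim t)
      have "norm (\<Sum>j<k. D j t) \<le> (\<Sum>j<k. norm (D j t))" by (rule norm_sum)
      also have "\<dots> \<le> W0 t" unfolding W0_def using elim by (intro sum_le_suminf) auto
      finally show ?case
        unfolding tel[of k] W_def using norm_triangle_ineq[of "tp (r 0) x t" "\<Sum>j<k. D j t"] by linarith
    qed
  qed
qed

text \<open>The second moment of |g| is at least 2 pi by Bessel's inequality and the fourth at most
  2 pi, so the integral of (|g|^2 - 1)^2 is not positive. This sidesteps the uniqueness theorem for
  the Fourier coefficients of |g|^2.\<close>

lemma inner2_imp_inner_fn:
  assumes x: "inner2 x"
  shows "inner_fn (coef x)"
proof -
  obtain g r W where g: "g \<in> borel_measurable borel" "\<And>t. g (t + 2 * pi) = g t"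
    and r: "filterlim r at_top sequentially"
    and lim: "AE t in Circ. (\<lambda>k. tp (r k) x t) \<longlonglongrightarrow> g t"
    and W: "integrable Circ W" "\<And>k. AE t in Circ. norm (tp (r k) x t) \<le> W t"
    using Riesz_Fischer[of x] by blast
  have gC: "g \<in> borel_measurable Circ" using g(1) by (rule measurable_Circ)
  have normx: "norm x = 1" using inner2_norm[OF x] .
  have trunc1: "norm (trunc N x) \<le> 1" for N
  proof -
    have "(norm (trunc N x))\<^sup>2 \<le> (norm x)\<^sup>2" unfolding norm_trunc_sq by (rule sum_coef_sq_le) simp
    then show ?thesis using normx by (simp add: abs_square_le_1)
  qed
  have lim_sq: "AE t in Circ. (\<lambda>k. (norm (tp (r k) x t))\<^sup>2) \<longlonglongrightarrow> (norm (g t))\<^sup>2"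
    using lim by eventually_elim (intro tendsto_intros)
  have g2: "integrable Circ (\<lambda>t. (norm (g t))\<^sup>2)"
  proof (rule Fatou_Circ(1)[OF lim_sq])
    show "(\<integral>t. (norm (tp (r k) x t))\<^sup>2 \<partial>Circ) \<le> 2 * pi" for k
      unfolding integral_tp_norm_sq using trunc1[of "r k"] by (simp add: power_le_one)
  qed (use gC in \<open>auto intro!: integrable_Circ_continuous continuous_intros\<close>)
  have g1: "integrable Circ g"
    using Circ.square_integrable_imp_integrable[of "\<lambda>t. norm (g t)"] gC g2 by (simp add: integrable_norm_iff)
  have coeffs: "(\<integral>t. g t * cis (- (real_of_int n * t)) \<partial>Circ) = 2 * pi * (if 0 \<le> n then coef x (nat n) else 0)" for n
  proof -
    have cis_meas: "(\<lambda>t. cis (- (real_of_int n * t))) \<in> borel_measurable Circ"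
      by (intro measurable_Circ borel_measurable_continuous_onI continuous_intros)
    have 1: "(\<lambda>k. \<integral>t. tp (r k) x t * cis (- (real_of_int n * t)) \<partial>Circ) \<longlonglongrightarrow> (\<integral>t. g t * cis (- (real_of_int n * t)) \<partial>Circ)"
    proof (rule integral_dominated_convergence[OF _ _ W(1)])
      show "(\<lambda>t. g t * cis (- (real_of_int n * t))) \<in> borel_measurable Circ"
        using borel_measurable_times[OF gC cis_meas] .
      show "(\<lambda>t. tp (r k) x t * cis (- (real_of_int n * t))) \<in> borel_measurable Circ" for k
        using borel_measurable_times[OF measurable_Circ[OF measurable_tp] cis_meas] .
      show "AE t in Circ. (\<lambda>k. tp (r k) x t * cis (- (real_of_int n * t))) \<longlonglongrightarrow> g t * cis (- (real_of_int n * t))"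
        using lim by eventually_elim (intro tendsto_intros)
      show "AE t in Circ. norm (tp (r k) x t * cis (- (real_of_int n * t))) \<le> W t" for k
        using W(2)[of k] by (simp add: norm_mult)
    qed
    have 2: "\<forall>\<^sub>F k in sequentially. (\<integral>t. tp (r k) x t * cis (- (real_of_int n * t)) \<partial>Circ) = 2 * pi * (if 0 \<le> n then coef x (nat n) else 0)"
      using filterlim_at_top[THEN iffD1, OF r, rule_format, of "Suc (nat n)"]
      by eventually_elim (auto simp: integral_tp_cis)
    show ?thesis by (rule LIMSEQ_unique[OF 1 tendsto_eventually[OF 2]])
  qed
  \<comment> \<open>Fatou is applied to one factor at a time. With the other frozen at
    \<open>tp M x\<close>, the limit product has the norm of \<open>trunc M x\<close>, because the
    translates of \<open>x\<close> are orthonormal.\<close>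
  have g4: "integrable Circ (\<lambda>t. (norm (g t))\<^sup>2 * (norm (g t))\<^sup>2)" "(\<integral>t. (norm (g t))\<^sup>2 * (norm (g t))\<^sup>2 \<partial>Circ) \<le> 2 * pi"
  proof -
    have prod: "integrable Circ (\<lambda>t. (norm (g t))\<^sup>2 * (norm (tp M x t))\<^sup>2)"
      "(\<integral>t. (norm (g t))\<^sup>2 * (norm (tp M x t))\<^sup>2 \<partial>Circ) \<le> 2 * pi" for M
    proof -
      define z where "z N = (\<Sum>i<M. coef x i *\<^sub>c (shift ^^ i) (trunc N x))" for N
      define y where "y = (\<Sum>i<M. coef x i *\<^sub>c (shift ^^ i) x)"
      have z: "z \<longlonglongrightarrow> y"
        unfolding z_def y_def by (intro tendsto_sum cmul.tendsto tendsto_const tendsto_shift_pow tendsto_trunc)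
      have "cip y y = (\<Sum>i<M. \<Sum>j<M. if j = i then of_real ((norm (coef x i))\<^sup>2) else 0)"
        unfolding y_def cip.sum_left cip.sum_right complex_norm_square
        by (intro sum.cong refl) (auto simp: inner2_orth[OF x] mult.commute)
      also have "\<dots> = of_real ((norm (trunc M x))\<^sup>2)" by (simp add: norm_trunc_sq)
      finally have "(norm y)\<^sup>2 = (norm (trunc M x))\<^sup>2" unfolding cip_self of_real_eq_iff .
      then have y1: "(norm y)\<^sup>2 \<le> 1" using trunc1[of M] by (simp add: power_le_one)
      have lim_z: "(\<lambda>k. 2 * pi * (norm (z (r k)))\<^sup>2) \<longlonglongrightarrow> 2 * pi * (norm y)\<^sup>2"
        by (intro tendsto_intros filterlim_compose[OF z r])
      have lim_prod: "AE t in Circ. (\<lambda>k. (norm (tp (r k) x t))\<^sup>2 * (norm (tp M x t))\<^sup>2) \<longlonglongrightarrow> (norm (g t))\<^sup>2 * (norm (tp M x t))\<^sup>2"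
        using lim_sq by eventually_elim (rule tendsto_mult[OF _ tendsto_const])
      have bound: "(\<integral>t. (norm (tp N x t))\<^sup>2 * (norm (tp M x t))\<^sup>2 \<partial>Circ) \<le> 2 * pi * (norm (z N))\<^sup>2" for N
      proof -
        have "(norm (tp N x t))\<^sup>2 * (norm (tp M x t))\<^sup>2 = (norm (tp (N + M) (z N) t))\<^sup>2" for t
          unfolding z_def tp_mult[symmetric] by (simp add: norm_mult power_mult_distrib)
        then have "(\<integral>t. (norm (tp N x t))\<^sup>2 * (norm (tp M x t))\<^sup>2 \<partial>Circ) = 2 * pi * (norm (trunc (N + M) (z N)))\<^sup>2"
          by (simp only: integral_tp_norm_sq)
        also have "\<dots> \<le> 2 * pi * (norm (z N))\<^sup>2"
          unfolding norm_trunc_sq by (intro mult_left_mono sum_coef_sq_le) auto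
        finally show ?thesis .
      qed
      have meas: "(\<lambda>t. (norm (g t))\<^sup>2 * (norm (tp M x t))\<^sup>2) \<in> borel_measurable Circ"
        using gC measurable_Circ[OF measurable_tp[of M x]] by measurable
      note F = Fatou_Circ[OF lim_prod _ _ bound lim_z meas]
      show "integrable Circ (\<lambda>t. (norm (g t))\<^sup>2 * (norm (tp M x t))\<^sup>2)"
        by (rule F) (auto intro!: integrable_Circ_continuous continuous_intros)
      have "(\<integral>t. (norm (g t))\<^sup>2 * (norm (tp M x t))\<^sup>2 \<partial>Circ) \<le> 2 * pi * (norm y)\<^sup>2"
        by (rule F) (auto intro!: integrable_Circ_continuous continuous_intros)
      also have "\<dots> \<le> 2 * pi" using y1 by simp
      finally show "(\<integral>t. (norm (g t))\<^sup>2 * (norm (tp M x t))\<^sup>2 \<partial>Circ) \<le> 2 * pi" .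
    qed
    have lim4: "AE t in Circ. (\<lambda>k. (norm (g t))\<^sup>2 * (norm (tp (r k) x t))\<^sup>2) \<longlonglongrightarrow> (norm (g t))\<^sup>2 * (norm (g t))\<^sup>2"
      using lim_sq by eventually_elim (rule tendsto_mult[OF tendsto_const])
    have meas: "(\<lambda>t. (norm (g t))\<^sup>2 * (norm (g t))\<^sup>2) \<in> borel_measurable Circ"
      using gC by measurable
    note F = Fatou_Circ[OF lim4 prod(1) _ prod(2) tendsto_const meas]
    show "integrable Circ (\<lambda>t. (norm (g t))\<^sup>2 * (norm (g t))\<^sup>2)" by (rule F) auto
    show "(\<integral>t. (norm (g t))\<^sup>2 * (norm (g t))\<^sup>2 \<partial>Circ) \<le> 2 * pi" by (rule F) auto
  qed
  have Bessel: "2 * pi * (norm (trunc N x))\<^sup>2 \<le> (\<integral>t. (norm (g t))\<^sup>2 \<partial>Circ)" for N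
  proof -
    have gs: "integrable Circ (\<lambda>t. g t * cnj (tp N x t))"
    proof (rule Bochner_Integration.integrable_bound[of _ "\<lambda>t. (norm (g t))\<^sup>2 + (norm (tp N x t))\<^sup>2"])
      show "integrable Circ (\<lambda>t. (norm (g t))\<^sup>2 + (norm (tp N x t))\<^sup>2)"
        by (intro Bochner_Integration.integrable_add g2 integrable_Circ_continuous continuous_intros)
      show "(\<lambda>t. g t * cnj (tp N x t)) \<in> borel_measurable Circ"
        by (rule borel_measurable_times[OF gC], rule measurable_Circ, rule borel_measurable_continuous_onI)
          (intro continuous_intros)
      show "AE t in Circ. norm (g t * cnj (tp N x t)) \<le> norm ((norm (g t))\<^sup>2 + (norm (tp N x t))\<^sup>2)"
        using norm_mult_le_sum_squares[of "g _" "cnj (tp N x _)"] by (intro AE_I2) (simp add: abs_of_nonneg)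
    qed
    have "(\<integral>t. g t * cnj (tp N x t) \<partial>Circ) = of_real (2 * pi * (norm (trunc N x))\<^sup>2)"
    proof -
      have "(\<integral>t. g t * cnj (tp N x t) \<partial>Circ) = (\<Sum>n<N. cnj (coef x n) * (2 * pi * coef x n))"
        unfolding integral_mult_cnj_tp[OF g1] coeffs by simp
      also have "\<dots> = of_real (2 * pi * (norm (trunc N x))\<^sup>2)"
        unfolding norm_trunc_sq of_real_mult of_real_sum complex_norm_square sum_distrib_left
        by (intro sum.cong) (auto simp: mult_ac)
      finally show ?thesis .
    qed
    then have cross: "(\<integral>t. Re (g t * cnj (tp N x t)) \<partial>Circ) = 2 * pi * (norm (trunc N x))\<^sup>2"
      using integral_Re[OF gs] by simp
    define cr where "cr = (\<lambda>t. Re (g t * cnj (tp N x t)))"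
    have cr_int: "integral\<^sup>L Circ cr = 2 * pi * (norm (trunc N x))\<^sup>2"
      unfolding cr_def by (rule cross)
    have i1: "integrable Circ (\<lambda>t. (norm (tp N x t))\<^sup>2)"
      by (intro integrable_Circ_continuous continuous_intros)
    have i2: "integrable Circ cr" unfolding cr_def using gs by (rule integrable_Re)
    have expand: "(norm (g t - tp N x t))\<^sup>2 = (norm (g t))\<^sup>2 + (norm (tp N x t))\<^sup>2 - 2 * cr t" for t
      unfolding cr_def cmod_power2 by (simp add: power2_eq_square algebra_simps)
    have "(\<integral>t. (norm (g t - tp N x t))\<^sup>2 \<partial>Circ) =
        (\<integral>t. (norm (g t))\<^sup>2 + (norm (tp N x t))\<^sup>2 \<partial>Circ) - (\<integral>t. 2 * cr t \<partial>Circ)"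
      unfolding expand by (rule Bochner_Integration.integral_diff) (use g2 i1 i2 in auto)
    also have "(\<integral>t. (norm (g t))\<^sup>2 + (norm (tp N x t))\<^sup>2 \<partial>Circ) =
        (\<integral>t. (norm (g t))\<^sup>2 \<partial>Circ) + 2 * pi * (norm (trunc N x))\<^sup>2"
      using Bochner_Integration.integral_add[OF g2 i1] unfolding integral_tp_norm_sq .
    also have "(\<integral>t. 2 * cr t \<partial>Circ) = 2 * (2 * pi * (norm (trunc N x))\<^sup>2)"
      unfolding cr_int[symmetric] by (rule integral_mult_right_zero)
    finally have "(\<integral>t. (norm (g t - tp N x t))\<^sup>2 \<partial>Circ) =
        (\<integral>t. (norm (g t))\<^sup>2 \<partial>Circ) + 2 * pi * (norm (trunc N x))\<^sup>2 - 2 * (2 * pi * (norm (trunc N x))\<^sup>2)" .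
    moreover have "0 \<le> (\<integral>t. (norm (g t - tp N x t))\<^sup>2 \<partial>Circ)" by simp
    ultimately show ?thesis by simp
  qed
  have "(\<lambda>N. 2 * pi * (norm (trunc N x))\<^sup>2) \<longlonglongrightarrow> 2 * pi * (norm x)\<^sup>2"
    by (intro tendsto_intros tendsto_trunc)
  then have low: "2 * pi \<le> (\<integral>t. (norm (g t))\<^sup>2 \<partial>Circ)"
    using tendsto_upperbound[of _ "2 * pi * (norm x)\<^sup>2" sequentially] Bessel normx by simp
  have dev: "integrable Circ (\<lambda>t. ((norm (g t))\<^sup>2 - 1)\<^sup>2)"
    "(\<integral>t. ((norm (g t))\<^sup>2 - 1)\<^sup>2 \<partial>Circ) \<le> 0"
  proof -
    have eq: "((norm (g t))\<^sup>2 - 1)\<^sup>2 = (norm (g t))\<^sup>2 * (norm (g t))\<^sup>2 + 1 - 2 * (norm (g t))\<^sup>2" for t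
    proof -
      have "(a - 1)\<^sup>2 = a * a + 1 - 2 * a" for a :: real
        by (simp add: power2_eq_square algebra_simps)
      then show ?thesis .
    qed
    have i1: "integrable Circ (\<lambda>t. (norm (g t))\<^sup>2 * (norm (g t))\<^sup>2 + 1)"
      by (rule Bochner_Integration.integrable_add[OF g4(1)]) (rule Circ.integrable_const)
    have i2: "integrable Circ (\<lambda>t. 2 * (norm (g t))\<^sup>2)"
      by (rule Bochner_Integration.integrable_mult_right) (rule g2)
    show "integrable Circ (\<lambda>t. ((norm (g t))\<^sup>2 - 1)\<^sup>2)"
      unfolding eq by (rule Bochner_Integration.integrable_diff[OF i1 i2])
    have "(\<integral>t. ((norm (g t))\<^sup>2 - 1)\<^sup>2 \<partial>Circ) =
        (\<integral>t. (norm (g t))\<^sup>2 * (norm (g t))\<^sup>2 + 1 \<partial>Circ) - (\<integral>t. 2 * (norm (g t))\<^sup>2 \<partial>Circ)"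
      unfolding eq by (rule Bochner_Integration.integral_diff[OF i1 i2])
    moreover have "(\<integral>t. (norm (g t))\<^sup>2 * (norm (g t))\<^sup>2 + 1 \<partial>Circ) =
        (\<integral>t. (norm (g t))\<^sup>2 * (norm (g t))\<^sup>2 \<partial>Circ) + (\<integral>t. 1 \<partial>Circ)"
      by (rule Bochner_Integration.integral_add[OF g4(1)]) (rule Circ.integrable_const)
    moreover have "(\<integral>t. 1 \<partial>Circ) = 2 * pi" using measure_Circ by simp
    moreover have "(\<integral>t. 2 * (norm (g t))\<^sup>2 \<partial>Circ) = 2 * (\<integral>t. (norm (g t))\<^sup>2 \<partial>Circ)"
      by (rule integral_mult_right_zero)
    ultimately show "(\<integral>t. ((norm (g t))\<^sup>2 - 1)\<^sup>2 \<partial>Circ) \<le> 0" using low g4(2) by linarith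
  qed
  have "(\<integral>t. ((norm (g t))\<^sup>2 - 1)\<^sup>2 \<partial>Circ) = 0"
  proof (rule antisym[OF dev(2)])
    show "0 \<le> (\<integral>t. ((norm (g t))\<^sup>2 - 1)\<^sup>2 \<partial>Circ)" by (rule Bochner_Integration.integral_nonneg) simp
  qed
  then have "AE t in Circ. ((norm (g t))\<^sup>2 - 1)\<^sup>2 = 0"
    using integral_nonneg_eq_0_iff_AE[OF dev(1)] by simp
  then have unimodular: "AE t in Circ. norm (g t) = 1"
  proof eventually_elim
    case (elim t)
    then have "(norm (g t))\<^sup>2 = 1" by simp
    moreover have "norm (g t) \<noteq> - 1" using norm_ge_zero[of "g t"] by linarith
    ultimately show ?case unfolding power2_eq_1_iff by blast
  qed
  have "boundary_fn (coef x) g"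
    unfolding boundary_fn_def fourier_coeff_def
  proof (intro conjI allI)
    show "set_integrable lborel {0..2 * pi} (\<lambda>t. (norm (g t))\<^sup>2)"
      using g2 unfolding integrable_Circ_iff .
    show "(LINT t:{0..2 * pi}|lborel. g t * cis (- (real_of_int n * t))) / complex_of_real (2 * pi) =
        (if 0 \<le> n then coef x (nat n) else 0)" for n
      unfolding integral_Circ_eq[symmetric] coeffs by simp
  qed (use g in auto)
  moreover have "AE t in lborel. t \<in> {0..2*pi} \<longrightarrow> norm (g t) = 1"
    using unimodular unfolding AE_Circ_iff .
  ultimately show ?thesis unfolding inner_fn_def by (intro exI[of _ g] conjI)
qed

section \<open>Bounded Hankel operators\<close>

text \<open>Boundedness is tested on finite sections. No operator has to exist beforehand, and each
  section involves finitely many coefficients, so the bound survives coefficientwise limits of the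
  symbol.\<close>

definition hankel_bound :: "(nat \<Rightarrow> complex) \<Rightarrow> real \<Rightarrow> bool" where
  "hankel_bound u K \<longleftrightarrow> 0 \<le> K \<and> (\<forall>N f h. norm (\<Sum>n<N. \<Sum>k<N. u (n + k) * f k * h n) \<le>
     K * sqrt (\<Sum>n<N. (norm (f n))\<^sup>2) * sqrt (\<Sum>n<N. (norm (h n))\<^sup>2))"

definition conj2 :: "l2 \<Rightarrow> l2" where
  "conj2 x = l2_of (Cc (coef x))"

lemma coef_conj2: "coef (conj2 x) = Cc (coef x)"
  unfolding conj2_def Cc_def by (simp add: H2_cnj)

lemma coef_conj2_nth [simp]: "coef (conj2 x) n = cnj (coef x n)"
  by (simp add: coef_conj2 Cc_def)

lemma conj2_conj2 [simp]: "conj2 (conj2 x) = x"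
  by (rule l2_eqI) simp

lemma norm_conj2 [simp]: "norm (conj2 x) = norm x"
proof -
  have "(norm (conj2 x))\<^sup>2 = (norm x)\<^sup>2" unfolding l2_norm_sq by simp
  then show ?thesis by simp
qed

lemma conj2_add: "conj2 (x + y) = conj2 x + conj2 y"
  and conj2_cmul: "conj2 (c *\<^sub>c x) = cnj c *\<^sub>c conj2 x"
  and conj2_shift: "conj2 (shift x) = shift (conj2 x)"
  and conj2_trunc: "conj2 (trunc N x) = trunc N (conj2 x)"
  by (rule l2_eqI; auto simp: coef_shift split: nat.splits)+

lemma conj2_scaleR: "conj2 (r *\<^sub>R x) = r *\<^sub>R conj2 x"
  by (rule l2_eqI) simp

lemma conj2_inject: "conj2 x = conj2 y \<longleftrightarrow> x = y"
  by (metis conj2_conj2)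

lemma bounded_linear_conj2: "bounded_linear conj2"
  by (rule bounded_linear_intro[where K = 1]) (auto simp: conj2_add scaleR_eq_cmul conj2_cmul)

locale bounded_hankel =
  fixes u :: "nat \<Rightarrow> complex" and K :: real
  assumes u_H2: "u \<in> H2" and bound: "hankel_bound u K"
begin

lemma u_shift_H2: "(\<lambda>k. u (n + k)) \<in> H2"
  using summable_ignore_initial_segment[of "\<lambda>k. (norm (u k))\<^sup>2" n] u_H2 by (simp add: H2_iff add.commute)

lemma Gop_sums: "(\<lambda>k. u (n + k) * coef x k) sums Gop u (coef x) n"
  unfolding Gop_def
  by (rule summable_sums, rule summable_norm_cancel, rule H2_summable_mult) (auto intro: u_shift_H2)

lemma Gop_bounded_sums: "(\<Sum>n<N. (norm (Gop u (coef x) n))\<^sup>2) \<le> (K * norm x)\<^sup>2"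
proof -
  define T where "T = (\<Sum>n<N. (norm (Gop u (coef x) n))\<^sup>2)"
  \<comment> \<open>Tests the form against the conjugate of its own truncated output, so that the
    value is \<open>T\<close> and one factor \<open>sqrt T\<close> can be cancelled.\<close>
  define h where "h n = (if n < N then cnj (Gop u (coef x) n) else 0)" for n
  have K: "K \<ge> 0" using bound by (simp add: hankel_bound_def)
  have le: "norm (\<Sum>n<N. (\<Sum>k<M. u (n + k) * coef x k) * h n) \<le> K * norm x * sqrt T" if "M \<ge> N" for M
  proof -
    have "(\<Sum>n<N. (\<Sum>k<M. u (n + k) * coef x k) * h n) = (\<Sum>n<M. \<Sum>k<M. u (n + k) * coef x k * h n)"
      unfolding sum_distrib_right using that
      by (intro sum.mono_neutral_left) (auto simp: h_def)
    also have "norm \<dots> \<le> K * sqrt (\<Sum>n<M. (norm (coef x n))\<^sup>2) * sqrt (\<Sum>n<M. (norm (h n))\<^sup>2)"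
      using bound by (simp add: hankel_bound_def)
    also have "(\<Sum>n<M. (norm (h n))\<^sup>2) = T"
      unfolding T_def h_def using that by (intro sum.mono_neutral_cong_right) auto
    also have "K * sqrt (\<Sum>n<M. (norm (coef x n))\<^sup>2) * sqrt T \<le> K * norm x * sqrt T"
      using sum_coef_sq_le[of "{..<M}" x] K
      by (intro mult_right_mono mult_left_mono) (auto simp: T_def real_le_lsqrt sum_nonneg)
    finally show ?thesis .
  qed
  have "(\<lambda>M. \<Sum>n<N. (\<Sum>k<M. u (n + k) * coef x k) * h n) \<longlonglongrightarrow> (\<Sum>n<N. Gop u (coef x) n * h n)"
    using Gop_sums by (intro tendsto_intros) (simp add: sums_def)
  then have "norm (\<Sum>n<N. Gop u (coef x) n * h n) \<le> K * norm x * sqrt T"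
    by (intro tendsto_upperbound[OF tendsto_norm]) (auto intro!: eventually_mono[OF eventually_ge_at_top[of N]] le)
  moreover have "(\<Sum>n<N. Gop u (coef x) n * h n) = of_real T"
    unfolding T_def of_real_sum complex_norm_square by (intro sum.cong) (auto simp: h_def)
  moreover have "T \<ge> 0" by (simp add: T_def sum_nonneg)
  ultimately have "T \<le> K * norm x * sqrt T" by simp
  then have "sqrt T * sqrt T \<le> K * norm x * sqrt T" using \<open>T \<ge> 0\<close> by simp
  then have "sqrt T \<le> K * norm x"
    using \<open>T \<ge> 0\<close> K by (cases "T = 0") (auto intro: mult_right_le_imp_le simp del: real_sqrt_mult_self)
  then have "(sqrt T)\<^sup>2 \<le> (K * norm x)\<^sup>2" using \<open>T \<ge> 0\<close> by (intro power_mono) auto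
  then show ?thesis using \<open>T \<ge> 0\<close> by (simp add: T_def)
qed

lemma Gop_H2: "Gop u (coef x) \<in> H2"
  by (rule H2_bounded_sums[OF Gop_bounded_sums])

definition G :: "l2 \<Rightarrow> l2" where
  "G x = l2_of (Gop u (coef x))"

lemma coef_G: "coef (G x) = Gop u (coef x)"
  unfolding G_def by (simp add: Gop_H2)

lemma coef_G_sums: "(\<lambda>k. u (n + k) * coef x k) sums coef (G x) n"
  by (simp add: coef_G Gop_sums)

lemma G_add: "G (x + y) = G x + G y"
  using sums_add[OF coef_G_sums[of _ x] coef_G_sums[of _ y]]
  by (intro l2_eqI) (simp add: sums_unique2[OF coef_G_sums] algebra_simps)

lemma G_cmul: "G (c *\<^sub>c x) = c *\<^sub>c G x"
  using sums_mult[OF coef_G_sums[of _ x], of c]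
  by (intro l2_eqI) (simp add: sums_unique2[OF coef_G_sums] algebra_simps)

lemma norm_G_le: "norm (G x) \<le> norm x * K"
proof -
  have K: "K \<ge> 0" using bound by (simp add: hankel_bound_def)
  have "(norm (G x))\<^sup>2 \<le> (K * norm x)\<^sup>2"
    unfolding l2_norm_sq coef_G by (rule H2_bounded_sums[OF Gop_bounded_sums])
  then show ?thesis using K by (simp add: power2_le_iff_abs_le mult.commute)
qed

lemma bounded_linear_G: "bounded_linear G"
  by (rule bounded_linear_intro[where K = K]) (auto simp: G_add scaleR_eq_cmul G_cmul norm_G_le)

lemma G_shift: "G (shift x) = bshift (G x)"
proof (rule l2_eqI)
  fix n
  have "(\<lambda>k. u (n + k) * coef (shift x) k) sums coef (G (shift x)) n" by (rule coef_G_sums)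
  then have "(\<lambda>k. u (n + Suc k) * coef (shift x) (Suc k)) sums coef (G (shift x)) n"
    by (subst sums_Suc_iff) simp
  then have "(\<lambda>k. u (Suc n + k) * coef x k) sums coef (G (shift x)) n" by simp
  moreover have "(\<lambda>k. u (Suc n + k) * coef x k) sums coef (G x) (Suc n)" by (rule coef_G_sums)
  ultimately show "coef (G (shift x)) n = coef (bshift (G x)) n" using sums_unique2 by simp
qed

lemma G_sym: "cip (G x) (conj2 y) = cip (G y) (conj2 x)"
proof -
  have fin: "cip (G (trunc N x)) (conj2 (trunc N y)) = (\<Sum>n<N. \<Sum>k<N. u (n + k) * coef x k * coef y n)" for N x y
  proof -
    have "coef (G (trunc N x)) n = (\<Sum>k<N. u (n + k) * coef x k)" for n
    proof -
      have "coef (G (trunc N x)) n = (\<Sum>k<N. u (n + k) * coef (trunc N x) k)"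
        by (rule sums_unique2[OF coef_G_sums], rule sums_finite) auto
      then show ?thesis by simp
    qed
    then have "(\<lambda>n. coef (G (trunc N x)) n * cnj (coef (conj2 (trunc N y)) n)) sums
        (\<Sum>n<N. (\<Sum>k<N. u (n + k) * coef x k) * cnj (coef (conj2 (trunc N y)) n))"
      using sums_finite[of "{..<N}" "\<lambda>n. coef (G (trunc N x)) n * cnj (coef (conj2 (trunc N y)) n)"] by simp
    then have "cip (G (trunc N x)) (conj2 (trunc N y)) = (\<Sum>n<N. (\<Sum>k<N. u (n + k) * coef x k) * coef y n)"
      using sums_unique2[OF cip_sums] by force
    then show ?thesis by (simp add: sum_distrib_right)
  qed
  have fin_sym: "cip (G (trunc N x)) (conj2 (trunc N y)) = cip (G (trunc N y)) (conj2 (trunc N x))" for N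
    unfolding fin by (subst sum.swap) (simp add: add.commute mult_ac)
  have lim: "(\<lambda>N. cip (G (trunc N x)) (conj2 (trunc N y))) \<longlonglongrightarrow> cip (G x) (conj2 y)" for x y
    by (intro cip.tendsto bounded_linear.tendsto[OF bounded_linear_G]
        bounded_linear.tendsto[OF bounded_linear_conj2] tendsto_trunc)
  have eq: "(\<lambda>N. cip (G (trunc N x)) (conj2 (trunc N y))) = (\<lambda>N. cip (G (trunc N y)) (conj2 (trunc N x)))"
    by (rule ext) (rule fin_sym)
  show ?thesis
    using lim[of x y] lim[of y x] unfolding eq by (rule LIMSEQ_unique)
qed

lemma h2inner_coef: "h2inner (coef x) (coef y) = cip x y"
  by (simp add: h2inner_def cip_def)

text \<open>The Hankel matrix is symmetric, so its adjoint is its entrywise conjugate. As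
  \<open>adj\<close> is a definite description, uniqueness is shown too, by pairing the difference
  of two candidates with itself.\<close>

lemma adj_G: "adj (Gop u) (coef y) = coef (conj2 (G (conj2 y)))"
  unfolding adj_def
proof (rule the_equality)
  have *: "cip (G x) y = cip x (conj2 (G (conj2 y)))" for x
  proof -
    have "cip (G x) y = cip (G (conj2 y)) (conj2 x)" using G_sym[of x "conj2 y"] by simp
    also have "\<dots> = cip x (conj2 (G (conj2 y)))" unfolding cip_def by (simp add: mult.commute)
    finally show ?thesis .
  qed
  have **: "h2inner (Gop u f) (coef y) = h2inner f (coef (conj2 (G (conj2 y))))" if "f \<in> H2" for f
    using *[of "l2_of f"] that by (simp add: coef_G flip: h2inner_coef)
  then show "coef (conj2 (G (conj2 y))) \<in> H2 \<and>
    (\<forall>f\<in>H2. h2inner (Gop u f) (coef y) = h2inner f (coef (conj2 (G (conj2 y)))))" by simp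
  fix h assume h: "h \<in> H2 \<and> (\<forall>f\<in>H2. h2inner (Gop u f) (coef y) = h2inner f h)"
  define z where "z = l2_of h"
  have hz: "h = coef z" using h by (simp add: z_def)
  have "cip x z = cip x (conj2 (G (conj2 y)))" for x
    using h **[of "coef x"] by (simp add: hz flip: h2inner_coef)
  from this[of "z - conj2 (G (conj2 y))"]
  have "cip (z - conj2 (G (conj2 y))) (z - conj2 (G (conj2 y))) = 0" by (simp add: cip.diff_right)
  then have "z = conj2 (G (conj2 y))" unfolding cip_self by simp
  then show "h = coef (conj2 (G (conj2 y)))" by (simp add: hz)
qed

text \<open>The antilinear operator \<open>H\<^sub>u f = P(u f\<^sup>*)\<close>; up to the scalar \<open>s\<close> its square on \<open>H\<^sup>2\<close> is
  \<open>G\<^sub>u G\<^sub>u\<^sup>*\<close>.\<close>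

definition H :: "real \<Rightarrow> l2 \<Rightarrow> l2" where
  "H s x = (1 / s) *\<^sub>R G (conj2 x)"

lemma antilinear_hankel_H: "antilinear_hankel (H s)"
proof
  show "H s (x + y) = H s x + H s y" for x y
    by (simp add: H_def conj2_add G_add scaleR_add_right)
  show "H s (c *\<^sub>c x) = cnj c *\<^sub>c H s x" for c x
    by (simp add: H_def conj2_cmul G_cmul scaleR_eq_cmul mult.commute)
  show "\<exists>K. \<forall>x. norm (H s x) \<le> norm x * K"
  proof (intro exI allI)
    fix x
    show "norm (H s x) \<le> norm x * (K * \<bar>1 / s\<bar>)"
      using mult_left_mono[OF norm_G_le[of "conj2 x"], of "\<bar>1 / s\<bar>"] by (simp add: H_def mult_ac)
  qed
  show "cip (H s x) y = cip (H s y) x" for x y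
    using G_sym[of "conj2 x" "conj2 y"] by (simp add: H_def cip.scaleR_left)
  show "H s (shift x) = bshift (H s x)" for x
    by (simp add: H_def conj2_shift G_shift scaleR_eq_cmul)
qed

lemma H_H: "s \<noteq> 0 \<Longrightarrow> H s (H s x) = x \<longleftrightarrow> G (conj2 (G (conj2 x))) = s\<^sup>2 *\<^sub>R x"
proof -
  assume s: "s \<noteq> 0"
  have 1: "s\<^sup>2 *\<^sub>R H s (H s x) = G (conj2 (G (conj2 x)))"
    using s by (simp add: H_def scaleR_eq_cmul conj2_cmul G_cmul power2_eq_square)
  have 2: "H s (H s x) = x \<longleftrightarrow> s\<^sup>2 *\<^sub>R H s (H s x) = s\<^sup>2 *\<^sub>R x"
    using s by simp
  show ?thesis unfolding 2 1 ..
qed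

lemma ker_nostar_eq: "s \<noteq> 0 \<Longrightarrow> ker_nostar u s = coef ` {x. H s (H s x) = x}"
proof -
  assume s: "s \<noteq> 0"
  have "coef x \<in> ker_nostar u s \<longleftrightarrow> H s (H s x) = x" for x
  proof -
    have "coef x \<in> ker_nostar u s \<longleftrightarrow> coef (G (conj2 (G (conj2 x)))) = coef (s\<^sup>2 *\<^sub>R x)"
      by (simp add: ker_nostar_def adj_G scaleR_conv_of_real fun_eq_iff flip: coef_G)
    then show ?thesis unfolding coef_inject H_H[OF s] .
  qed
  note * = this
  show ?thesis
  proof (intro equalityI subsetI)
    fix f assume f: "f \<in> ker_nostar u s"
    define x where "x = l2_of f"
    have "coef x = f" using f by (simp add: x_def ker_nostar_def)
    then show "f \<in> coef ` {x. H s (H s x) = x}" using * f by (intro image_eqI[of _ _ x]) auto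
  qed (use * in auto)
qed

text \<open>Conjugating coefficients turns G^* G into G G^*, which is why the first kernel is the
  image under C of the second.\<close>

lemma ker_star_eq: "s \<noteq> 0 \<Longrightarrow> ker_star u s = Cc ` coef ` {x. H s (H s x) = x}"
proof -
  assume s: "s \<noteq> 0"
  have *: "coef (conj2 x) \<in> ker_star u s \<longleftrightarrow> H s (H s x) = x" for x
  proof -
    have "coef (conj2 x) \<in> ker_star u s \<longleftrightarrow> conj2 (G (conj2 (G (conj2 x)))) = s\<^sup>2 *\<^sub>R conj2 x"
      unfolding coef_inject[symmetric]
      by (simp add: ker_star_def adj_G scaleR_conv_of_real fun_eq_iff flip: coef_G)
    also have "\<dots> \<longleftrightarrow> G (conj2 (G (conj2 x))) = s\<^sup>2 *\<^sub>R x"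
      by (simp only: conj2_scaleR[symmetric] conj2_inject)
    finally show ?thesis unfolding H_H[OF s] .
  qed
  show ?thesis
  proof (intro equalityI subsetI)
    fix f assume f: "f \<in> ker_star u s"
    define x where "x = conj2 (l2_of f)"
    have fx: "coef (conj2 x) = f" using f by (simp add: x_def ker_star_def)
    then have "H s (H s x) = x" using *[of x] f by simp
    moreover have "f = Cc (coef x)" using fx by (simp add: coef_conj2)
    ultimately show "f \<in> Cc ` coef ` {x. H s (H s x) = x}" by blast
  next
    fix f assume "f \<in> Cc ` coef ` {x. H s (H s x) = x}"
    then obtain x where "H s (H s x) = x" "f = Cc (coef x)" by blast
    then show "f \<in> ker_star u s" using *[of x] by (simp add: coef_conj2)
  qed
qed

end

section \<open>Elements of H^2 as holomorphic functions, and the theorem for bounded Hankel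
  operators\<close>

lemma one_le_conv_radius_ps: "fps_conv_radius (ps x) \<ge> 1"
  unfolding fps_conv_radius_def fps_nth_ps[abs_def]
proof (rule conv_radius_geI_ex')
  fix r :: real assume r: "0 < r" "ereal r < 1"
  show "summable (\<lambda>n. coef x n * of_real r ^ n)"
  proof (rule summable_norm_cancel, rule summable_comparison_test')
    show "summable (\<lambda>n. norm x * r ^ n)" using r by (intro summable_mult summable_geometric) simp
    show "norm (norm (coef x n * of_real r ^ n)) \<le> norm x * r ^ n" for n
    proof -
      have "norm (norm (coef x n * of_real r ^ n)) = norm (coef x n) * r ^ n"
        using r by (simp add: norm_mult norm_power)
      then show ?thesis using r norm_coef_le[of x n] by (simp add: mult_right_mono)
    qed
  qed
qed

definition fn :: "l2 \<Rightarrow> complex \<Rightarrow> complex" where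
  "fn x = eval_fps (ps x)"

lemma holomorphic_fn: "fn x holomorphic_on ball 0 1"
proof -
  have "ball (0::complex) 1 = eball 0 1" by (simp add: one_ereal_def)
  also have "\<dots> \<subseteq> eball 0 (fps_conv_radius (ps x))"
    using one_le_conv_radius_ps[of x] by (rule eball_mono)
  finally show ?thesis unfolding fn_def by (rule holomorphic_on_eval_fps)
qed

lemma taylor_coeff_fn: "taylor_coeff (fn x) n = coef x n"
proof -
  have "0 < fps_conv_radius (ps x)" by (rule less_le_trans[OF _ one_le_conv_radius_ps]) simp
  then show ?thesis
    using fps_nth_conv_deriv[of "ps x" n] by (simp add: taylor_coeff_def fn_def)
qed

lemma mult_fn: "mult (fn x) (coef y) n = fps_nth (ps x * ps y) n"
proof -
  have "mult (fn x) (coef y) n = (\<Sum>k=0..n. coef y k * coef x (n - k))"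
    by (simp add: mult_def taylor_coeff_fn atLeast0AtMost mult.commute)
  also have "\<dots> = fps_nth (ps y * ps x) n" by (simp add: fps_mult_nth)
  finally show ?thesis by (simp add: mult.commute)
qed

theorem schmidt_subspaces_of_bounded_hankel:
  assumes "u \<in> H2" "hankel_bound u K" and s: "s > 0" and "ker_star u s \<noteq> {\<lambda>n. 0}"
  obtains \<theta> p where "inner2 \<theta>" "isometric_multiplier p (RanH (coef \<theta>))"
    "ker_star u s = Cc ` (mult p ` RanH (coef \<theta>))"
    "ker_nostar u s = mult p ` RanH (coef \<theta>)"
    "\<And>f. f \<in> RanH (coef \<theta>) \<Longrightarrow>
      Gop u (Cc (mult p f)) = (\<lambda>n. complex_of_real s * mult p (theta_bar (coef \<theta>) f) n)"
proof -
  interpret bounded_hankel u K by standard (use assms in auto)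
  interpret B: antilinear_hankel "H s" by (rule antilinear_hankel_H)
  have E: "{x. H s (H s x) = x} = B.E" by (simp only: B.E_def)
  have s0: "s \<noteq> 0" using s by simp
  note ker_star_E = ker_star_eq[OF s0, unfolded E] and ker_nostar_E = ker_nostar_eq[OF s0, unfolded E]
  have "B.E \<noteq> {0}"
  proof
    assume E0: "B.E = {0}"
    have "ker_star u s = {Cc (coef 0)}"
      unfolding ker_star_E E0 by (simp only: image_insert image_empty)
    moreover have "Cc (coef 0) = (\<lambda>n. 0)" by (simp add: Cc_def fun_eq_iff)
    ultimately show False using assms(4) by simp
  qed
  then interpret B: schmidt "H s" by unfold_locales
  \<comment> \<open>Multiplication by p undoes \<open>V\<close>; all the claims are thereby
    statements about E.\<close>
  have mV: "mult (fn B.p) (coef (B.V x)) = coef x" if "x \<in> B.E" for x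
  proof (rule ext)
    fix n
    have "mult (fn B.p) (coef (B.V x)) n = fps_nth (ps B.p * ps (B.V x)) n" by (rule mult_fn)
    moreover have "ps B.p * ps (B.V x) = ps x" using B.ps_V[OF that] by (rule sym)
    ultimately show "mult (fn B.p) (coef (B.V x)) n = coef x n" by (simp only: fps_nth_ps)
  qed
  have im: "mult (fn B.p) ` RanH (coef B.\<theta>) = coef ` B.E"
  proof -
    have "mult (fn B.p) ` (\<lambda>x. coef (B.V x)) ` B.E = (\<lambda>x. mult (fn B.p) (coef (B.V x))) ` B.E"
      by (rule image_image)
    also have "\<dots> = coef ` B.E"
      by (rule image_cong, rule refl, rule mV)
    finally show ?thesis unfolding B.RanH_theta .
  qed
  have iso: "isometric_multiplier (fn B.p) (RanH (coef B.\<theta>))"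
    unfolding isometric_multiplier_def B.RanH_theta
  proof (intro conjI ballI holomorphic_fn)
    fix f assume "f \<in> (\<lambda>x. coef (B.V x)) ` B.E"
    then obtain x where x: "x \<in> B.E" and f: "f = coef (B.V x)" by blast
    show "mult (fn B.p) f \<in> H2" unfolding f mV[OF x] by (rule coef_H2)
    show "h2norm (mult (fn B.p) f) = h2norm f"
      unfolding f mV[OF x] h2norm_coef B.norm_V[OF x] by (rule refl)
  qed
  have star: "ker_star u s = Cc ` (mult (fn B.p) ` RanH (coef B.\<theta>))"
    unfolding im by (rule ker_star_E)
  have nostar: "ker_nostar u s = mult (fn B.p) ` RanH (coef B.\<theta>)"
    unfolding im by (rule ker_nostar_E)
  have action: "Gop u (Cc (mult (fn B.p) f)) =
      (\<lambda>n. complex_of_real s * mult (fn B.p) (theta_bar (coef B.\<theta>) f) n)"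
    if f_RanH: "f \<in> RanH (coef B.\<theta>)" for f
  proof (rule ext)
    fix n
    obtain x where x: "x \<in> B.E" and f: "f = coef (B.V x)"
      using f_RanH unfolding B.RanH_theta by blast
    have eq: "G (conj2 x) = s *\<^sub>R H s x" using s by (simp add: H_def)
    have 1: "Gop u (Cc (mult (fn B.p) f)) = coef (G (conj2 x))"
      unfolding f mV[OF x] coef_G coef_conj2 by (rule refl)
    have 2: "mult (fn B.p) (theta_bar (coef B.\<theta>) f) = coef (H s x)"
      unfolding f B.theta_bar_V[OF x] by (rule mV) (rule B.B_in_E[OF x])
    show "Gop u (Cc (mult (fn B.p) f)) n =
        complex_of_real s * mult (fn B.p) (theta_bar (coef B.\<theta>) f) n"
      unfolding 1 2 eq coef_scaleR scaleR_conv_of_real by (rule refl)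
  qed
  from B.inner2_theta iso star nostar action show ?thesis by (rule that)
qed

section \<open>A sub-mean value property\<close>

text \<open>\<open>D v\<close> and \<open>E v\<close> are the first and second derivative of \<open>F\<close> in the direction \<open>v\<close>.\<close>

definition C2 :: "(complex \<Rightarrow> real) \<Rightarrow> (complex \<Rightarrow> complex \<Rightarrow> real) \<Rightarrow> (complex \<Rightarrow> complex \<Rightarrow> real) \<Rightarrow> bool" where
  "C2 F D E \<longleftrightarrow> continuous_on UNIV F \<and> (\<forall>v. continuous_on UNIV (D v)) \<and> (\<forall>v. continuous_on UNIV (E v)) \<and>
    (\<forall>z v. ((\<lambda>s::real. F (z + of_real s * v)) has_real_derivative D v z) (at 0)) \<and>
    (\<forall>z v. ((\<lambda>s::real. D v (z + of_real s * v)) has_real_derivative E v z) (at 0))"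

lemma C2_add: "C2 F D E \<Longrightarrow> C2 F' D' E' \<Longrightarrow>
  C2 (\<lambda>z. F z + F' z) (\<lambda>v z. D v z + D' v z) (\<lambda>v z. E v z + E' v z)"
  unfolding C2_def by (auto intro!: continuous_intros DERIV_add)

lemma C2_cmult: "C2 F D E \<Longrightarrow> C2 (\<lambda>z. c * F z) (\<lambda>v z. c * D v z) (\<lambda>v z. c * E v z)"
  unfolding C2_def by (auto intro!: continuous_intros DERIV_cmult)

lemma C2_mult:
  assumes "C2 F D E" "C2 F' D' E'"
  shows "C2 (\<lambda>z. F z * F' z) (\<lambda>v z. D v z * F' z + F z * D' v z)
    (\<lambda>v z. E v z * F' z + 2 * D v z * D' v z + F z * E' v z)"
proof -
  have c: "continuous_on UNIV F" "continuous_on UNIV F'" "continuous_on UNIV (D v)" "continuous_on UNIV (D' v)"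
    "continuous_on UNIV (E v)" "continuous_on UNIV (E' v)" for v
    using assms by (auto simp: C2_def)
  have d: "((\<lambda>s::real. F (z + of_real s * v)) has_real_derivative D v z) (at 0)"
    "((\<lambda>s::real. F' (z + of_real s * v)) has_real_derivative D' v z) (at 0)"
    "((\<lambda>s::real. D v (z + of_real s * v)) has_real_derivative E v z) (at 0)"
    "((\<lambda>s::real. D' v (z + of_real s * v)) has_real_derivative E' v z) (at 0)" for z v
    using assms by (auto simp: C2_def)
  show ?thesis
    unfolding C2_def
  proof (intro conjI allI)
    show "((\<lambda>s::real. F (z + of_real s * v) * F' (z + of_real s * v)) has_real_derivative D v z * F' z + F z * D' v z) (at 0)" for z v
      using DERIV_mult[OF d(1)[of z v] d(2)[of z v]] by (simp add: algebra_simps)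
    show "((\<lambda>s::real. D v (z + of_real s * v) * F' (z + of_real s * v) + F (z + of_real s * v) * D' v (z + of_real s * v))
        has_real_derivative E v z * F' z + 2 * D v z * D' v z + F z * E' v z) (at 0)" for z v
      using DERIV_add[OF DERIV_mult[OF d(3)[where z = z and v = v] d(2)[of z v]] DERIV_mult[OF d(1)[of z v] d(4)[where z = z and v = v]]]
      by (simp add: algebra_simps)
  qed (intro continuous_intros c)+
qed

lemma C2_exp:
  assumes "C2 F D E"
  shows "C2 (\<lambda>z. exp (F z)) (\<lambda>v z. exp (F z) * D v z) (\<lambda>v z. exp (F z) * ((D v z)\<^sup>2 + E v z))"
proof -
  have c: "continuous_on UNIV F" "continuous_on UNIV (D v)" "continuous_on UNIV (E v)" for v
    using assms by (auto simp: C2_def)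
  have d: "((\<lambda>s::real. F (z + of_real s * v)) has_real_derivative D v z) (at 0)"
    "((\<lambda>s::real. D v (z + of_real s * v)) has_real_derivative E v z) (at 0)" for z v
    using assms by (auto simp: C2_def)
  have e: "((\<lambda>s::real. exp (F (z + of_real s * v))) has_real_derivative exp (F z) * D v z) (at 0)" for z v
    using DERIV_chain2[OF DERIV_exp d(1), of z v] by simp
  show ?thesis
    unfolding C2_def
  proof (intro conjI allI)
    show "((\<lambda>s::real. exp (F (z + of_real s * v))) has_real_derivative exp (F z) * D v z) (at 0)" for z v
      by (rule e)
    show "((\<lambda>s::real. exp (F (z + of_real s * v)) * D v (z + of_real s * v)) has_real_derivative
        exp (F z) * ((D v z)\<^sup>2 + E v z)) (at 0)" for z v
      using DERIV_mult[OF e[of z v] d(2)[where z = z and v = v]] by (simp add: algebra_simps power2_eq_square)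
  qed (intro continuous_intros c)+
qed

lemma deriv_Re_mult_cnj:
  assumes "a holomorphic_on UNIV" "b holomorphic_on UNIV"
  shows "((\<lambda>s::real. Re (a (z + of_real s * v) * cnj (b (z + of_real s * v)))) has_real_derivative
    Re (v * deriv a z * cnj (b z) + a z * cnj (v * deriv b z))) (at 0)"
proof -
  have line: "((\<lambda>s::real. z + of_real s * v) has_vector_derivative v) (at 0)"
    by (auto intro!: derivative_eq_intros simp: has_vector_derivative_def scaleR_conv_of_real)
  have *: "((\<lambda>s::real. c (z + of_real s * v)) has_vector_derivative v * deriv c z) (at 0)"
    if "c holomorphic_on UNIV" for c
    using field_vector_diff_chain_at[OF line, of c "deriv c z"] holomorphic_derivI[OF that, of z]
    by (simp add: o_def)
  have "((\<lambda>s::real. a (z + of_real s * v) * cnj (b (z + of_real s * v))) has_vector_derivative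
      a z * cnj (v * deriv b z) + v * deriv a z * cnj (b z)) (at 0)"
    using has_vector_derivative_mult[OF *[OF assms(1)] bounded_linear.has_vector_derivative[OF bounded_linear_cnj *[OF assms(2)]]]
    by simp
  from bounded_linear.has_vector_derivative[OF bounded_linear_Re this] show ?thesis
    by (simp add: has_real_derivative_iff_has_vector_derivative add.commute)
qed

lemma C2_Re_mult_cnj:
  assumes a: "a holomorphic_on UNIV" and b: "b holomorphic_on UNIV"
  shows "C2 (\<lambda>z. Re (a z * cnj (b z))) (\<lambda>v z. Re (v * deriv a z * cnj (b z) + a z * cnj (v * deriv b z)))
    (\<lambda>v z. Re (v\<^sup>2 * deriv (deriv a) z * cnj (b z) + 2 * (v * cnj v) * deriv a z * cnj (deriv b z) +
      a z * cnj (v\<^sup>2 * deriv (deriv b) z)))"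
proof -
  have a': "deriv a holomorphic_on UNIV" and b': "deriv b holomorphic_on UNIV"
    using a b by (auto intro: holomorphic_deriv)
  have a'': "deriv (deriv a) holomorphic_on UNIV" and b'': "deriv (deriv b) holomorphic_on UNIV"
    using a' b' by (auto intro: holomorphic_deriv)
  note c = holomorphic_on_imp_continuous_on
  have dv: "deriv (\<lambda>z. v * deriv c z) z = v * deriv (deriv c) z" if "c holomorphic_on UNIV" for c v z
    using holomorphic_derivI[OF holomorphic_deriv[OF that], of z]
    by (intro DERIV_imp_deriv DERIV_cmult) auto
  show ?thesis
    unfolding C2_def
  proof (intro conjI allI)
    show "((\<lambda>s::real. Re (v * deriv a (z + of_real s * v) * cnj (b (z + of_real s * v)) + a (z + of_real s * v) * cnj (v * deriv b (z + of_real s * v))))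
      has_real_derivative Re (v\<^sup>2 * deriv (deriv a) z * cnj (b z) + 2 * (v * cnj v) * deriv a z * cnj (deriv b z) +
      a z * cnj (v\<^sup>2 * deriv (deriv b) z))) (at 0)" for z v
    proof -
      have ha: "(\<lambda>z. v * deriv a z) holomorphic_on UNIV" and hb: "(\<lambda>z. v * deriv b z) holomorphic_on UNIV"
        by (intro holomorphic_intros a' b')+
      show ?thesis
        using DERIV_add[OF deriv_Re_mult_cnj[OF ha b, of z v] deriv_Re_mult_cnj[OF a hb, of z v]]
        unfolding dv[OF a] dv[OF b] plus_complex.sel[symmetric]
        by (simp only: complex_cnj_mult power2_eq_square algebra_simps mult_2 distrib_left distrib_right)
    qed
  qed (intro continuous_intros c a b a' b' a'' b'' deriv_Re_mult_cnj)+
qed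

lemma C2_shift:
  assumes "C2 F D E"
  shows "((\<lambda>x. F (z + of_real x * v)) has_real_derivative D v (z + of_real x * v)) (at x)"
    and "((\<lambda>x. D v (z + of_real x * v)) has_real_derivative E v (z + of_real x * v)) (at x)"
proof -
  have eq: "(\<lambda>s. z + of_real x * v + of_real s * v) = (\<lambda>s. z + of_real (s + x) * v)"
    by (auto simp: algebra_simps)
  have *: "((\<lambda>s::real. G (z + of_real x * v + of_real s * v)) has_real_derivative d) (at 0) \<Longrightarrow>
      ((\<lambda>x. G (z + of_real x * v)) has_real_derivative d) (at x)" for G :: "complex \<Rightarrow> real" and d
    using DERIV_shift[of "\<lambda>x. G (z + of_real x * v)" d 0 x] by (simp add: eq fun_cong[OF eq] algebra_simps)
  show "((\<lambda>x. F (z + of_real x * v)) has_real_derivative D v (z + of_real x * v)) (at x)"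
    and "((\<lambda>x. D v (z + of_real x * v)) has_real_derivative E v (z + of_real x * v)) (at x)"
    using assms by (auto intro!: * simp: C2_def)
qed

text \<open>Subharmonicity of \<open>F \<circ> ln\<close> on the punctured disc: the integral of \<open>F\<close> over the vertical period
  \<open>x + i[0, 2\<pi>]\<close> is a convex function of \<open>x\<close> that is bounded at \<open>-\<infinity>\<close>, hence increasing.\<close>

lemma sub_mean_value:
  assumes C2: "C2 F D E" and per: "\<And>z. F (z + 2 * pi * \<i>) = F z"
    and lap: "\<And>z. Re z \<le> 0 \<Longrightarrow> 0 \<le> E 1 z + E \<i> z"
    and upper: "\<And>z. Re z \<le> 0 \<Longrightarrow> F z \<le> C" and lower: "\<And>z. Re z \<le> 0 \<Longrightarrow> - C * exp (Re z) \<le> F z"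
  shows "0 \<le> integral {0..2*pi} (\<lambda>t. F (\<i> * of_real t))"
proof -
  define m where "m x = integral {0..2*pi} (\<lambda>t. F (of_real x + \<i> * of_real t))" for x
  define m1 where "m1 x = integral {0..2*pi} (\<lambda>t. D 1 (of_real x + \<i> * of_real t))" for x
  define m2 where "m2 x = integral {0..2*pi} (\<lambda>t. E 1 (of_real x + \<i> * of_real t))" for x
  have cont: "continuous_on UNIV F" "continuous_on UNIV (D v)" "continuous_on UNIV (E v)" for v
    using C2 by (auto simp: C2_def)
  have cline: "continuous_on S (\<lambda>t. G (of_real x + \<i> * of_real t))" if "continuous_on UNIV G" for G :: "complex \<Rightarrow> real" and x S
    by (rule continuous_on_compose2[OF that]) (auto intro!: continuous_intros)
  have int: "(\<lambda>t. G (of_real x + \<i> * of_real t)) integrable_on {0..2*pi}" if "continuous_on UNIV G" for G :: "complex \<Rightarrow> real" and x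
    by (rule integrable_continuous_real) (rule cline[OF that])
  have cprod: "continuous_on (UNIV \<times> cbox 0 (2*pi)) (\<lambda>(x, t). G (of_real x + \<i> * of_real t))" if "continuous_on UNIV G" for G :: "complex \<Rightarrow> real"
    unfolding case_prod_unfold by (rule continuous_on_compose2[OF that]) (auto intro!: continuous_intros)
  have d: "((\<lambda>x. F (of_real x + \<i> * of_real t)) has_real_derivative D 1 (of_real x + \<i> * of_real t)) (at x)"
    "((\<lambda>x. D 1 (of_real x + \<i> * of_real t)) has_real_derivative E 1 (of_real x + \<i> * of_real t)) (at x)" for x t
    using C2_shift(1)[OF C2, where z = "\<i> * of_real t" and v = 1 and x = x]
      C2_shift(2)[OF C2, where z = "\<i> * of_real t" and v = 1 and x = x] by (simp_all add: add.commute)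
  have m': "(m has_real_derivative m1 x) (at x)" for x
    unfolding m_def m1_def
    using leibniz_rule_field_derivative[of UNIV 0 "2*pi" "\<lambda>x t. F (of_real x + \<i> * of_real t)" "\<lambda>x t. D 1 (of_real x + \<i> * of_real t)" x]
      d int cprod cont by (simp add: cbox_interval)
  have m1': "(m1 has_real_derivative m2 x) (at x)" for x
    unfolding m1_def m2_def
    using leibniz_rule_field_derivative[of UNIV 0 "2*pi" "\<lambda>x t. D 1 (of_real x + \<i> * of_real t)" "\<lambda>x t. E 1 (of_real x + \<i> * of_real t)" x]
      d int cprod cont by (simp add: cbox_interval)
  have m2_nonneg: "0 \<le> m2 x" if x: "x \<le> 0" for x
  proof -
    have perD: "D v (z + 2 * pi * \<i>) = D v z" for v z
    proof -
      have "((\<lambda>s::real. F (z + of_real s * v)) has_real_derivative D v (z + 2 * pi * \<i>)) (at 0)"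
      proof -
        have "((\<lambda>s::real. F (z + 2 * pi * \<i> + of_real s * v)) has_real_derivative D v (z + 2 * pi * \<i>)) (at 0)"
          using C2 unfolding C2_def by blast
        moreover have "F (z + 2 * pi * \<i> + of_real s * v) = F (z + of_real s * v)" for s
          using per[of "z + of_real s * v"] by (simp add: algebra_simps)
        ultimately show ?thesis by simp
      qed
      moreover have "((\<lambda>s::real. F (z + of_real s * v)) has_real_derivative D v z) (at 0)"
        using C2 unfolding C2_def by blast
      ultimately show ?thesis by (rule DERIV_unique)
    qed
    \<comment> \<open>The second derivative along the period integrates to 0 by periodicity, so
      \<open>m2\<close> equals the integral of the full Laplacian.\<close>
    have "((\<lambda>t. E \<i> (of_real x + \<i> * of_real t)) has_integral
        D \<i> (of_real x + \<i> * of_real (2*pi)) - D \<i> (of_real x + \<i> * of_real 0)) {0..2*pi}"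
    proof (rule fundamental_theorem_of_calculus)
      show "((\<lambda>t. D \<i> (of_real x + \<i> * of_real t)) has_vector_derivative E \<i> (of_real x + \<i> * of_real t)) (at t within {0..2*pi})" for t
        using C2_shift(2)[OF C2, where z = "of_real x" and v = \<i> and x = t]
        by (auto intro: has_vector_derivative_at_within simp: has_real_derivative_iff_has_vector_derivative mult.commute)
    qed simp
    then have "integral {0..2*pi} (\<lambda>t. E \<i> (of_real x + \<i> * of_real t)) = 0"
      using perD[of \<i> "of_real x"] by (simp add: integral_unique mult_ac)
    then have "m2 x = integral {0..2*pi} (\<lambda>t. E 1 (of_real x + \<i> * of_real t) + E \<i> (of_real x + \<i> * of_real t))"
      unfolding m2_def by (subst Henstock_Kurzweil_Integration.integral_add) (auto intro!: int cont)
    also have "\<dots> \<ge> 0"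
      using x by (intro Henstock_Kurzweil_Integration.integral_nonneg Henstock_Kurzweil_Integration.integrable_add int cont) (auto intro!: lap)
    finally show ?thesis .
  qed
  have m1_mono: "m1 x \<le> m1 y" if "x \<le> y" "y \<le> 0" for x y
    using that by (intro DERIV_nonneg_imp_nondecreasing[of x y m1]) (auto intro!: m1' m2_nonneg)
  have m_upper: "m x \<le> 2 * pi * C" if "x \<le> 0" for x
  proof -
    have "m x \<le> integral {0..2*pi} (\<lambda>t. C)"
      unfolding m_def using that by (intro integral_le int cont) (auto intro!: upper)
    then show ?thesis by simp
  qed
  have m_lower: "- (2 * pi * C * exp x) \<le> m x" if "x \<le> 0" for x
  proof -
    have "integral {0..2*pi} (\<lambda>t. - C * exp x) \<le> m x"
      unfolding m_def using that lower[of "of_real x + \<i> * of_real _"] by (intro integral_le int cont) auto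
    then show ?thesis by (simp add: mult_ac)
  qed
  have m1_nonneg: "0 \<le> m1 y" if y: "y \<le> 0" for y
  proof (rule ccontr)
    assume "\<not> 0 \<le> m1 y"
    then have neg: "m1 y < 0" by simp
    \<comment> \<open>Going left by \<open>L\<close> along a slope of at most \<open>m1 y\<close>
      gains 2 pi C - m(y) + 1, which puts \<open>m (y - L)\<close> above the upper bound.\<close>
    define L where "L = (2 * pi * C - m y + 1) / (- m1 y)"
    have "L > 0" unfolding L_def using neg m_upper[OF y] by (intro divide_pos_pos) auto
    obtain z where z: "y - L < z" "z < y" "m y - m (y - L) = (y - (y - L)) * m1 z"
      using MVT2[of "y - L" y m m1] m' \<open>L > 0\<close> by auto
    have "m y - m (y - L) = L * m1 z" using z by simp
    also have "\<dots> \<le> L * m1 y" using m1_mono[of z y] z y \<open>L > 0\<close> by (intro mult_left_mono) auto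
    also have "\<dots> = - (2 * pi * C - m y + 1)" unfolding L_def using neg by simp
    finally have "m (y - L) > 2 * pi * C" by simp
    then show False using m_upper[of "y - L"] y \<open>L > 0\<close> by simp
  qed
  have m_mono: "m x \<le> m 0" if "x \<le> 0" for x
    using that by (intro DERIV_nonneg_imp_nondecreasing[of x 0 m]) (auto intro!: m' m1_nonneg)
  \<comment> \<open>The lower bound tends to 0 at minus infinity and \<open>m\<close> is increasing,
    so its value at 0 is nonnegative.\<close>
  have "((\<lambda>x. - (2 * pi * C * exp x)) \<longlongrightarrow> - (2 * pi * C * 0)) at_bot"
    by (intro tendsto_intros exp_at_bot)
  then have "- (2 * pi * C * 0) \<le> m 0"
  proof (rule tendsto_upperbound)
    show "\<forall>\<^sub>F x in at_bot. - (2 * pi * C * exp x) \<le> m 0"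
      using eventually_le_at_bot[of "0::real"]
      by eventually_elim (rule order_trans[OF m_lower m_mono])
  qed simp
  then show ?thesis by (simp add: m_def)
qed

text \<open>Connects the Lebesgue integral of the estimates with the gauge integral under which
  \<open>sub_mean_value\<close> differentiates.\<close>

lemma integral_Circ_eq_HK:
  fixes f :: "real \<Rightarrow> real"
  assumes "continuous_on UNIV f"
  shows "integral\<^sup>L Circ f = integral {0..2*pi} f"
  unfolding integral_Circ_eq using integrable_Circ_continuous[OF assms]
  by (intro set_borel_integral_eq_integral) (simp add: integrable_Circ_iff)

section \<open>The Poisson kernel\<close>

definition poisson :: "complex \<Rightarrow> real \<Rightarrow> real" where
  "poisson w t = (1 - (norm w)\<^sup>2) / (norm (1 - cnj w * cis t))\<^sup>2"

lemma poisson_denom: "norm w < 1 \<Longrightarrow> 1 - cnj w * cis t \<noteq> 0"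
proof
  assume w: "norm w < 1" and "1 - cnj w * cis t = 0"
  then have "norm (cnj w * cis t) = norm (1::complex)" by (metis eq_iff_diff_eq_0)
  then show False using w by (simp add: norm_mult)
qed

lemma poisson_nonneg: "norm w < 1 \<Longrightarrow> 0 \<le> poisson w t"
  by (simp add: poisson_def power_le_one)

lemma continuous_poisson:
  assumes "norm w < 1"
  shows "continuous_on A (poisson w)"
  unfolding poisson_def[abs_def] using poisson_denom[OF assms] by (intro continuous_intros) auto

text \<open>The kernel is \<open>k + cnj k - 1\<close> with \<open>k\<close> the Cauchy kernel. The
  resolvent identity for \<open>k\<close> gives a recursion in the frequency, and uniform
  boundedness of the coefficients solves it without integrating a series.\<close>

lemma poisson_integral_cis:
  fixes w :: complex
  assumes w: "norm w < 1"
  shows "(\<integral>t. poisson w t * cis (real n * t) \<partial>Circ) = 2 * pi * w ^ n"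
proof -
  define k where "k t = 1 / (1 - cnj w * cis t)" for t
  define A where "A m = (\<integral>t. cis (real_of_int m * t) * k t \<partial>Circ)" for m
  have ck: "continuous_on UNIV k"
    unfolding k_def using poisson_denom[OF w] by (intro continuous_intros) auto
  have int: "integrable Circ (\<lambda>t. cis (real_of_int m * t) * k t)" "integrable Circ (\<lambda>t. cis (real_of_int m * t))" for m
    by (intro integrable_Circ_continuous continuous_intros ck)+
  have rec: "A m = (if m = 0 then 2 * pi else 0) + cnj w * A (m + 1)" for m
  proof -
    have "cis (real_of_int m * t) * k t = cis (real_of_int m * t) + cnj w * (cis (real_of_int (m + 1) * t) * k t)" for t
    proof -
      have "k t = 1 + cnj w * cis t * k t" using poisson_denom[OF w, of t] by (simp add: k_def field_simps)
      then have "cis (real_of_int m * t) * k t = cis (real_of_int m * t) * (1 + cnj w * cis t * k t)" by simp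
      also have "\<dots> = cis (real_of_int m * t) + cnj w * ((cis (real_of_int m * t) * cis t) * k t)"
        by (simp add: algebra_simps)
      finally show ?thesis by (simp add: cis_mult distrib_right)
    qed
    then have "A m = (\<integral>t. cis (real_of_int m * t) + cnj w * (cis (real_of_int (m + 1) * t) * k t) \<partial>Circ)"
      by (simp only: A_def)
    also have "\<dots> = (\<integral>t. cis (real_of_int m * t) \<partial>Circ) + (\<integral>t. cnj w * (cis (real_of_int (m + 1) * t) * k t) \<partial>Circ)"
      by (rule Bochner_Integration.integral_add) (intro int Bochner_Integration.integrable_mult_right)+
    also have "(\<integral>t. cnj w * (cis (real_of_int (m + 1) * t) * k t) \<partial>Circ) = cnj w * A (m + 1)"
      unfolding A_def by (rule integral_mult_right_zero)
    finally show ?thesis unfolding integral_Circ_cis .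
  qed
  have A_bound: "norm (A m) \<le> 2 * pi * (1 / (1 - norm w))" for m
  proof -
    have "norm (A m) \<le> (\<integral>t. norm (cis (real_of_int m * t) * k t) \<partial>Circ)"
      unfolding A_def by (rule integral_norm_bound)
    also have "\<dots> \<le> (\<integral>t. 1 / (1 - norm w) \<partial>Circ)"
    proof (rule integral_mono)
      show "norm (cis (real_of_int m * t) * k t) \<le> 1 / (1 - norm w)" for t
      proof -
        have "1 - norm w \<le> norm (1 - cnj w * cis t)"
          using norm_triangle_ineq2[of 1 "cnj w * cis t"] by (simp add: norm_mult)
        then show ?thesis using w by (simp add: norm_mult k_def norm_divide frac_le)
      qed
    qed (use int in auto)
    also have "\<dots> = 2 * pi * (1 / (1 - norm w))" using measure_Circ by simp
    finally show ?thesis .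
  qed
  have A_pos: "A m = 0" if "m > 0" for m
  proof -
    have eq: "A m = cnj w ^ j * A (m + int j)" for j
    proof (induction j)
      case (Suc j)
      have "A (m + int j) = cnj w * A (m + int j + 1)" using rec[of "m + int j"] that by simp
      then have "cnj w ^ j * A (m + int j) = cnj w ^ Suc j * A (m + int j + 1)" by simp
      then show ?case using Suc by (simp add: add_ac)
    qed simp
    have "norm (A m) \<le> norm w ^ j * (2 * pi * (1 / (1 - norm w)))" for j
      unfolding eq[of j] norm_mult norm_power complex_mod_cnj by (intro mult_left_mono A_bound) simp
    moreover have "(\<lambda>j. norm w ^ j * (2 * pi * (1 / (1 - norm w)))) \<longlonglongrightarrow> 0 * (2 * pi * (1 / (1 - norm w)))"
      using w by (intro tendsto_intros LIMSEQ_power_zero) simp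
    ultimately have "norm (A m) \<le> 0 * (2 * pi * (1 / (1 - norm w)))"
      by (intro tendsto_lowerbound[of _ _ sequentially]) auto
    then show ?thesis by simp
  qed
  have A_neg: "A (- int j) = 2 * pi * cnj w ^ j" for j
  proof (induction j)
    case 0
    then show ?case using rec[of 0] A_pos[of 1] by simp
  next
    case (Suc j)
    have "A (- int (Suc j)) = cnj w * A (- int j)" using rec[of "- int (Suc j)"] by simp
    then show ?case using Suc by simp
  qed
  have split: "poisson w t * cis (real n * t) =
      (cis (real_of_int (int n) * t) * k t + cnj (cis (real_of_int (- int n) * t) * k t)) - cis (real_of_int (int n) * t)" for t
  proof -
    have c1: "cis t * cnj (cis t) = 1" by (simp add: cis_cnj cis_mult)
    have nz: "1 - cnj w * cis t \<noteq> 0" "1 - w * cnj (cis t) \<noteq> 0"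
    proof -
      show "1 - cnj w * cis t \<noteq> 0" by (rule poisson_denom[OF w])
      then have "cnj (1 - cnj w * cis t) \<noteq> 0" by (simp only: complex_cnj_zero_iff not_False_eq_True)
      then show "1 - w * cnj (cis t) \<noteq> 0" by simp
    qed
    have "complex_of_real (poisson w t) = (1 - w * cnj w) / ((1 - cnj w * cis t) * (1 - w * cnj (cis t)))"
      unfolding poisson_def of_real_divide of_real_diff complex_norm_square by simp
    also have "\<dots> = 1 / (1 - cnj w * cis t) + 1 / (1 - w * cnj (cis t)) - 1"
    proof -
      define x y where "x = cnj w * cis t" and "y = w * cnj (cis t)"
      have xy: "x * y = w * cnj w"
        using c1 by (simp add: x_def y_def mult_ac)
      have "1 - x \<noteq> 0" "1 - y \<noteq> 0" using nz by (simp_all add: x_def y_def)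
      then have "(1 - x * y) / ((1 - x) * (1 - y)) = 1 / (1 - x) + 1 / (1 - y) - 1"
        by (simp add: divide_simps) (simp add: algebra_simps)
      then show ?thesis unfolding xy unfolding x_def y_def .
    qed
    also have "\<dots> = k t + cnj (k t) - 1" by (simp add: k_def)
    finally have "complex_of_real (poisson w t) = k t + cnj (k t) - 1" .
    moreover have "cnj (cis (real_of_int (- int n) * t)) = cis (real n * t)" by (simp add: cis_cnj)
    moreover have "complex_of_real (poisson w t) * cis (real n * t) = cis (real n * t) * k t + cis (real n * t) * cnj (k t) - cis (real n * t)"
      unfolding calculation(1) by (simp add: algebra_simps)
    ultimately show ?thesis by (simp only: complex_cnj_mult of_int_of_nat_eq)
  qed
  have "(\<integral>t. poisson w t * cis (real n * t) \<partial>Circ) =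
      (\<integral>t. cis (real_of_int (int n) * t) * k t + cnj (cis (real_of_int (- int n) * t) * k t) \<partial>Circ) - (\<integral>t. cis (real_of_int (int n) * t) \<partial>Circ)"
    unfolding split by (rule Bochner_Integration.integral_diff) (intro int Bochner_Integration.integrable_add integrable_cnj)+
  also have "(\<integral>t. cis (real_of_int (int n) * t) * k t + cnj (cis (real_of_int (- int n) * t) * k t) \<partial>Circ) = A (int n) + cnj (A (- int n))"
  proof -
    have "(\<integral>t. cnj (cis (real_of_int (- int n) * t) * k t) \<partial>Circ) = cnj (A (- int n))"
      unfolding A_def by (rule Bochner_Integration.integral_cnj)
    then show ?thesis
      unfolding A_def[of "int n"]
      using Bochner_Integration.integral_add[OF int(1) integrable_cnj[OF int(1)], of "int n" "- int n"] by (simp only:)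
  qed
  finally show ?thesis
    unfolding A_neg integral_Circ_cis using A_pos[of "int n"] A_neg[of 0] by (cases "n = 0") auto
qed

lemma poisson_integral_poly:
  assumes w: "norm w < 1"
  shows "(\<integral>t. poisson w t * poly p (cis t) \<partial>Circ) = 2 * pi * poly p w"
proof -
  have "poisson w t * poly p (cis t) = (\<Sum>i\<le>degree p. coeff p i * (poisson w t * cis (real i * t)))" for t
    unfolding poly_altdef sum_distrib_left
  proof (intro sum.cong refl)
    fix i
    have "cis t ^ i = cis (real i * t)" by (rule Complex.DeMoivre)
    then show "poisson w t * (coeff p i * cis t ^ i) = coeff p i * (poisson w t * cis (real i * t))"
      by (simp only: mult_ac)
  qed
  then have "(\<integral>t. poisson w t * poly p (cis t) \<partial>Circ) = (\<integral>t. (\<Sum>i\<le>degree p. coeff p i * (poisson w t * cis (real i * t))) \<partial>Circ)"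
    by simp
  also have "\<dots> = (\<Sum>i\<le>degree p. \<integral>t. coeff p i * (poisson w t * cis (real i * t)) \<partial>Circ)"
    by (rule Bochner_Integration.integral_sum)
      (intro integrable_Circ_continuous continuous_intros continuous_poisson w)
  also have "\<dots> = (\<Sum>i\<le>degree p. coeff p i * (2 * pi * w ^ i))"
    unfolding integral_mult_right_zero poisson_integral_cis[OF w] ..
  finally show ?thesis unfolding poly_altdef sum_distrib_left by (simp add: mult_ac)
qed

lemma poisson_integral_Re_poly:
  assumes w: "norm w < 1"
  shows "(\<integral>t. poisson w t * Re (poly p (cis t)) \<partial>Circ) = 2 * pi * Re (poly p w)"
proof -
  have int: "integrable Circ (\<lambda>t. poisson w t * poly p (cis t))"
    by (intro integrable_Circ_continuous continuous_intros continuous_poisson w)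
  show ?thesis
    using integral_Re[OF int] unfolding poisson_integral_poly[OF w] by simp
qed

lemma poisson_integral_1: "norm w < 1 \<Longrightarrow> (\<integral>t. poisson w t \<partial>Circ) = 2 * pi"
  using poisson_integral_Re_poly[of w 1] by simp

text \<open>Supplies the harmonic extension of |u|^2 from the circle as the real part of a
  polynomial, with no Dirichlet problem to solve.\<close>

lemma ex_poly_Re_mult_cnj:
  "\<exists>W. \<forall>z. norm z = 1 \<longrightarrow> Re (poly W z) = Re (poly a z * cnj (poly b z))"
proof (induction a arbitrary: b rule: pCons_induct)
  case 0
  show ?case by (rule exI[of _ 0]) simp
next
  case (pCons c a)
  obtain d b' where b: "b = pCons d b'" by (cases b)
  obtain W where W: "\<And>z. norm z = 1 \<Longrightarrow> Re (poly W z) = Re (poly a z * cnj (poly b' z))"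
    using pCons(2)[of b'] by blast
  \<comment> \<open>Expands (c + z a) times the conjugate of (d + z b') with |z| = 1. The
    antianalytic term is replaced by its conjugate, which has the same real part.\<close>
  define V where "V = W + [:c * cnj d:] + smult (cnj c) (pCons 0 b') + smult (cnj d) (pCons 0 a)"
  have "Re (poly V z) = Re (poly (pCons c a) z * cnj (poly b z))" if z: "norm z = 1" for z
  proof -
    have zz: "z * cnj z = 1" using z complex_norm_square[of z] by simp
    have "poly (pCons c a) z * cnj (poly b z) = c * cnj d + c * cnj (z * poly b' z) + cnj d * (z * poly a z) +
        (z * cnj z) * (poly a z * cnj (poly b' z))"
      by (simp add: b algebra_simps)
    then have "Re (poly (pCons c a) z * cnj (poly b z)) = Re (c * cnj d) + Re (c * cnj (z * poly b' z)) +
        Re (cnj d * (z * poly a z)) + Re (poly a z * cnj (poly b' z))"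
      unfolding zz by simp
    moreover have "Re (c * cnj (z * poly b' z)) = Re (cnj c * (z * poly b' z))" by (simp add: algebra_simps)
    ultimately show ?thesis
      by (simp only: V_def poly_add poly_smult poly_pCons poly_0 W[OF z] plus_complex.sel) simp
  qed
  then show ?case by blast
qed

section \<open>Bounding a Hankel form by the Garsia norm of its symbol\<close>

text \<open>With \<open>\<alpha> = a' a\<^sup>*\<close>, \<open>\<beta> = U' U\<^sup>*\<close> the Laplacian of \<open>|a|\<^sup>2 exp (c |U|\<^sup>2)\<close> is
  \<open>4 exp (c |U|\<^sup>2) (|a' + c a \<beta>|\<^sup>2 + c |a|\<^sup>2 |U'|\<^sup>2)\<close>.\<close>

lemma C2_weighted:
  assumes a: "a holomorphic_on UNIV" and U: "U holomorphic_on UNIV"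
  shows "\<exists>D E. C2 (\<lambda>z. (norm (a z))\<^sup>2 * exp (c * (norm (U z))\<^sup>2)) D E \<and>
    (\<forall>z. E 1 z + E \<i> z = 4 * exp (c * (norm (U z))\<^sup>2) *
      ((norm (deriv a z + of_real c * a z * (deriv U z * cnj (U z))))\<^sup>2 + c * (norm (a z))\<^sup>2 * (norm (deriv U z))\<^sup>2))"
proof -
  have n2: "(norm x)\<^sup>2 = Re (x * cnj x)" for x :: complex
    unfolding complex_norm_square[symmetric] by simp
  define Da where "Da v z = Re (v * deriv a z * cnj (a z) + a z * cnj (v * deriv a z))" for v z
  define Ea where "Ea v z = Re (v\<^sup>2 * deriv (deriv a) z * cnj (a z) + 2 * (v * cnj v) * deriv a z * cnj (deriv a z) +
      a z * cnj (v\<^sup>2 * deriv (deriv a) z))" for v z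
  define DU where "DU v z = Re (v * deriv U z * cnj (U z) + U z * cnj (v * deriv U z))" for v z
  define EU where "EU v z = Re (v\<^sup>2 * deriv (deriv U) z * cnj (U z) + 2 * (v * cnj v) * deriv U z * cnj (deriv U z) +
      U z * cnj (v\<^sup>2 * deriv (deriv U) z))" for v z
  define G where "G z = exp (c * (norm (U z))\<^sup>2)" for z
  have 1: "C2 (\<lambda>z. (norm (a z))\<^sup>2) Da Ea"
    using C2_Re_mult_cnj[OF a a] unfolding n2 Da_def[abs_def] Ea_def[abs_def] .
  have 2: "C2 (\<lambda>z. (norm (U z))\<^sup>2) DU EU"
    using C2_Re_mult_cnj[OF U U] unfolding n2 DU_def[abs_def] EU_def[abs_def] .
  note 3 = C2_mult[OF 1 C2_exp[OF C2_cmult[OF 2, of c]], folded G_def]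
  have sumE: "Ea 1 z + Ea \<i> z = 4 * (norm (deriv a z))\<^sup>2" "EU 1 z + EU \<i> z = 4 * (norm (deriv U z))\<^sup>2" for z
    unfolding Ea_def EU_def n2 by (simp_all add: algebra_simps)
  have sumDD: "Da 1 z * DU 1 z + Da \<i> z * DU \<i> z = 4 * Re ((deriv a z * cnj (a z)) * cnj (deriv U z * cnj (U z)))" for z
    unfolding Da_def DU_def by (simp add: algebra_simps)
  have sumD2: "(DU 1 z)\<^sup>2 + (DU \<i> z)\<^sup>2 = 4 * (norm (deriv U z * cnj (U z)))\<^sup>2" for z
    unfolding DU_def n2 by (simp add: algebra_simps power2_eq_square)
  show ?thesis
  proof (intro exI conjI allI, rule 3[unfolded G_def])
    fix z
    define \<alpha> \<beta> where "\<alpha> = deriv a z" and "\<beta> = deriv U z * cnj (U z)"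
    have eq1: "(norm (\<alpha> + of_real c * a z * \<beta>))\<^sup>2 = (norm \<alpha>)\<^sup>2 + 2 * c * Re ((\<alpha> * cnj (a z)) * cnj \<beta>) + c\<^sup>2 * (norm (a z))\<^sup>2 * (norm \<beta>)\<^sup>2"
      unfolding n2 by (simp add: algebra_simps power2_eq_square)
    have eq2: "Ea 1 z * G z + 2 * Da 1 z * (G z * (c * DU 1 z)) + (norm (a z))\<^sup>2 * (G z * ((c * DU 1 z)\<^sup>2 + c * EU 1 z)) +
      (Ea \<i> z * G z + 2 * Da \<i> z * (G z * (c * DU \<i> z)) + (norm (a z))\<^sup>2 * (G z * ((c * DU \<i> z)\<^sup>2 + c * EU \<i> z))) =
      G z * ((Ea 1 z + Ea \<i> z) + 2 * c * (Da 1 z * DU 1 z + Da \<i> z * DU \<i> z) +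
        (norm (a z))\<^sup>2 * (c\<^sup>2 * ((DU 1 z)\<^sup>2 + (DU \<i> z)\<^sup>2) + c * (EU 1 z + EU \<i> z)))"
      by (simp add: algebra_simps power2_eq_square)
    show "Ea 1 z * exp (c * (norm (U z))\<^sup>2) + 2 * Da 1 z * (exp (c * (norm (U z))\<^sup>2) * (c * DU 1 z)) +
        (norm (a z))\<^sup>2 * (exp (c * (norm (U z))\<^sup>2) * ((c * DU 1 z)\<^sup>2 + c * EU 1 z)) +
      (Ea \<i> z * exp (c * (norm (U z))\<^sup>2) + 2 * Da \<i> z * (exp (c * (norm (U z))\<^sup>2) * (c * DU \<i> z)) +
        (norm (a z))\<^sup>2 * (exp (c * (norm (U z))\<^sup>2) * ((c * DU \<i> z)\<^sup>2 + c * EU \<i> z))) =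
      4 * exp (c * (norm (U z))\<^sup>2) *
      ((norm (deriv a z + of_real c * a z * (deriv U z * cnj (U z))))\<^sup>2 + c * (norm (a z))\<^sup>2 * (norm (deriv U z))\<^sup>2)"
      unfolding G_def[symmetric]
      unfolding eq2 sumE sumDD sumD2 unfolding \<alpha>_def[symmetric] \<beta>_def[symmetric] eq1
      by (simp only: algebra_simps)
  qed
qed

text \<open>The \<open>v\<^sup>2\<close> terms cancel between the directions 1 and i, and only the
  mixed term survives.\<close>

lemma C2_Re_laplacian:
  assumes a: "a holomorphic_on UNIV" and b: "b holomorphic_on UNIV"
  shows "\<exists>D E. C2 (\<lambda>z. Re (a z * cnj (b z))) D E \<and>
    (\<forall>z. E 1 z + E \<i> z = 4 * Re (deriv a z * cnj (deriv b z)))"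
  by (intro exI conjI, rule C2_Re_mult_cnj[OF a b]) (simp add: algebra_simps)

text \<open>The pullback by exp turns the punctured disc into a half plane and circles into vertical
  periods, as \<open>sub_mean_value\<close> requires.\<close>

definition epoly :: "complex poly \<Rightarrow> complex \<Rightarrow> complex" where
  "epoly p z = poly p (exp z)"

lemma holomorphic_epoly: "epoly p holomorphic_on UNIV"
proof -
  have "(poly p \<circ> exp) holomorphic_on UNIV"
    by (rule holomorphic_on_compose) (auto intro!: holomorphic_intros)
  then show ?thesis by (simp add: epoly_def[abs_def] o_def)
qed

text \<open>Here \<open>\<phi> = (|u|\<^sup>2 - P[|u|\<^sup>2]) / X\<close> satisfies \<open>-1 \<le> \<phi>\<close> in the disc and vanishes on the circle; the
  function \<open>k (e\<^sup>\<phi> + 1) (|f|\<^sup>2 + |h|\<^sup>2) / 2 - Re (\<omega> u (f h)\<^sup>*)\<close> is subharmonic.\<close>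

lemma hankel_form_poly_bound:
  fixes u f h :: "complex poly"
  assumes X: "X > 0" and u0: "poly u 0 = 0"
    and osc: "\<And>w. norm w < 1 \<Longrightarrow> (\<integral>t. poisson w t * (norm (poly u (cis t) - poly u w))\<^sup>2 \<partial>Circ) \<le> 2 * pi * X"
  shows "norm (\<integral>t. poly u (cis t) * cnj (poly f (cis t) * poly h (cis t)) \<partial>Circ) \<le>
    sqrt (exp 1 * X) * (\<integral>t. (norm (poly f (cis t)))\<^sup>2 + (norm (poly h (cis t)))\<^sup>2 \<partial>Circ)"
proof -
  obtain W where W: "\<And>z. norm z = 1 \<Longrightarrow> Re (poly W z) = (norm (poly u z))\<^sup>2"
    using ex_poly_Re_mult_cnj[of u u] unfolding complex_norm_square[symmetric] by auto
  \<comment> \<open>Inside the disc the left side is the Poisson variance of \<open>u\<close> at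
    \<open>w\<close>, which the oscillation hypothesis bounds; on the circle it is 0.\<close>
  have W_disc: "Re (poly W w) - (norm (poly u w))\<^sup>2 \<le> X" if w: "norm w \<le> 1" for w
  proof (cases "norm w = 1")
    case False
    then have w: "norm w < 1" using that by simp
    note ints = integrable_Circ_continuous continuous_intros continuous_poisson[OF w]
    define b where "b = poly u w"
    have e: "poisson w t * (norm (poly u (cis t) - b))\<^sup>2 =
        poisson w t * Re (poly (W - smult (2 * cnj b) u + [:of_real ((norm b)\<^sup>2):]) (cis t))" for t
    proof -
      have "(norm (poly u (cis t) - b))\<^sup>2 = (norm (poly u (cis t)))\<^sup>2 - 2 * Re (cnj b * poly u (cis t)) + (norm b)\<^sup>2"
        unfolding cmod_power2 by (simp add: algebra_simps power2_eq_square)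
      then show ?thesis using W[of "cis t"] by simp
    qed
    have "(\<integral>t. poisson w t * (norm (poly u (cis t) - b))\<^sup>2 \<partial>Circ) = 2 * pi * (Re (poly W w) - (norm b)\<^sup>2)"
    proof -
      have "Re (cnj b * b) = (norm b)\<^sup>2" unfolding cmod_power2 by (simp add: power2_eq_square)
      then show ?thesis
        unfolding e poisson_integral_Re_poly[OF w] by (simp add: b_def[symmetric] mult.assoc)
    qed
    then show ?thesis using osc[OF w] unfolding b_def by (simp add: mult_le_cancel_left)
  qed (use W X in simp)
  define c where "c = 1 / X"
  define k where "k = sqrt (exp 1 * X)"
  have k: "k > 0" "k\<^sup>2 = exp 1 * X" using X by (simp_all add: k_def)
  define H where "H = (\<integral>t. poly u (cis t) * cnj (poly f (cis t) * poly h (cis t)) \<partial>Circ)"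
  define \<omega> where "\<omega> = (if H = 0 then 1 else cnj H / norm H)"
  have \<omega>: "norm \<omega> = 1" "\<omega> * H = norm H"
    using complex_norm_square[of H] by (auto simp: \<omega>_def norm_divide power2_eq_square field_simps)
  \<comment> \<open>The harmonic part of the weight is absorbed into a holomorphic factor of modulus
    exp(-c Re W / 2), so that \<open>C2_weighted\<close> applies with |u|^2 alone in the
    exponent.\<close>
  define q where "q p z = epoly p z * exp (- of_real (c / 2) * epoly W z)" for p z
  have q_hol: "q p holomorphic_on UNIV" for p
    unfolding q_def[abs_def] by (intro holomorphic_intros holomorphic_epoly)
  have qn: "(norm (q p z))\<^sup>2 * exp (c * (norm (epoly u z))\<^sup>2) = (norm (epoly p z))\<^sup>2 * exp (c * ((norm (epoly u z))\<^sup>2 - Re (epoly W z)))" for p z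
    unfolding q_def norm_mult norm_exp_eq_Re power_mult_distrib
    by (simp add: power2_eq_square mult.assoc exp_add[symmetric] algebra_simps)
  have phi: "exp (c * ((norm (epoly u z))\<^sup>2 - Re (epoly W z))) \<ge> exp (- 1)" if "Re z \<le> 0" for z
  proof -
    have "norm (exp z) \<le> 1" using that by simp
    from W_disc[OF this] have "- X \<le> (norm (epoly u z))\<^sup>2 - Re (epoly W z)" by (simp add: epoly_def)
    then have "c * (- X) \<le> c * ((norm (epoly u z))\<^sup>2 - Re (epoly W z))"
      using X by (intro mult_left_mono) (auto simp: c_def)
    then show ?thesis using X by (simp add: c_def)
  qed
  obtain D1 E1 where C1: "C2 (\<lambda>z. (norm (q f z))\<^sup>2 * exp (c * (norm (epoly u z))\<^sup>2)) D1 E1"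
    and L1: "\<And>z. E1 1 z + E1 \<i> z = 4 * exp (c * (norm (epoly u z))\<^sup>2) *
      ((norm (deriv (q f) z + of_real c * q f z * (deriv (epoly u) z * cnj (epoly u z))))\<^sup>2 + c * (norm (q f z))\<^sup>2 * (norm (deriv (epoly u) z))\<^sup>2)"
    using C2_weighted[OF q_hol[of f] holomorphic_epoly[of u], of c] by blast
  obtain D2 E2 where C2: "C2 (\<lambda>z. (norm (q h z))\<^sup>2 * exp (c * (norm (epoly u z))\<^sup>2)) D2 E2"
    and L2: "\<And>z. E2 1 z + E2 \<i> z = 4 * exp (c * (norm (epoly u z))\<^sup>2) *
      ((norm (deriv (q h) z + of_real c * q h z * (deriv (epoly u) z * cnj (epoly u z))))\<^sup>2 + c * (norm (q h z))\<^sup>2 * (norm (deriv (epoly u) z))\<^sup>2)"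
    using C2_weighted[OF q_hol[of h] holomorphic_epoly[of u], of c] by blast
  obtain D3 E3 where C3: "C2 (\<lambda>z. Re (epoly f z * cnj (epoly f z))) D3 E3"
    and L3: "\<And>z. E3 1 z + E3 \<i> z = 4 * Re (deriv (epoly f) z * cnj (deriv (epoly f) z))"
    using C2_Re_laplacian[OF holomorphic_epoly[of f] holomorphic_epoly[of f]] by blast
  obtain D4 E4 where C4: "C2 (\<lambda>z. Re (epoly h z * cnj (epoly h z))) D4 E4"
    and L4: "\<And>z. E4 1 z + E4 \<i> z = 4 * Re (deriv (epoly h) z * cnj (deriv (epoly h) z))"
    using C2_Re_laplacian[OF holomorphic_epoly[of h] holomorphic_epoly[of h]] by blast
  define \<omega>u where "\<omega>u = smult (- \<omega>) u"
  obtain D5 E5 where C5: "C2 (\<lambda>z. Re (epoly \<omega>u z * cnj (epoly (f * h) z))) D5 E5"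
    and L5: "\<And>z. E5 1 z + E5 \<i> z = 4 * Re (deriv (epoly \<omega>u) z * cnj (deriv (epoly (f * h)) z))"
    using C2_Re_laplacian[OF holomorphic_epoly[of \<omega>u] holomorphic_epoly[of "f * h"]] by blast
  define F where "F z = k / 2 * ((norm (q f z))\<^sup>2 * exp (c * (norm (epoly u z))\<^sup>2)) + k / 2 * ((norm (q h z))\<^sup>2 * exp (c * (norm (epoly u z))\<^sup>2)) +
    k / 2 * Re (epoly f z * cnj (epoly f z)) + k / 2 * Re (epoly h z * cnj (epoly h z)) + Re (epoly \<omega>u z * cnj (epoly (f * h) z))" for z
  define E where "E v z = k / 2 * E1 v z + k / 2 * E2 v z + k / 2 * E3 v z + k / 2 * E4 v z + E5 v z" for v z
  define D where "D v z = k / 2 * D1 v z + k / 2 * D2 v z + k / 2 * D3 v z + k / 2 * D4 v z + D5 v z" for v z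
  have C2F: "C2 F D E"
    unfolding F_def[abs_def] D_def[abs_def] E_def[abs_def]
    by (intro C2_add C2_cmult C1 C2 C3 C4 C5)
  have n2: "Re (x * cnj x) = (norm x)\<^sup>2" for x :: complex
    unfolding complex_norm_square[symmetric] by simp
  define \<kappa> where "\<kappa> z = k / 2 * ((norm (poly f z))\<^sup>2 + (norm (poly h z))\<^sup>2) * (exp (c * ((norm (poly u z))\<^sup>2 - Re (poly W z))) + 1) -
    Re (\<omega> * (poly u z * cnj (poly f z * poly h z)))" for z
  have F_\<kappa>: "F z = \<kappa> (exp z)" for z
    unfolding F_def qn unfolding n2 \<kappa>_def \<omega>u_def epoly_def by (simp add: algebra_simps)
  have \<kappa>_cont: "continuous_on A \<kappa>" for A
    unfolding \<kappa>_def[abs_def] by (intro continuous_intros)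
  obtain C0 where "\<forall>x\<in>\<kappa> ` cball 0 1. norm x \<le> C0"
    using compact_imp_bounded[OF compact_continuous_image[OF \<kappa>_cont compact_cball[of 0 1]]]
    unfolding bounded_iff by blast
  then have C0: "\<bar>\<kappa> z\<bar> \<le> C0" if "norm z \<le> 1" for z
    using that by auto
  \<comment> \<open>Here u(0) = 0 is used: the factor z of \<open>u\<close> becomes the decay exp(Re
    z) in the lower bound.\<close>
  obtain u1 where u1: "u = pCons 0 u1"
    using u0 by (cases u) simp
  have "continuous_on (cball 0 1) (\<lambda>z. poly (u1 * f * h) z)" by (intro continuous_intros)
  from compact_imp_bounded[OF compact_continuous_image[OF this compact_cball]]
  obtain C1 where "\<forall>x\<in>(\<lambda>z. poly (u1 * f * h) z) ` cball 0 1. norm x \<le> C1"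
    unfolding bounded_iff by blast
  then have C1: "norm (poly (u1 * f * h) z) \<le> C1" if "norm z \<le> 1" for z
    using that by auto
  have lower: "- max C0 C1 * exp (Re z) \<le> F z" if "Re z \<le> 0" for z
  proof -
    define y where "y = exp z"
    have y: "norm y \<le> 1" "norm y = exp (Re z)" using that by (simp_all add: y_def)
    have "Re (\<omega> * (poly u y * cnj (poly f y * poly h y))) \<le> norm (\<omega> * (poly u y * cnj (poly f y * poly h y)))"
      by (rule complex_Re_le_cmod)
    also have "\<dots> = norm y * norm (poly (u1 * f * h) y)"
      by (simp add: norm_mult \<omega> u1 mult_ac)
    also have "\<dots> \<le> norm y * max C0 C1"
      using C1[OF y(1)] by (intro mult_left_mono) auto
    finally have "- (norm y * max C0 C1) \<le> - Re (\<omega> * (poly u y * cnj (poly f y * poly h y)))" by simp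
    also have "\<dots> \<le> \<kappa> y"
      unfolding \<kappa>_def using k(1) by (simp add: add_nonneg_nonneg)
    finally show ?thesis unfolding F_\<kappa> y_def[symmetric] y(2) by (simp add: mult.commute)
  qed
  have lap: "0 \<le> E 1 z + E \<i> z" if z: "Re z \<le> 0" for z
  proof -
    define u' where "u' = norm (deriv (epoly u) z)"
    define a a' b b' where "a = norm (epoly f z)" and "a' = norm (deriv (epoly f) z)"
      and "b = norm (epoly h z)" and "b' = norm (deriv (epoly h) z)"
    have pos: "u' \<ge> 0" "a \<ge> 0" "a' \<ge> 0" "b \<ge> 0" "b' \<ge> 0" by (simp_all add: u'_def a_def a'_def b_def b'_def)
    \<comment> \<open>Drops the square in the Laplacian and bounds the weight below by 1/e.\<close>
    have low: "4 * exp (- 1) * c * (norm (epoly p z))\<^sup>2 * u'\<^sup>2 \<le> 4 * exp (c * (norm (epoly u z))\<^sup>2) *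
      ((norm (deriv (q p) z + of_real c * q p z * (deriv (epoly u) z * cnj (epoly u z))))\<^sup>2 + c * (norm (q p z))\<^sup>2 * (norm (deriv (epoly u) z))\<^sup>2)" for p
    proof -
      have "4 * exp (- 1) * c * (norm (epoly p z))\<^sup>2 * u'\<^sup>2 = 4 * c * u'\<^sup>2 * ((norm (epoly p z))\<^sup>2 * exp (- 1))" by simp
      also have "\<dots> \<le> 4 * c * u'\<^sup>2 * ((norm (epoly p z))\<^sup>2 * exp (c * ((norm (epoly u z))\<^sup>2 - Re (epoly W z))))"
        using phi[OF z] X by (intro mult_left_mono) (auto simp: c_def)
      also have "\<dots> = 4 * exp (c * (norm (epoly u z))\<^sup>2) * (0 + c * (norm (q p z))\<^sup>2 * (norm (deriv (epoly u) z))\<^sup>2)"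
        unfolding qn[symmetric] u'_def by (simp add: mult_ac)
      also have "\<dots> \<le> 4 * exp (c * (norm (epoly u z))\<^sup>2) *
        ((norm (deriv (q p) z + of_real c * q p z * (deriv (epoly u) z * cnj (epoly u z))))\<^sup>2 + c * (norm (q p z))\<^sup>2 * (norm (deriv (epoly u) z))\<^sup>2)"
        by (intro mult_left_mono add_right_mono) auto
      finally show ?thesis .
    qed
    have dfh: "deriv (epoly (f * h)) z = deriv (epoly f) z * epoly h z + epoly f z * deriv (epoly h) z"
    proof -
      have "epoly (f * h) = (\<lambda>z. epoly f z * epoly h z)" by (simp add: epoly_def fun_eq_iff)
      then show ?thesis
        using DERIV_mult[OF holomorphic_derivI[OF holomorphic_epoly[of f], of z] holomorphic_derivI[OF holomorphic_epoly[of h], of z]]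
        by (intro DERIV_imp_deriv) (simp add: algebra_simps)
    qed
    have du: "deriv (epoly \<omega>u) z = - \<omega> * deriv (epoly u) z"
    proof -
      have "epoly \<omega>u = (\<lambda>z. - \<omega> * epoly u z)" by (simp add: epoly_def fun_eq_iff \<omega>u_def)
      then show ?thesis
        using DERIV_cmult[OF holomorphic_derivI[OF holomorphic_epoly[of u], of z], of "- \<omega>"]
        by (intro DERIV_imp_deriv) simp
    qed
    have "\<bar>Re (deriv (epoly \<omega>u) z * cnj (deriv (epoly (f * h)) z))\<bar> \<le> norm (deriv (epoly \<omega>u) z * cnj (deriv (epoly (f * h)) z))"
      by (rule abs_Re_le_cmod)
    also have "\<dots> = u' * norm (deriv (epoly f) z * epoly h z + epoly f z * deriv (epoly h) z)"
      unfolding norm_mult complex_mod_cnj du dfh by (simp add: \<omega> u'_def)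
    also have "\<dots> \<le> u' * (a' * b + a * b')"
      using norm_triangle_ineq[of "deriv (epoly f) z * epoly h z" "epoly f z * deriv (epoly h) z"]
      by (intro mult_left_mono pos) (simp add: norm_mult a_def a'_def b_def b'_def)
    finally have l5: "- (4 * (u' * (a' * b + a * b'))) \<le> E5 1 z + E5 \<i> z" unfolding L5 by simp
    have l1: "4 * exp (- 1) * c * a\<^sup>2 * u'\<^sup>2 \<le> E1 1 z + E1 \<i> z" unfolding L1 a_def by (rule low)
    have l2: "4 * exp (- 1) * c * b\<^sup>2 * u'\<^sup>2 \<le> E2 1 z + E2 \<i> z" unfolding L2 b_def by (rule low)
    have l3: "E3 1 z + E3 \<i> z = 4 * a'\<^sup>2" unfolding L3 n2 a'_def ..
    have l4: "E4 1 z + E4 \<i> z = 4 * b'\<^sup>2" unfolding L4 n2 b'_def ..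
    have ck: "exp (- 1) * c = 1 / k\<^sup>2" unfolding k(2) c_def by (simp add: exp_minus field_simps)
    \<comment> \<open>Young's inequality, for which \<open>k\<close> was chosen: k^2 = e X is the
      reciprocal of \<open>exp (- 1) * c\<close>. The cross terms pair |f| u' with |h'| and |h| u'
      with |f'|.\<close>
    have quad: "u' * x * y \<le> k / 2 * (1 / k\<^sup>2 * x\<^sup>2 * u'\<^sup>2) + k / 2 * y\<^sup>2" for x y :: real
    proof -
      have "0 \<le> (u' * x - k * y)\<^sup>2 / (2 * k)" using k(1) by simp
      also have "\<dots> = k / 2 * (1 / k\<^sup>2 * x\<^sup>2 * u'\<^sup>2) + k / 2 * y\<^sup>2 - u' * x * y"
        using k(1) by (simp add: field_simps power2_eq_square)
      finally show ?thesis by simp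
    qed
    have "E 1 z + E \<i> z = k / 2 * (E1 1 z + E1 \<i> z) + k / 2 * (E2 1 z + E2 \<i> z) + k / 2 * (E3 1 z + E3 \<i> z) +
        k / 2 * (E4 1 z + E4 \<i> z) + (E5 1 z + E5 \<i> z)"
      unfolding E_def by (simp add: algebra_simps)
    also have "\<dots> \<ge> k / 2 * (4 * exp (- 1) * c * a\<^sup>2 * u'\<^sup>2) + k / 2 * (4 * exp (- 1) * c * b\<^sup>2 * u'\<^sup>2) + k / 2 * (4 * a'\<^sup>2) +
        k / 2 * (4 * b'\<^sup>2) + - (4 * (u' * (a' * b + a * b')))"
      unfolding l3 l4 using l1 l2 l5 k(1) by (intro add_mono mult_left_mono) auto
    finally have low: "k / 2 * (4 * exp (- 1) * c * a\<^sup>2 * u'\<^sup>2) + k / 2 * (4 * exp (- 1) * c * b\<^sup>2 * u'\<^sup>2) + k / 2 * (4 * a'\<^sup>2) +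
        k / 2 * (4 * b'\<^sup>2) + - (4 * (u' * (a' * b + a * b'))) \<le> E 1 z + E \<i> z" .
    have "k / 2 * (4 * exp (- 1) * c * a\<^sup>2 * u'\<^sup>2) + k / 2 * (4 * exp (- 1) * c * b\<^sup>2 * u'\<^sup>2) + k / 2 * (4 * a'\<^sup>2) +
        k / 2 * (4 * b'\<^sup>2) + - (4 * (u' * (a' * b + a * b'))) =
      4 * ((k / 2 * ((exp (- 1) * c) * a\<^sup>2 * u'\<^sup>2) + k / 2 * b'\<^sup>2 - u' * a * b') +
        (k / 2 * ((exp (- 1) * c) * b\<^sup>2 * u'\<^sup>2) + k / 2 * a'\<^sup>2 - u' * b * a'))"
      by (simp add: algebra_simps)
    also have "\<dots> \<ge> 0" unfolding ck using quad[of a b'] quad[of b a']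
      by (intro mult_nonneg_nonneg add_nonneg_nonneg) linarith+
    finally show ?thesis using low by linarith
  qed
  have "0 \<le> integral {0..2*pi} (\<lambda>t. F (\<i> * of_real t))"
  proof (rule sub_mean_value[OF C2F _ lap _ lower])
    show "F (z + 2 * pi * \<i>) = F z" for z
      unfolding F_\<kappa> exp_add exp_two_pi_i by simp
    show "F z \<le> max C0 C1" if "Re z \<le> 0" for z
      using C0[of "exp z"] that unfolding F_\<kappa> by simp
  qed
  also have "integral {0..2*pi} (\<lambda>t. F (\<i> * of_real t)) = (\<integral>t. F (\<i> * of_real t) \<partial>Circ)"
  proof (rule integral_Circ_eq_HK[symmetric])
    have "continuous_on UNIV F" using C2F by (simp add: C2_def)
    then show "continuous_on UNIV (\<lambda>t::real. F (\<i> * of_real t))"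
      by (rule continuous_on_compose2) (auto intro!: continuous_intros)
  qed
  also have "(\<integral>t. F (\<i> * of_real t) \<partial>Circ) =
      (\<integral>t. k * ((norm (poly f (cis t)))\<^sup>2 + (norm (poly h (cis t)))\<^sup>2) - Re (\<omega> * (poly u (cis t) * cnj (poly f (cis t) * poly h (cis t)))) \<partial>Circ)"
    \<comment> \<open>On the circle Re W = |u|^2, the exponential is 1, and the two halves of the
      coefficient add up to \<open>k\<close>.\<close>
    unfolding F_\<kappa> cis_conv_exp[symmetric] \<kappa>_def using W by simp
  also have "\<dots> = k * (\<integral>t. (norm (poly f (cis t)))\<^sup>2 + (norm (poly h (cis t)))\<^sup>2 \<partial>Circ) -
      (\<integral>t. Re (\<omega> * (poly u (cis t) * cnj (poly f (cis t) * poly h (cis t)))) \<partial>Circ)"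
    unfolding integral_mult_right_zero[symmetric]
    by (rule Bochner_Integration.integral_diff) (intro integrable_Circ_continuous continuous_intros)+
  also have "(\<integral>t. Re (\<omega> * (poly u (cis t) * cnj (poly f (cis t) * poly h (cis t)))) \<partial>Circ) = norm H"
  proof -
    have "integrable Circ (\<lambda>t. \<omega> * (poly u (cis t) * cnj (poly f (cis t) * poly h (cis t))))"
      by (intro integrable_Circ_continuous continuous_intros)
    from integral_Re[OF this] show ?thesis
      unfolding integral_mult_right_zero H_def[symmetric] \<omega>(2) by simp
  qed
  finally show ?thesis unfolding H_def k_def by simp
qed

section \<open>Hankel forms of polynomials as circle integrals\<close>

definition lp :: "complex poly \<Rightarrow> l2" where
  "lp p = l2_of (coeff p)"

lemma coef_lp [simp]: "coef (lp p) = coeff p"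
proof -
  have "{n. coeff p n \<noteq> 0} \<subseteq> {..degree p}" by (auto intro: le_degree)
  then have "coeff p \<in> H2" by (intro H2_finite finite_subset[OF _ finite_atMost])
  then show ?thesis by (simp add: lp_def)
qed

lemma poly_cis_eq_tp: "degree p < N \<Longrightarrow> poly p (cis t) = tp N (lp p) t"
proof -
  assume "degree p < N"
  then have "tp N (lp p) t = (\<Sum>i\<le>degree p. coeff p i * cis (real i * t))"
    unfolding tp_def coef_lp by (intro sum.mono_neutral_right) (auto simp: coeff_eq_0)
  then show ?thesis unfolding poly_altdef Complex.DeMoivre by simp
qed

lemma integral_poly_norm_sq: "(\<integral>t. (norm (poly p (cis t)))\<^sup>2 \<partial>Circ) = 2 * pi * (norm (lp p))\<^sup>2"
proof -
  have "trunc (Suc (degree p)) (lp p) = lp p" by (rule l2_eqI) (auto simp: coeff_eq_0)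
  then show ?thesis
    using integral_tp_norm_sq[of "Suc (degree p)" "lp p"] by (simp add: poly_cis_eq_tp[of p "Suc (degree p)"])
qed

lemma integral_poly_cis: "(\<integral>t. poly p (cis t) * cis (- (real n * t)) \<partial>Circ) = 2 * pi * coeff p n"
proof -
  have "(\<integral>t. poly p (cis t) * cis (- (real n * t)) \<partial>Circ) = (\<integral>t. tp (Suc (degree p)) (lp p) t * cis (- (real_of_int (int n) * t)) \<partial>Circ)"
    by (simp add: poly_cis_eq_tp[of p "Suc (degree p)"])
  then show ?thesis unfolding integral_tp_cis by (auto simp: coeff_eq_0)
qed

definition fpoly :: "nat \<Rightarrow> (nat \<Rightarrow> complex) \<Rightarrow> complex poly" where
  "fpoly N f = (\<Sum>k<N. monom (f k) k)"

lemma coeff_fpoly: "coeff (fpoly N f) n = (if n < N then f n else 0)"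
  by (simp add: fpoly_def coeff_sum)

lemma poly_fpoly_cis: "poly (fpoly N f) (cis t) = (\<Sum>k<N. f k * cis (real k * t))"
  by (simp add: fpoly_def poly_sum poly_monom Complex.DeMoivre)

lemma norm_lp_fpoly: "(norm (lp (fpoly N f)))\<^sup>2 = (\<Sum>k<N. (norm (f k))\<^sup>2)"
  unfolding l2_norm_sq coef_lp coeff_fpoly by (subst suminf_finite[of "{..<N}"]) auto

lemma hankel_form_integral:
  "(\<integral>t. poly u (cis t) * cnj (poly (fpoly N f) (cis t) * poly (fpoly N h) (cis t)) \<partial>Circ) =
    2 * pi * (\<Sum>n<N. \<Sum>k<N. coeff u (n + k) * cnj (f k) * cnj (h n))"
proof -
  have e: "poly u (cis t) * cnj (poly (fpoly N f) (cis t) * poly (fpoly N h) (cis t)) =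
      (\<Sum>n<N. \<Sum>k<N. (cnj (f k) * cnj (h n)) * (poly u (cis t) * cis (- (real (n + k) * t))))" for t
  proof -
    have cf: "cnj (poly (fpoly N g) (cis t)) = (\<Sum>k<N. cnj (g k) * cis (- (real k * t)))" for g
      by (simp add: poly_fpoly_cis cis_cnj)
    have "cis (- (real (n + k) * t)) = cis (- (real n * t)) * cis (- (real k * t))" for n k
      by (simp add: cis_mult algebra_simps)
    moreover have "cnj (poly (fpoly N f) (cis t) * poly (fpoly N h) (cis t)) =
        (\<Sum>n<N. \<Sum>k<N. (cnj (h n) * cis (- (real n * t))) * (cnj (f k) * cis (- (real k * t))))"
      unfolding complex_cnj_mult cf by (subst mult.commute) (rule sum_product)
    ultimately show ?thesis
      by (simp only: sum_distrib_left) (simp only: mult_ac)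
  qed
  have int: "integrable Circ (\<lambda>t. poly u (cis t) * cis (- (real m * t)))" for m
    by (intro integrable_Circ_continuous continuous_intros)
  have "(\<integral>t. (\<Sum>n<N. \<Sum>k<N. (cnj (f k) * cnj (h n)) * (poly u (cis t) * cis (- (real (n + k) * t)))) \<partial>Circ) =
      (\<Sum>n<N. \<integral>t. (\<Sum>k<N. (cnj (f k) * cnj (h n)) * (poly u (cis t) * cis (- (real (n + k) * t)))) \<partial>Circ)"
    by (rule Bochner_Integration.integral_sum) (intro Bochner_Integration.integrable_sum Bochner_Integration.integrable_mult_right int)
  also have "\<dots> = (\<Sum>n<N. \<Sum>k<N. \<integral>t. (cnj (f k) * cnj (h n)) * (poly u (cis t) * cis (- (real (n + k) * t))) \<partial>Circ)"
    by (intro sum.cong refl Bochner_Integration.integral_sum) (intro Bochner_Integration.integrable_mult_right int)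
  also have "\<dots> = (\<Sum>n<N. \<Sum>k<N. (cnj (f k) * cnj (h n)) * (2 * pi * coeff u (n + k)))"
    unfolding integral_mult_right_zero integral_poly_cis ..
  also have "\<dots> = 2 * pi * (\<Sum>n<N. \<Sum>k<N. coeff u (n + k) * cnj (f k) * cnj (h n))"
    unfolding sum_distrib_left by (simp only: mult_ac)
  finally show ?thesis unfolding e .
qed

lemma hankel_bound_of_garsia:
  assumes X: "X > 0" and u0: "coeff u 0 = 0"
    and osc: "\<And>w. norm w < 1 \<Longrightarrow> (\<integral>t. poisson w t * (norm (poly u (cis t) - poly u w))\<^sup>2 \<partial>Circ) \<le> 2 * pi * X"
  shows "hankel_bound (coeff u) (2 * sqrt (exp 1 * X))"
  unfolding hankel_bound_def
proof (intro conjI allI)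
  show "0 \<le> 2 * sqrt (exp 1 * X)" using X by simp
  define k where "k = sqrt (exp 1 * X)"
  fix N :: nat and f h :: "nat \<Rightarrow> complex"
  define S where "S f h = (\<Sum>n<N. \<Sum>k<N. coeff u (n + k) * f k * h n)" for f h :: "nat \<Rightarrow> complex"
  define n2 where "n2 f = (\<Sum>n<N. (norm (f n))\<^sup>2)" for f :: "nat \<Rightarrow> complex"
  have p0: "poly u 0 = 0" using u0 by (simp add: poly_0_coeff_0)
  have 1: "norm (S f h) \<le> k * (n2 f + n2 h)" for f h
  proof -
    \<comment> \<open>The integral conjugates its two arguments, so the coefficients are conjugated
      beforehand.\<close>
    define F G where "F = fpoly N (\<lambda>i. cnj (f i))" and "G = fpoly N (\<lambda>i. cnj (h i))"
    have "norm (\<integral>t. poly u (cis t) * cnj (poly F (cis t) * poly G (cis t)) \<partial>Circ) \<le>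
        k * (\<integral>t. (norm (poly F (cis t)))\<^sup>2 + (norm (poly G (cis t)))\<^sup>2 \<partial>Circ)"
      unfolding k_def by (rule hankel_form_poly_bound[OF X p0]) (rule osc)
    also have "(\<integral>t. (norm (poly F (cis t)))\<^sup>2 + (norm (poly G (cis t)))\<^sup>2 \<partial>Circ) =
        (\<integral>t. (norm (poly F (cis t)))\<^sup>2 \<partial>Circ) + (\<integral>t. (norm (poly G (cis t)))\<^sup>2 \<partial>Circ)"
      by (rule Bochner_Integration.integral_add) (intro integrable_Circ_continuous continuous_intros)+
    finally have "norm (2 * pi * S f h) \<le> k * (2 * pi * n2 f + 2 * pi * n2 h)"
      unfolding F_def G_def hankel_form_integral integral_poly_norm_sq norm_lp_fpoly
      by (simp add: S_def n2_def)
    then have "2 * pi * norm (S f h) \<le> 2 * pi * (k * (n2 f + n2 h))"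
      by (simp add: norm_mult algebra_simps)
    then show ?thesis by (simp add: mult_le_cancel_left)
  qed
  have n2_pos: "n2 f \<ge> 0" for f by (simp add: n2_def sum_nonneg)
  have "norm (S f h) \<le> 2 * k * sqrt (n2 f) * sqrt (n2 h)"
  proof (cases "n2 f = 0 \<or> n2 h = 0")
    case True
    then have "(\<forall>n<N. f n = 0) \<or> (\<forall>n<N. h n = 0)"
      unfolding n2_def by (auto simp: sum_nonneg_eq_0_iff)
    then have "S f h = 0" unfolding S_def by auto
    then show ?thesis using n2_pos X by (simp add: k_def)
  next
    case False
    then have ab: "n2 f > 0" "n2 h > 0" using n2_pos[of f] n2_pos[of h] by auto
    \<comment> \<open>Rescaling \<open>f\<close> and \<open>h\<close> by reciprocal factors fixes
      the form and equalises the two squared norms; their sum becomes twice the product of the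
      norms.\<close>
    define \<tau> where "\<tau> = sqrt (sqrt (n2 h) / sqrt (n2 f))"
    have \<tau>: "\<tau> > 0" "\<tau>\<^sup>2 = sqrt (n2 h) / sqrt (n2 f)" using ab by (simp_all add: \<tau>_def)
    have "S (\<lambda>i. \<tau> * f i) (\<lambda>i. h i / \<tau>) = S f h" unfolding S_def using \<tau>(1) by (simp add: mult.assoc)
    moreover have "n2 (\<lambda>i. \<tau> * f i) = \<tau>\<^sup>2 * n2 f" "n2 (\<lambda>i. h i / \<tau>) = n2 h / \<tau>\<^sup>2"
      unfolding n2_def sum_distrib_left sum_divide_distrib
      by (simp_all add: norm_mult norm_divide power_mult_distrib power_divide)
    ultimately have "norm (S f h) \<le> k * (\<tau>\<^sup>2 * n2 f + n2 h / \<tau>\<^sup>2)"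
      using 1[of "\<lambda>i. \<tau> * f i" "\<lambda>i. h i / \<tau>"] by simp
    also have "\<tau>\<^sup>2 * n2 f + n2 h / \<tau>\<^sup>2 = 2 * sqrt (n2 f) * sqrt (n2 h)"
    proof -
      define a b where "a = sqrt (n2 f)" and "b = sqrt (n2 h)"
      have "a > 0" "b > 0" "n2 f = a * a" "n2 h = b * b" using ab by (simp_all add: a_def b_def)
      then show ?thesis unfolding \<tau>(2) a_def[symmetric] b_def[symmetric] by (simp add: field_simps)
    qed
    finally show ?thesis by (simp add: mult_ac)
  qed
  then show "norm (\<Sum>n<N. \<Sum>k<N. coeff u (n + k) * f k * h n)
       \<le> 2 * sqrt (exp 1 * X) * sqrt (\<Sum>n<N. (norm (f n))\<^sup>2) * sqrt (\<Sum>n<N. (norm (h n))\<^sup>2)"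
    by (simp add: S_def n2_def k_def)
qed

text \<open>With \<open>v = u - u(w) = (z - w) q\<close> one has \<open>v q\<^sup>* z\<^sup>* = |q|\<^sup>2 (1 - w z\<^sup>*)\<close> on the circle. Its coefficients with
  nonnegative index are given by the Hankel matrix of \<open>u\<close>, and in terms of the coefficients \<open>R\<close> of \<open>|q|\<^sup>2\<close> they
  form \<open>R - w S\<^sup>*R\<close>, while the others form \<open>S\<^sup>*R - w\<^sup>* R\<close> up to conjugation, which is not larger.\<close>

lemma quartic_bound:
  fixes u q :: "complex poly" and w :: complex
  assumes B: "hankel_bound (coeff u) B" and w: "norm w < 1" and u: "u = [:-w, 1:] * q + [:c:]"
  shows "(\<integral>t. (norm (poly ([:-w, 1:] * q) (cis t)))\<^sup>2 * (norm (poly q (cis t)))\<^sup>2 \<partial>Circ) \<le>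
    2 * B\<^sup>2 * (\<integral>t. (norm (poly q (cis t)))\<^sup>2 \<partial>Circ)"
proof -
  have uH: "coeff u \<in> H2" using coef_H2[of "lp u"] by simp
  interpret bounded_hankel "coeff u" B by standard (rule uH, rule B)
  define v where "v = [:-w, 1:] * q"
  define Q where "Q = lp q"
  define L where "L = Suc (degree q)"
  \<comment> \<open>The reversed conjugate of \<open>q\<close>, equal on the circle to z^(L-1) times
    the conjugate of \<open>q\<close>. So \<open>v * q'\<close> is a polynomial with the required
    modulus whose index \<open>L + n\<close> corresponds to frequency n.\<close>
  define q' where "q' = fpoly L (\<lambda>i. cnj (coeff q (L - 1 - i)))"
  define \<rho> where "\<rho> n = cip ((bshift ^^ n) Q) Q" for n
  have \<rho>0: "\<rho> n = 0" if "n \<ge> L" for n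
  proof -
    have "(bshift ^^ n) Q = 0" by (rule l2_eqI) (use that in \<open>auto simp: Q_def L_def coeff_eq_0\<close>)
    then show ?thesis by (simp add: \<rho>_def)
  qed
  define R where "R = l2_of \<rho>"
  have "{n. \<rho> n \<noteq> 0} \<subseteq> {..<L}" using \<rho>0 by (auto simp: not_less[symmetric])
  then have "\<rho> \<in> H2" by (intro H2_finite finite_subset[OF _ finite_lessThan])
  then have coef_R: "coef R = \<rho>" by (simp add: R_def)
  have lv: "lp v = shift Q - w *\<^sub>c Q"
  proof (rule l2_eqI)
    show "coef (lp v) n = coef (shift Q - w *\<^sub>c Q) n" for n
      by (cases n) (simp_all add: v_def Q_def)
  qed
  have bv: "bshift (lp v) = Q - w *\<^sub>c bshift Q"
    unfolding lv by (simp add: bshift_diff)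
  have bvn: "cip ((bshift ^^ Suc n) (lp v)) Q = coef (R - w *\<^sub>c bshift R) n" for n
  proof -
    have "(bshift ^^ n) (x - y) = (bshift ^^ n) x - (bshift ^^ n) y" for x y by (rule l2_eqI) simp
    then have "(bshift ^^ Suc n) (lp v) = (bshift ^^ n) Q - w *\<^sub>c (bshift ^^ Suc n) Q"
      by (simp add: funpow_swap1 bv)
    then show ?thesis by (simp add: cip.diff_left coef_R \<rho>_def del: funpow.simps)
  qed
  have svn: "cip ((shift ^^ n) (lp v)) Q = cnj (coef (bshift R - cnj w *\<^sub>c R) n)" for n
  proof -
    have "(shift ^^ n) (shift x - y) = (shift ^^ Suc n) x - (shift ^^ n) y" for x y
    proof -
      have "(shift ^^ n) (a - b) = (shift ^^ n) a - (shift ^^ n) b" for a b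
        by (rule l2_eqI) (simp add: coef_shift_pow)
      then show ?thesis by (simp add: funpow_swap1)
    qed
    then have "(shift ^^ n) (lp v) = (shift ^^ Suc n) Q - w *\<^sub>c (shift ^^ n) Q"
      unfolding lv by simp
    moreover have "cip ((shift ^^ j) Q) Q = cnj (\<rho> j)" for j
      unfolding \<rho>_def by (metis cip_shift_pow_left cnj_cip)
    ultimately show ?thesis by (simp add: cip.diff_left coef_R del: funpow.simps)
  qed
  have hi: "coeff (v * q') (L + n) = coef (R - w *\<^sub>c bshift R) n" for n
  proof -
    have "coeff (v * q') (L + n) = (\<Sum>i<L. cnj (coeff q (L - 1 - i)) * coeff v (L + n - i))"
    proof -
      have "coeff (v * q') (L + n) = (\<Sum>i\<le>L + n. coeff q' i * coeff v (L + n - i))"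
        by (subst mult.commute) (rule coeff_mult)
      also have "\<dots> = (\<Sum>i<L. cnj (coeff q (L - 1 - i)) * coeff v (L + n - i))"
        by (intro sum.mono_neutral_cong_right) (auto simp: q'_def coeff_fpoly)
      finally show ?thesis .
    qed
    also have "\<dots> = (\<Sum>k<L. coeff v (Suc n + k) * cnj (coeff q k))"
      by (rule sum.reindex_bij_witness[of _ "\<lambda>k. L - 1 - k" "\<lambda>i. L - 1 - i"]) (auto simp: mult.commute Suc_diff_Suc add.commute)
    also have "\<dots> = cip ((bshift ^^ Suc n) (lp v)) Q"
      unfolding cip_def by (subst suminf_finite[of "{..<L}"]) (auto simp: Q_def L_def coeff_eq_0 simp del: funpow.simps)
    finally show ?thesis unfolding bvn .
  qed
  have lo: "coeff (v * q') (L - Suc n) = cnj (coef (bshift R - cnj w *\<^sub>c R) n)" if "n < L" for n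
  proof -
    have "coeff (v * q') (L - Suc n) = (\<Sum>i\<le>L - Suc n. cnj (coeff q (L - 1 - i)) * coeff v (L - Suc n - i))"
    proof -
      have "coeff (v * q') (L - Suc n) = (\<Sum>i\<le>L - Suc n. coeff q' i * coeff v (L - Suc n - i))"
        by (subst mult.commute) (rule coeff_mult)
      also have "\<dots> = (\<Sum>i\<le>L - Suc n. cnj (coeff q (L - 1 - i)) * coeff v (L - Suc n - i))"
        using that by (intro sum.cong) (auto simp: q'_def coeff_fpoly)
      finally show ?thesis .
    qed
    also have "\<dots> = (\<Sum>k\<in>{n..<L}. coeff v (k - n) * cnj (coeff q k))"
      using that
      by (intro sum.reindex_bij_witness[of _ "\<lambda>k. L - 1 - k" "\<lambda>i. L - 1 - i"]) (auto simp: mult.commute add.commute)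
    also have "\<dots> = cip ((shift ^^ n) (lp v)) Q"
      unfolding cip_def
      by (subst suminf_finite[of "{n..<L}"]) (auto simp: Q_def L_def coeff_eq_0 coef_shift_pow intro!: sum.cong)
    finally show ?thesis unfolding svn .
  qed
  have "(norm (lp (v * q')))\<^sup>2 \<le> (norm (bshift R - cnj w *\<^sub>c R))\<^sup>2 + (norm (R - w *\<^sub>c bshift R))\<^sup>2"
  proof -
    have s: "(\<lambda>n. (norm (coeff (v * q') n))\<^sup>2) sums (norm (lp (v * q')))\<^sup>2"
      using summable_sums[OF summable_coef_sq[of "lp (v * q')"]] unfolding l2_norm_sq by simp
    have "(norm (lp (v * q')))\<^sup>2 = (\<Sum>n. (norm (coeff (v * q') (n + L)))\<^sup>2) + (\<Sum>n<L. (norm (coeff (v * q') n))\<^sup>2)"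
      using suminf_split_initial_segment[OF sums_summable[OF s], of L] sums_unique[OF s] by simp
    also have "(\<Sum>n. (norm (coeff (v * q') (n + L)))\<^sup>2) = (norm (R - w *\<^sub>c bshift R))\<^sup>2"
      unfolding l2_norm_sq add.commute[of _ L] hi ..
    also have "(\<Sum>n<L. (norm (coeff (v * q') n))\<^sup>2) = (\<Sum>n<L. (norm (coeff (v * q') (L - Suc n)))\<^sup>2)"
      by (rule sum.nat_diff_reindex[symmetric])
    also have "\<dots> = (\<Sum>n<L. (norm (coef (bshift R - cnj w *\<^sub>c R) n))\<^sup>2)"
      by (intro sum.cong refl) (simp add: lo del: coef_diff)
    also have "\<dots> \<le> (norm (bshift R - cnj w *\<^sub>c R))\<^sup>2"
      by (rule sum_coef_sq_le) simp
    finally show ?thesis by simp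
  qed
  also have "(norm (bshift R - cnj w *\<^sub>c R))\<^sup>2 \<le> (norm (R - w *\<^sub>c bshift R))\<^sup>2"
  proof -
    have "Re (cip (bshift R) (cnj w *\<^sub>c R)) = Re (cip R (w *\<^sub>c bshift R))"
    proof -
      have "cip (bshift R) (cnj w *\<^sub>c R) = cnj (cip R (w *\<^sub>c bshift R))"
        by (simp only: cip_cmul_left cip_cmul_right complex_cnj_mult complex_cnj_cnj cnj_cip)
      then show ?thesis by (simp only: cnj.simps)
    qed
    \<comment> \<open>This product is the difference of the two squared norms, the cross terms
      having equal real parts.\<close>
    moreover have "0 \<le> (1 - (norm w)\<^sup>2) * ((norm R)\<^sup>2 - (norm (bshift R))\<^sup>2)"
      using w norm_bshift_le[of R] by (intro mult_nonneg_nonneg) (auto simp: power_le_one power_mono)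
    ultimately show ?thesis
      unfolding norm_diff_sq norm_cmul complex_mod_cnj power_mult_distrib by (simp add: algebra_simps)
  qed
  also have "(norm (R - w *\<^sub>c bshift R))\<^sup>2 \<le> (B * norm Q)\<^sup>2"
    unfolding l2_norm_sq
  proof (rule H2_bounded_sums(2))
    fix N
    have "coef (R - w *\<^sub>c bshift R) n = Gop (coeff u) (coef (conj2 Q)) (Suc n)" for n
    proof -
      \<comment> \<open>\<open>u\<close> and \<open>v\<close> differ by a constant, which affects
        only index 0; the positive-index rows therefore come from the Hankel matrix of
        \<open>u\<close>.\<close>
      have "(bshift ^^ Suc n) (lp v) = (bshift ^^ Suc n) (lp u)"
        by (rule l2_eqI) (simp add: u v_def del: funpow.simps)
      then have "coef (R - w *\<^sub>c bshift R) n = cip ((bshift ^^ Suc n) (lp u)) Q"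
        using bvn[of n] by (simp del: funpow.simps coef_diff)
      then show ?thesis
        unfolding Gop_def cip_def by (simp del: funpow.simps coef_diff)
    qed
    then have "(\<Sum>n<N. (norm (coef (R - w *\<^sub>c bshift R) n))\<^sup>2) = (\<Sum>n<N. (norm (Gop (coeff u) (coef (conj2 Q)) (Suc n)))\<^sup>2)"
      by (simp del: coef_diff)
    also have "\<dots> \<le> (\<Sum>n<Suc N. (norm (Gop (coeff u) (coef (conj2 Q)) n))\<^sup>2)"
      unfolding sum.lessThan_Suc_shift by simp
    also have "\<dots> \<le> (B * norm (conj2 Q))\<^sup>2" by (rule Gop_bounded_sums)
    finally show "(\<Sum>n<N. (norm (coef (R - w *\<^sub>c bshift R) n))\<^sup>2) \<le> (B * norm Q)\<^sup>2" by simp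
  qed
  finally have main: "(norm (lp (v * q')))\<^sup>2 \<le> 2 * B\<^sup>2 * (norm Q)\<^sup>2" by (simp add: power_mult_distrib)
  have "norm (poly q' (cis t)) = norm (poly q (cis t))" for t
  proof -
    have "poly q' (cis t) = cis (real (L - 1) * t) * cnj (poly q (cis t))"
    proof -
      have "cis (real (L - 1) * t) * cnj (poly q (cis t)) = (\<Sum>k<L. cis (real (L - 1) * t) * (cnj (coeff q k) * cnj (cis (real k * t))))"
        unfolding poly_altdef Complex.DeMoivre cnj_sum sum_distrib_left complex_cnj_mult
        by (simp add: L_def lessThan_Suc_atMost)
      also have "\<dots> = (\<Sum>i<L. cnj (coeff q (L - 1 - i)) * cis (real i * t))"
      proof (rule sum.reindex_bij_witness[of _ "\<lambda>k. L - 1 - k" "\<lambda>i. L - 1 - i"])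
        fix k assume "k \<in> {..<L}"
        then have "real (L - 1 - k) = real (L - 1) - real k" and "L - 1 - (L - 1 - k) = k" by auto
        then show "cnj (coeff q (L - 1 - (L - 1 - k))) * cis (real (L - 1 - k) * t) =
            cis (real (L - 1) * t) * (cnj (coeff q k) * cnj (cis (real k * t)))"
          by (simp add: cis_cnj cis_mult left_diff_distrib right_diff_distrib mult_ac)
      qed auto
      finally show ?thesis unfolding q'_def poly_fpoly_cis by simp
    qed
    then show ?thesis by (simp add: norm_mult)
  qed
  then have eq: "(norm (poly ([:-w, 1:] * q) (cis t)))\<^sup>2 * (norm (poly q (cis t)))\<^sup>2 = (norm (poly (v * q') (cis t)))\<^sup>2" for t
    by (simp add: v_def norm_mult power_mult_distrib)
  then show ?thesis
    unfolding eq integral_poly_norm_sq using main by (simp add: Q_def)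
qed

lemma garsia_bound_of_hankel_bound:
  assumes B: "hankel_bound (coeff u) B" "B > 0" and w: "norm w < 1"
    and M: "(\<integral>t. poisson w t * norm (poly u (cis t) - poly u w) \<partial>Circ) \<le> 2 * pi * M"
  shows "(\<integral>t. poisson w t * (norm (poly u (cis t) - poly u w))\<^sup>2 \<partial>Circ) \<le> 2 * pi * (4 * B * M)"
proof -
  define q where "q = synthetic_div u w"
  define v where "v = [:-w, 1:] * q"
  have u: "u = v + [:poly u w:]"
    using synthetic_div_correct'[of w u] by (simp add: v_def q_def)
  have uv: "poly u z - poly u w = poly v z" for z
    by (subst u) simp
  \<comment> \<open>On the circle |z - w| equals the modulus in the Poisson denominator, so the
    kernel cancels against the factor z - w of \<open>v\<close>.\<close>
  have pv: "poisson w t * (norm (poly v (cis t)))\<^sup>2 = (1 - (norm w)\<^sup>2) * (norm (poly q (cis t)))\<^sup>2" for t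
  proof -
    have "cis t - w = cis t * (1 - w * cis (- t))" by (simp add: algebra_simps cis_mult)
    also have "norm \<dots> = norm (cnj (1 - w * cis (- t)))" unfolding norm_mult complex_mod_cnj by simp
    also have "cnj (1 - w * cis (- t)) = 1 - cnj w * cis t" by (simp add: cis_cnj)
    finally have "norm (cis t - w) = norm (1 - cnj w * cis t)" .
    then have "norm (poly v (cis t)) = norm (1 - cnj w * cis t) * norm (poly q (cis t))"
      unfolding v_def poly_mult norm_mult by simp
    then show ?thesis
      using poisson_denom[OF w, of t] by (simp add: poisson_def power_mult_distrib)
  qed
  note ints = integrable_Circ_continuous continuous_intros continuous_poisson[OF w]
  define x where "x = (\<integral>t. poisson w t * (norm (poly v (cis t)))\<^sup>2 \<partial>Circ)"
  have x4: "(\<integral>t. poisson w t * (norm (poly v (cis t)))^4 \<partial>Circ) \<le> 2 * B\<^sup>2 * x"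
  proof -
    have "poisson w t * (norm (poly v (cis t)))^4 = (1 - (norm w)\<^sup>2) * ((norm (poly v (cis t)))\<^sup>2 * (norm (poly q (cis t)))\<^sup>2)" for t
    proof -
      have "poisson w t * (norm (poly v (cis t)))^4 = (poisson w t * (norm (poly v (cis t)))\<^sup>2) * (norm (poly v (cis t)))\<^sup>2"
        by (simp add: power2_eq_square power4_eq_xxxx)
      then show ?thesis unfolding pv by simp
    qed
    then have "(\<integral>t. poisson w t * (norm (poly v (cis t)))^4 \<partial>Circ) =
        (1 - (norm w)\<^sup>2) * (\<integral>t. (norm (poly v (cis t)))\<^sup>2 * (norm (poly q (cis t)))\<^sup>2 \<partial>Circ)"
      by (simp only: integral_mult_right_zero)
    also have "\<dots> \<le> (1 - (norm w)\<^sup>2) * (2 * B\<^sup>2 * (\<integral>t. (norm (poly q (cis t)))\<^sup>2 \<partial>Circ))"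
      unfolding v_def using w
      by (intro mult_left_mono quartic_bound[OF B(1) w u[unfolded v_def]]) (simp add: power_le_one)
    also have "\<dots> = 2 * B\<^sup>2 * x"
      unfolding x_def pv integral_mult_right_zero by simp
    finally show ?thesis .
  qed
  \<comment> \<open>Chosen so that the fourth-power term, at most
    \<open>2 * B\<^sup>2 * x / r\<^sup>2\<close>, is x/2 and can be absorbed on the left.\<close>
  define r where "r = 2 * B"
  have r: "r > 0" using B by (simp add: r_def)
  have pt: "y\<^sup>2 \<le> r * y + y^4 / r\<^sup>2" if "y \<ge> 0" for y :: real
  proof (cases "y \<le> r")
    case True
    then have "y\<^sup>2 \<le> r * y" using that by (simp add: power2_eq_square mult_right_mono)
    moreover have "0 \<le> y^4 / r\<^sup>2" by simp
    ultimately show ?thesis by linarith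
  next
    case False
    then have "r\<^sup>2 * y\<^sup>2 \<le> y\<^sup>2 * y\<^sup>2" using r by (intro mult_right_mono power_mono) auto
    then have "y\<^sup>2 \<le> y^4 / r\<^sup>2" using r by (simp add: pos_le_divide_eq power2_eq_square power4_eq_xxxx mult_ac)
    moreover have "0 \<le> r * y" using r that by simp
    ultimately show ?thesis by linarith
  qed
  have i1: "integrable Circ (\<lambda>t. r * (poisson w t * norm (poly v (cis t))))"
    and i2: "integrable Circ (\<lambda>t. (poisson w t * (norm (poly v (cis t)))^4) / r\<^sup>2)"
    using r by (intro ints | simp)+
  have "x \<le> (\<integral>t. r * (poisson w t * norm (poly v (cis t))) + (poisson w t * (norm (poly v (cis t)))^4) / r\<^sup>2 \<partial>Circ)"
    unfolding x_def
  proof (rule integral_mono[OF _ Bochner_Integration.integrable_add[OF i1 i2]])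
    show "poisson w t * (norm (poly v (cis t)))\<^sup>2 \<le> r * (poisson w t * norm (poly v (cis t))) + (poisson w t * (norm (poly v (cis t)))^4) / r\<^sup>2" for t
      using mult_left_mono[OF pt[OF norm_ge_zero[of "poly v (cis t)"]] poisson_nonneg[OF w, of t]]
      by (simp add: algebra_simps)
  qed (intro ints)
  also have "\<dots> = r * (\<integral>t. poisson w t * norm (poly v (cis t)) \<partial>Circ) + (\<integral>t. poisson w t * (norm (poly v (cis t)))^4 \<partial>Circ) / r\<^sup>2"
    using Bochner_Integration.integral_add[OF i1 i2] by (simp only: integral_mult_right_zero integral_divide_zero)
  also have "\<dots> \<le> r * (2 * pi * M) + (2 * B\<^sup>2 * x) / r\<^sup>2"
    using M r x4 unfolding uv by (intro add_mono mult_left_mono divide_right_mono) auto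
  also have "(2 * B\<^sup>2 * x) / r\<^sup>2 = x / 2"
    using B by (simp add: r_def power2_eq_square)
  finally have "x \<le> 2 * pi * (4 * B * M)" unfolding r_def by (simp add: algebra_simps)
  then show ?thesis unfolding x_def uv .
qed

text \<open>A crude entrywise bound for a finite matrix; only finiteness matters, as the starting
  point of the self-improvement.\<close>

lemma ex_hankel_bound_poly: "\<exists>B>0. hankel_bound (coeff u) B"
proof -
  define d where "d = degree u"
  define B where "B = 1 + (\<Sum>n\<le>d. \<Sum>k\<le>d. norm (coeff u (n + k)))"
  have B: "B > 0" unfolding B_def by (intro add_pos_nonneg sum_nonneg) auto
  have "norm (\<Sum>n<N. \<Sum>k<N. coeff u (n + k) * f k * h n) \<le> B * sqrt (\<Sum>n<N. (norm (f n))\<^sup>2) * sqrt (\<Sum>n<N. (norm (h n))\<^sup>2)"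
    for N and f h :: "nat \<Rightarrow> complex"
  proof -
    define a b where "a = sqrt (\<Sum>n<N. (norm (f n))\<^sup>2)" and "b = sqrt (\<Sum>n<N. (norm (h n))\<^sup>2)"
    have le: "norm (g n) \<le> sqrt (\<Sum>n<N. (norm (g n))\<^sup>2)" if "n < N" for g :: "nat \<Rightarrow> complex" and n
      using that by (intro real_le_rsqrt member_le_sum) auto
    have ab: "a \<ge> 0" "b \<ge> 0" by (simp_all add: a_def b_def sum_nonneg)
    have "norm (\<Sum>n<N. \<Sum>k<N. coeff u (n + k) * f k * h n) \<le> (\<Sum>n<N. \<Sum>k<N. norm (coeff u (n + k)) * (a * b))"
    proof (intro sum_norm_le)
      fix n k assume "n \<in> {..<N}" "k \<in> {..<N}"
      then have "norm (f k) * norm (h n) \<le> a * b"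
        unfolding a_def b_def by (intro mult_mono le) (auto simp: sum_nonneg)
      then show "norm (coeff u (n + k) * f k * h n) \<le> norm (coeff u (n + k)) * (a * b)"
        unfolding norm_mult mult.assoc by (rule mult_left_mono) simp
    qed
    also have "\<dots> = (\<Sum>n<N. \<Sum>k<N. norm (coeff u (n + k))) * (a * b)" by (simp add: sum_distrib_right)
    also have "(\<Sum>n<N. \<Sum>k<N. norm (coeff u (n + k))) \<le> (\<Sum>n\<le>d. \<Sum>k\<le>d. norm (coeff u (n + k)))"
    proof -
      have "(\<Sum>n<N. \<Sum>k<N. norm (coeff u (n + k))) = (\<Sum>(n, k)\<in>{..<N} \<times> {..<N}. norm (coeff u (n + k)))"
        by (rule sum.cartesian_product)
      also have "\<dots> = (\<Sum>(n, k)\<in>({..<N} \<inter> {..d}) \<times> ({..<N} \<inter> {..d}). norm (coeff u (n + k)))"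
      proof (rule sum.mono_neutral_right)
        have deg: "a \<le> d \<and> b \<le> d" if "coeff u (a + b) \<noteq> 0" for a b
          using le_degree[OF that] by (simp add: d_def)
        show "\<forall>x\<in>{..<N} \<times> {..<N} - ({..<N} \<inter> {..d}) \<times> ({..<N} \<inter> {..d}). (case x of (n, k) \<Rightarrow> norm (coeff u (n + k))) = 0"
          by (auto dest: deg)
      qed auto
      also have "\<dots> \<le> (\<Sum>(n, k)\<in>{..d} \<times> {..d}. norm (coeff u (n + k)))"
        by (rule sum_mono2) auto
      finally show ?thesis unfolding sum.cartesian_product .
    qed
    then have "(\<Sum>n<N. \<Sum>k<N. norm (coeff u (n + k))) * (a * b) \<le> B * (a * b)"
      using ab by (intro mult_right_mono) (auto simp: B_def)
    finally show ?thesis by (simp add: a_def b_def mult.assoc)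
  qed
  then show ?thesis using B unfolding hankel_bound_def by (intro exI[of _ B]) auto
qed

text \<open>Any bound \<open>B\<close> for the Hankel form can be improved to \<open>4 (e B M)^(1/2)\<close>, so the best one is at
  most \<open>16 e M\<close>.\<close>

lemma hankel_bound_of_L1_garsia:
  assumes M: "M > 0" and u0: "coeff u 0 = 0"
    and osc: "\<And>w. norm w < 1 \<Longrightarrow> (\<integral>t. poisson w t * norm (poly u (cis t) - poly u w) \<partial>Circ) \<le> 2 * pi * M"
  shows "hankel_bound (coeff u) (48 * M + 1)"
proof -
  define Bs where "Bs = {B. B > 0 \<and> hankel_bound (coeff u) B}"
  have ne: "Bs \<noteq> {}" using ex_hankel_bound_poly[of u] by (auto simp: Bs_def)
  have bdd: "bdd_below Bs" by (rule bdd_belowI[of _ 0]) (auto simp: Bs_def)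
  define \<beta> where "\<beta> = Inf Bs"
  have \<beta>0: "\<beta> \<ge> 0" unfolding \<beta>_def by (rule cInf_greatest[OF ne]) (auto simp: Bs_def)
  have improve: "\<beta>\<^sup>2 / (16 * exp 1 * M) \<le> B" if "B \<in> Bs" for B
  proof -
    have B: "hankel_bound (coeff u) B" "B > 0" using that by (auto simp: Bs_def)
    have "4 * B * M > 0" using B M by simp
    from hankel_bound_of_garsia[OF this u0 garsia_bound_of_hankel_bound[OF B _ osc]]
    have "2 * sqrt (exp 1 * (4 * B * M)) \<in> Bs"
      using B M by (simp add: Bs_def)
    then have "\<beta> \<le> 2 * sqrt (exp 1 * (4 * B * M))" unfolding \<beta>_def using bdd by (rule cInf_lower)
    then have "\<beta>\<^sup>2 \<le> (2 * sqrt (exp 1 * (4 * B * M)))\<^sup>2" using \<beta>0 by (rule power_mono)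
    also have "\<dots> = 16 * exp 1 * M * B" using B M by (simp add: power_mult_distrib)
    finally show ?thesis using M by (simp add: pos_divide_le_eq mult_ac)
  qed
  have "\<beta>\<^sup>2 / (16 * exp 1 * M) \<le> \<beta>"
    using improve unfolding \<beta>_def by (intro cInf_greatest[OF ne])
  then have "\<beta> * \<beta> \<le> (16 * exp 1 * M) * \<beta>"
    using M by (simp add: pos_divide_le_eq power2_eq_square mult_ac)
  then have "\<beta> \<le> 16 * exp 1 * M"
    using \<beta>0 M by (cases "\<beta> = 0") (auto simp: mult_le_cancel_right)
  \<comment> \<open>e <= 3 gives 48; the extra 1 makes the inequality strict, so that an actual
    bound below it can be chosen.\<close>
  also have "\<dots> \<le> 16 * 3 * M" using M exp_le by (intro mult_right_mono mult_left_mono) auto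
  finally have "\<beta> < 48 * M + 1" by simp
  then obtain B where B: "B \<in> Bs" "B < 48 * M + 1"
    unfolding \<beta>_def using cInf_less_iff[OF ne bdd] by blast
  show ?thesis
    unfolding hankel_bound_def
  proof (intro conjI allI)
    fix N :: nat and f h :: "nat \<Rightarrow> complex"
    have "norm (\<Sum>n<N. \<Sum>k<N. coeff u (n + k) * f k * h n) \<le> B * sqrt (\<Sum>n<N. (norm (f n))\<^sup>2) * sqrt (\<Sum>n<N. (norm (h n))\<^sup>2)"
      using B(1) by (auto simp: Bs_def hankel_bound_def)
    also have "\<dots> \<le> (48 * M + 1) * sqrt (\<Sum>n<N. (norm (f n))\<^sup>2) * sqrt (\<Sum>n<N. (norm (h n))\<^sup>2)"
      using B(2) by (intro mult_right_mono) (auto simp: sum_nonneg)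
    finally show "norm (\<Sum>n<N. \<Sum>k<N. coeff u (n + k) * f k * h n) \<le>
      (48 * M + 1) * sqrt (\<Sum>n<N. (norm (f n))\<^sup>2) * sqrt (\<Sum>n<N. (norm (h n))\<^sup>2)" .
  qed (use M in simp)
qed

section \<open>Translates of periodic functions\<close>

lemma set_integral_translate:
  fixes f :: "real \<Rightarrow> 'a :: {banach, second_countable_topology}"
  shows "set_integrable lborel {a..b} (\<lambda>x. f (x + s)) \<longleftrightarrow> set_integrable lborel {a + s..b + s} f"
    and "(LINT x:{a..b}|lborel. f (x + s)) = (LINT x:{a + s..b + s}|lborel. f x)"
proof -
  have e: "indicat_real {a..b} x *\<^sub>R f (x + s) = indicat_real {a + s..b + s} (s + 1 * x) *\<^sub>R f (s + 1 * x)" for x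
    by (auto simp: indicator_def add.commute)
  show "set_integrable lborel {a..b} (\<lambda>x. f (x + s)) \<longleftrightarrow> set_integrable lborel {a + s..b + s} f"
    unfolding set_integrable_def e by (rule lborel_integrable_real_affine_iff) simp
  show "(LINT x:{a..b}|lborel. f (x + s)) = (LINT x:{a + s..b + s}|lborel. f x)"
    unfolding set_lebesgue_integral_def e
    by (subst lborel_integral_real_affine[where c = 1 and t = s]) auto
qed

lemma periodic_integral_shift:
  fixes f :: "real \<Rightarrow> 'a :: {banach, second_countable_topology}"
  assumes per: "\<And>t. f (t + 2 * pi) = f t" and int: "set_integrable lborel {0..2*pi} f"
  shows "set_integrable lborel {a..a + 2*pi} f" "(LINT x:{a..a + 2*pi}|lborel. f x) = (LINT x:{0..2*pi}|lborel. f x)"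
proof -
  have pern: "f (t + 2 * pi * real n) = f t" for t n
  proof (induction n)
    case (Suc n)
    have "f (t + 2 * pi * real (Suc n)) = f ((t + 2 * pi * real n) + 2 * pi)" by (simp add: algebra_simps)
    then show ?case using Suc per by simp
  qed simp
  have perk: "f (t + 2 * pi * of_int k) = f t" for t k
  proof (cases "k \<ge> 0")
    case True
    then show ?thesis using pern[of t "nat k"] by simp
  next
    case False
    then show ?thesis using pern[of "t + 2 * pi * of_int k" "nat (- k)"] by simp
  qed
  define k where "k = \<lfloor>a / (2 * pi)\<rfloor>"
  \<comment> \<open>Reduces to a window starting in [0, 2 pi], which is cut at 2 pi and its right
    piece moved back by one period.\<close>
  define a0 where "a0 = a - 2 * pi * of_int k"
  have a0: "0 \<le> a0" "a0 \<le> 2 * pi"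
  proof -
    have "of_int k \<le> a / (2 * pi)" "a / (2 * pi) < of_int k + 1" unfolding k_def by linarith+
    then have "of_int k * (2 * pi) \<le> a" "a < (of_int k + 1) * (2 * pi)"
      by (simp_all add: pos_le_divide_eq pos_divide_less_eq)
    then show "0 \<le> a0" "a0 \<le> 2 * pi" by (simp_all add: a0_def algebra_simps)
  qed
  have i1: "set_integrable lborel {a0..2*pi} f" and i0: "set_integrable lborel {0..a0} f"
    using a0 by (intro set_integrable_subset[OF int]; auto)+
  have i2: "set_integrable lborel {2*pi..a0 + 2*pi} f"
    using i0 set_integral_translate(1)[of 0 a0 f "2*pi"] by (simp add: per)
  have AE: "AE x in lborel. \<not> (x \<in> {a0..2*pi} \<and> x \<in> {2*pi..a0 + 2*pi})"
    using AE_lborel_singleton[of "2*pi"] by eventually_elim auto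
  have AE': "AE x in lborel. \<not> (x \<in> {0..a0} \<and> x \<in> {a0..2*pi})"
    using AE_lborel_singleton[of a0] by eventually_elim auto
  have un: "{a0..a0 + 2*pi} = {a0..2*pi} \<union> {2*pi..a0 + 2*pi}" "{0..2*pi} = {0..a0} \<union> {a0..2*pi}"
    using a0 by auto
  have int0: "set_integrable lborel {a0..a0 + 2*pi} f"
    unfolding un by (intro set_integrable_Un i1 i2) auto
  have "(LINT x:{a0..a0 + 2*pi}|lborel. f x) = (LINT x:{a0..2*pi}|lborel. f x) + (LINT x:{2*pi..a0 + 2*pi}|lborel. f x)"
    unfolding un by (rule set_integral_Un_AE[OF AE _ _ i1 i2]) auto
  also have "(LINT x:{2*pi..a0 + 2*pi}|lborel. f x) = (LINT x:{0..a0}|lborel. f x)"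
    using set_integral_translate(2)[of 0 a0 f "2*pi"] by (simp add: per)
  also have "(LINT x:{a0..2*pi}|lborel. f x) + (LINT x:{0..a0}|lborel. f x) = (LINT x:{0..2*pi}|lborel. f x)"
    unfolding un(2) by (subst set_integral_Un_AE[OF AE' _ _ i0 i1]) auto
  finally have eq0: "(LINT x:{a0..a0 + 2*pi}|lborel. f x) = (LINT x:{0..2*pi}|lborel. f x)" .
  have sh: "a0 + 2 * pi * of_int k = a" "a0 + 2 * pi + 2 * pi * of_int k = a + 2 * pi" by (simp_all add: a0_def)
  show "set_integrable lborel {a..a + 2*pi} f"
    using int0 set_integral_translate(1)[of a0 "a0 + 2*pi" f "2 * pi * of_int k"] unfolding sh by (simp add: perk)
  show "(LINT x:{a..a + 2*pi}|lborel. f x) = (LINT x:{0..2*pi}|lborel. f x)"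
    using eq0 set_integral_translate(2)[of a0 "a0 + 2*pi" f "2 * pi * of_int k"] unfolding sh by (simp add: perk)
qed

section \<open>Poisson averages of functions of bounded mean oscillation\<close>

lemma norm_1_minus_cis_ge:
  assumes "\<bar>x\<bar> \<le> pi"
  shows "\<bar>x\<bar> / 3 \<le> norm (1 - cis x)"
proof -
  define y where "y = \<bar>x\<bar> / 2"
  have y: "0 \<le> y" "y \<le> 2" using assms pi_less_4 by (auto simp: y_def)
  have "\<bar>sin y - (\<Sum>m<3. sin_coeff m * y ^ m)\<bar> \<le> inverse (fact 3) * \<bar>y\<bar> ^ 3"
    by (rule Maclaurin_sin_bound)
  then have "\<bar>sin y - y\<bar> \<le> y ^ 3 / 6"
    using y by (simp add: sin_coeff_def numeral_3_eq_3 fact_numeral)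
  then have "y - y ^ 3 / 6 \<le> sin y" by linarith
  \<comment> \<open>With y <= 2 the cubic Taylor term costs at most 2y/3, which leaves y/3.\<close>
  moreover have "y ^ 3 \<le> 4 * y"
    using y mult_mono[of y 2 y 2] by (simp add: power3_eq_cube mult_right_mono)
  ultimately have s: "y / 3 \<le> sin y" by simp
  have "(norm (1 - cis x))\<^sup>2 = (1 - cos x)\<^sup>2 + (sin x)\<^sup>2" by (simp add: cmod_power2)
  also have "\<dots> = 2 - 2 * cos x" using sin_cos_squared_add[of x] by (simp add: power2_diff)
  also have "cos x = cos (2 * y)" by (simp add: y_def)
  also have "2 - 2 * cos (2 * y) = (2 * sin y)\<^sup>2" unfolding cos_double_sin by (simp add: power_mult_distrib)
  finally have "norm (1 - cis x) = 2 * sin y"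
    by (rule power2_eq_imp_eq) (use s y in auto)
  then show ?thesis using s by (simp add: y_def)
qed

text \<open>The factor 1 + 3 (n - k) is the loss from comparing averages over n - k dyadic steps;
  the geometric weight keeps the total of order 2^n.\<close>

lemma sum_dyadic: "(\<Sum>k<n. 2 ^ k * (1 + 3 * real (n - k))) \<le> 7 * 2 ^ n"
proof -
  have "(\<Sum>k<n. 2 ^ k * (1 + 3 * real (n - k))) = 7 * 2 ^ n - 7 - 3 * real n"
  proof (induction n)
    case (Suc n)
    have "(\<Sum>k<n. 2 ^ k * (1 + 3 * real (Suc n - k))) = (\<Sum>k<n. 2 ^ k * (1 + 3 * real (n - k))) + 3 * (\<Sum>k<n. 2 ^ k)"
      unfolding sum_distrib_left sum.distrib[symmetric]
      by (intro sum.cong refl) (simp add: Suc_diff_le algebra_simps)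
    moreover have "(\<Sum>k<n. 2 ^ k) = (2::real) ^ n - 1" by (simp add: sum_gp_strict)
    ultimately show ?case using Suc by (simp add: algebra_simps)
  qed simp
  then show ?thesis by simp
qed

text \<open>Dyadic arcs centred at the argument of w shrink from a full period to a length
  comparable to 1 - |w|. The kernel is dominated by a weighted sum of their indicators, and the
  averages drift only linearly from arc to arc.\<close>

lemma poisson_mean_oscillation:
  fixes \<phi> :: "real \<Rightarrow> complex"
  assumes cont: "continuous_on UNIV \<phi>" and per: "\<And>t. \<phi> (t + 2 * pi) = \<phi> t" and M: "M \<ge> 0"
    and osc: "\<And>a h. 0 < h \<Longrightarrow> h \<le> 2 * pi \<Longrightarrow> \<exists>c. (LINT t:{a..a + h}|lborel. norm (\<phi> t - c)) \<le> M * h"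
    and w: "norm w < 1"
  shows "\<exists>c. (\<integral>t. poisson w t * norm (\<phi> t - c) \<partial>Circ) \<le> 2 * pi * (228 * M)"
proof -
  obtain \<alpha> where \<alpha>: "w = norm w * cis \<alpha>"
    using rcis_cmod_Arg[of w] by (metis rcis_def)
  define h where "h k = 2 * pi / 2 ^ k" for k :: nat
  define I where "I k = {\<alpha> - h k / 2..\<alpha> - h k / 2 + h k}" for k
  have h: "0 < h k" "h k \<le> 2 * pi" for k by (simp_all add: h_def divide_le_eq)
  have h_Suc: "h k = 2 * h (Suc k)" for k by (simp add: h_def)
  have "\<forall>k. \<exists>c. (LINT t:I k|lborel. norm (\<phi> t - c)) \<le> M * h k"
    unfolding I_def using osc h by blast
  then obtain c where c: "\<And>k. (LINT t:I k|lborel. norm (\<phi> t - c k)) \<le> M * h k" by metis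
  have int: "set_integrable lborel (I k) (\<lambda>t. norm (\<phi> t - d))" for k d
    unfolding I_def by (rule borel_integrable_atLeastAtMost') (intro continuous_intros continuous_on_subset[OF cont], simp)
  have Ico: "set_integrable lborel (I k) (\<lambda>t. d)" for k and d :: real
    unfolding I_def by (rule borel_integrable_atLeastAtMost') (intro continuous_intros)
  have Iconst: "(LINT t:I k|lborel. d) = d * h k" for k and d :: real
    unfolding I_def set_lebesgue_integral_def using h(1)[of k] by simp
  have decr: "h (k + j) \<le> h k" for k j
    unfolding h_def by (intro divide_left_mono) (auto simp: power_add)
  have I_sub: "I (k + j) \<subseteq> I k" for k j using decr[of k j] by (auto simp: I_def)
  \<comment> \<open>On the smaller arc the two oscillations sum to at most M h_k + M h_(k+1), which
    is 3 M times its length.\<close>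
  have step: "norm (c k - c (Suc k)) \<le> 3 * M" for k
  proof -
    have "norm (c k - c (Suc k)) * h (Suc k) = (LINT t:I (Suc k)|lborel. norm (c k - c (Suc k)))"
      unfolding Iconst ..
    also have "\<dots> \<le> (LINT t:I (Suc k)|lborel. norm (\<phi> t - c k) + norm (\<phi> t - c (Suc k)))"
    proof (rule set_integral_mono[OF Ico set_integral_add(1)[OF int int]])
      show "norm (c k - c (Suc k)) \<le> norm (\<phi> t - c k) + norm (\<phi> t - c (Suc k))" for t
        using norm_triangle_ineq4[of "\<phi> t - c (Suc k)" "\<phi> t - c k"] by simp
    qed
    also have "\<dots> = (LINT t:I (Suc k)|lborel. norm (\<phi> t - c k)) + (LINT t:I (Suc k)|lborel. norm (\<phi> t - c (Suc k)))"
      by (rule set_integral_add(2)[OF int int])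
    also have "(LINT t:I (Suc k)|lborel. norm (\<phi> t - c k)) \<le> (LINT t:I k|lborel. norm (\<phi> t - c k))"
      unfolding set_lebesgue_integral_def
    proof (rule integral_mono[OF int[unfolded set_integrable_def] int[unfolded set_integrable_def]])
      show "indicat_real (I (Suc k)) t *\<^sub>R norm (\<phi> t - c k) \<le> indicat_real (I k) t *\<^sub>R norm (\<phi> t - c k)" for t
        using I_sub[of k 1] by (auto simp: indicator_def)
    qed
    also have "\<dots> \<le> M * h k" by (rule c)
    also have "(LINT t:I (Suc k)|lborel. norm (\<phi> t - c (Suc k))) \<le> M * h (Suc k)" by (rule c)
    finally have "norm (c k - c (Suc k)) * h (Suc k) \<le> (3 * M) * h (Suc k)"
      using h_Suc[of k] by simp
    then show ?thesis using h(1)[of "Suc k"] by (simp add: mult_le_cancel_right)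
  qed
  have chain: "norm (c k - c (k + j)) \<le> 3 * M * real j" for k j
  proof (induction j)
    case (Suc j)
    have "norm (c k - c (k + Suc j)) \<le> norm (c k - c (k + j)) + norm (c (k + j) - c (Suc (k + j)))"
      using norm_triangle_ineq[of "c k - c (k + j)" "c (k + j) - c (Suc (k + j))"] by simp
    then show ?case using Suc step[of "k + j"] by (simp add: algebra_simps)
  qed simp
  define \<delta> where "\<delta> = 1 - norm w"
  have \<delta>: "0 < \<delta>" "\<delta> \<le> 1" using w by (simp_all add: \<delta>_def)
  define n where "n = (LEAST n. 1 / \<delta> < 2 ^ Suc n)"
  have n: "1 / \<delta> < 2 ^ Suc n" "2 ^ n \<le> 1 / \<delta>"
  proof -
    obtain m where "1 / \<delta> < 2 ^ m" using real_arch_pow[of 2 "1 / \<delta>"] by auto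
    moreover have "(2::real) ^ m < 2 ^ Suc m" by simp
    ultimately have "1 / \<delta> < 2 ^ Suc m" by (rule less_trans)
    then show "1 / \<delta> < 2 ^ Suc n" unfolding n_def by (rule LeastI)
    show "2 ^ n \<le> 1 / \<delta>"
    proof (cases n)
      case 0
      then show ?thesis using \<delta> by simp
    next
      case (Suc m)
      then have "\<not> 1 / \<delta> < 2 ^ Suc m" using not_less_Least[of m "\<lambda>n. 1 / \<delta> < 2 ^ Suc n"] by (simp add: n_def)
      then show ?thesis using Suc by simp
    qed
  qed
  have \<delta>n: "\<delta> \<le> 1 / 2 ^ n" using n(2) \<delta> by (simp add: field_simps)
  define A where "A k = (LINT t:I k|lborel. norm (\<phi> t - c n))" for k
  have A: "A k \<le> M * h k * (1 + 3 * real (n - k))" if "k \<le> n" for k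
  proof -
    have "A k \<le> (LINT t:I k|lborel. norm (\<phi> t - c k) + norm (c k - c n))"
      unfolding A_def
    proof (rule set_integral_mono[OF int set_integral_add(1)[OF int Ico]])
      show "norm (\<phi> t - c n) \<le> norm (\<phi> t - c k) + norm (c k - c n)" for t
        using norm_triangle_ineq[of "\<phi> t - c k" "c k - c n"] by simp
    qed
    also have "\<dots> = (LINT t:I k|lborel. norm (\<phi> t - c k)) + norm (c k - c n) * h k"
      unfolding set_integral_add(2)[OF int Ico] Iconst ..
    also have "\<dots> \<le> M * h k + 3 * M * real (n - k) * h k"
      using chain[of k "n - k"] that h(1)[of k] by (intro add_mono c mult_right_mono) auto
    finally show ?thesis by (simp add: algebra_simps)
  qed
  have P2: "poisson w t \<le> 2 * \<delta> / (norm (1 - cnj w * cis t))\<^sup>2" for t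
  proof -
    have "1 - (norm w)\<^sup>2 = (1 + norm w) * \<delta>" by (simp add: \<delta>_def algebra_simps power2_eq_square)
    also have "\<dots> \<le> 2 * \<delta>" using w \<delta> by (intro mult_right_mono) auto
    finally show ?thesis unfolding poisson_def by (intro divide_right_mono) auto
  qed
  have dist1: "\<delta> \<le> norm (1 - cnj w * cis t)" for t
    using norm_triangle_ineq2[of 1 "cnj w * cis t"] by (simp add: norm_mult \<delta>_def)
  \<comment> \<open>Moving w radially to the circle costs \<delta>, itself at most the distance in
    question, so the constant 1/3 is halved.\<close>
  have dist2: "\<bar>t - \<alpha>\<bar> / 6 \<le> norm (1 - cnj w * cis t)" if "t \<in> I 0" for t
  proof -
    have "\<bar>t - \<alpha>\<bar> \<le> pi" using that by (auto simp: I_def h_def)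
    then have "\<bar>t - \<alpha>\<bar> / 3 \<le> norm (1 - cis (t - \<alpha>))" by (rule norm_1_minus_cis_ge)
    have "cnj w * cis t = norm w * cis (t - \<alpha>)"
      by (subst \<alpha>) (simp add: cis_cnj cis_mult mult.assoc)
    then have "1 - cis (t - \<alpha>) = (1 - cnj w * cis t) - of_real \<delta> * cis (t - \<alpha>)"
      by (simp add: \<delta>_def algebra_simps)
    then have "norm (1 - cis (t - \<alpha>)) \<le> norm (1 - cnj w * cis t) + norm (of_real \<delta> * cis (t - \<alpha>))"
      by (simp only: norm_triangle_ineq4)
    also have "norm (of_real \<delta> * cis (t - \<alpha>)) = \<delta>" using \<delta> by (simp add: norm_mult)
    finally show ?thesis using \<open>\<bar>t - \<alpha>\<bar> / 3 \<le> norm (1 - cis (t - \<alpha>))\<close> dist1[of t] by linarith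
  qed
  \<comment> \<open>Off the next arc the distance is at least 1/(4 2^k), so the kernel is at most 2
    \<delta> 16 4^k, with \<delta> at most 2^(-n).\<close>
  define C where "C k = (32 * (4 ^ k / 2 ^ n) :: real)" for k :: nat
  have point: "poisson w t \<le> 4 * 2 ^ n * indicat_real (I n) t + (\<Sum>k<n. C k * indicat_real (I k) t)" if t: "t \<in> I 0" for t
  proof -
    have C0: "0 \<le> C k" for k by (simp add: C_def)
    show ?thesis
    proof (cases "t \<in> I n")
      case True
      have "2 * \<delta> / (norm (1 - cnj w * cis t))\<^sup>2 \<le> 2 * \<delta> / \<delta>\<^sup>2"
        using \<delta> dist1[of t] by (intro divide_left_mono power_mono mult_pos_pos) auto
      also have "\<dots> = 2 * (1 / \<delta>)" using \<delta> by (simp add: power2_eq_square)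
      also have "\<dots> \<le> 4 * 2 ^ n" using n(1) by simp
      finally have "poisson w t \<le> 4 * 2 ^ n" using P2[of t] by linarith
      moreover have "0 \<le> (\<Sum>k<n. C k * indicat_real (I k) t)" by (intro sum_nonneg mult_nonneg_nonneg C0) auto
      ultimately show ?thesis using True by simp
    next
      case False
      \<comment> \<open>The first arc that misses \<open>t\<close>; it is not arc 0, so
        \<open>t\<close> lies in its predecessor and the distance bound of that scale
        applies.\<close>
      define j where "j = (LEAST j. t \<notin> I j)"
      have j: "t \<notin> I j" unfolding j_def using False by (rule LeastI)
      have "j \<noteq> 0" using j t by (metis (full_types))
      then obtain k where k: "j = Suc k" by (cases j) auto
      have tk: "t \<in> I k" using not_less_Least[of k "\<lambda>j. t \<notin> I j"] k by (auto simp: j_def)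
      have "k < n"
      proof (rule ccontr)
        assume "\<not> k < n"
        then show False using tk False I_sub[of n "k - n"] by auto
      qed
      have far: "pi / (2 * 2 ^ k) \<le> \<bar>t - \<alpha>\<bar>"
        using j h(1)[of j] by (auto simp: k I_def h_def not_le)
      have "3 / (2 * 2 ^ k) / 6 \<le> pi / (2 * 2 ^ k) / 6" using pi_gt3 by (intro divide_right_mono) auto
      also have "\<dots> \<le> \<bar>t - \<alpha>\<bar> / 6" using far by (rule divide_right_mono) simp
      also have "\<dots> \<le> norm (1 - cnj w * cis t)" by (rule dist2[OF t])
      finally have "1 / (4 * 2 ^ k) \<le> norm (1 - cnj w * cis t)" by simp
      then have "(1 / (4 * 2 ^ k))\<^sup>2 \<le> (norm (1 - cnj w * cis t))\<^sup>2" by (intro power_mono) auto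
      then have "2 * \<delta> / (norm (1 - cnj w * cis t))\<^sup>2 \<le> 2 * \<delta> / (1 / (4 * 2 ^ k))\<^sup>2"
        using \<delta> poisson_denom[OF w, of t] by (intro divide_left_mono mult_pos_pos) auto
      also have "\<dots> = 32 * 4 ^ k * \<delta>"
      proof -
        have "((4::real) * 2 ^ k)\<^sup>2 = 16 * 4 ^ k" by (simp add: power_mult_distrib power2_eq_square flip: power_mult_distrib)
        then show ?thesis by (simp add: power_divide)
      qed
      also have "\<dots> \<le> 32 * 4 ^ k * (1 / 2 ^ n)" using \<delta>n by (intro mult_left_mono) auto
      finally have "poisson w t \<le> C k" using P2[of t] unfolding C_def by simp
      also have "C k = C k * indicat_real (I k) t" using tk by simp
      also have "\<dots> \<le> (\<Sum>k<n. C k * indicat_real (I k) t)"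
        using \<open>k < n\<close> by (intro member_le_sum) (auto intro: mult_nonneg_nonneg C0)
      finally show ?thesis using False by simp
    qed
  qed
  have contP: "continuous_on UNIV (\<lambda>t. poisson w t * norm (\<phi> t - c n))"
    by (intro continuous_intros continuous_poisson w cont)
  have perP: "poisson w (t + 2 * pi) = poisson w t" for t
  proof -
    have "cis (t + 2 * pi) = cis t" by (simp add: cis_mult[symmetric])
    then show ?thesis by (simp only: poisson_def)
  qed
  have I0: "I 0 = {\<alpha> - pi..\<alpha> - pi + 2 * pi}" by (simp add: I_def h_def)
  have "(\<integral>t. poisson w t * norm (\<phi> t - c n) \<partial>Circ) = (LINT t:I 0|lborel. poisson w t * norm (\<phi> t - c n))"
    unfolding I0 integral_Circ_eq using integrable_Circ_continuous[OF contP]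
    by (intro periodic_integral_shift(2)[symmetric]) (auto simp: perP per integrable_Circ_iff)
  also have "\<dots> = (\<integral>t. indicat_real (I 0) t * (poisson w t * norm (\<phi> t - c n)) \<partial>lborel)"
    by (simp add: set_lebesgue_integral_def)
  also have "\<dots> \<le> (\<integral>t. 4 * 2 ^ n * (indicat_real (I n) t * norm (\<phi> t - c n)) + (\<Sum>k<n. C k * (indicat_real (I k) t * norm (\<phi> t - c n))) \<partial>lborel)"
  proof (rule integral_mono)
    have ik: "integrable lborel (\<lambda>t. indicat_real (I k) t * norm (\<phi> t - c n))" for k
      using int[of k "c n"] by (simp add: set_integrable_def)
    show "integrable lborel (\<lambda>t. 4 * 2 ^ n * (indicat_real (I n) t * norm (\<phi> t - c n)) + (\<Sum>k<n. C k * (indicat_real (I k) t * norm (\<phi> t - c n))))"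
      by (intro Bochner_Integration.integrable_add Bochner_Integration.integrable_sum Bochner_Integration.integrable_mult_right ik)
    have "set_integrable lborel (I 0) (\<lambda>t. poisson w t * norm (\<phi> t - c n))"
      unfolding I_def by (rule borel_integrable_atLeastAtMost') (rule continuous_on_subset[OF contP], simp)
    then show "integrable lborel (\<lambda>t. indicat_real (I 0) t * (poisson w t * norm (\<phi> t - c n)))"
      by (simp add: set_integrable_def)
    fix t
    show "indicat_real (I 0) t * (poisson w t * norm (\<phi> t - c n)) \<le>
      4 * 2 ^ n * (indicat_real (I n) t * norm (\<phi> t - c n)) + (\<Sum>k<n. C k * (indicat_real (I k) t * norm (\<phi> t - c n)))"
    proof (cases "t \<in> I 0")
      case True
      have "poisson w t * norm (\<phi> t - c n) \<le> (4 * 2 ^ n * indicat_real (I n) t + (\<Sum>k<n. C k * indicat_real (I k) t)) * norm (\<phi> t - c n)"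
        by (intro mult_right_mono point True) simp
      also have "\<dots> = 4 * 2 ^ n * (indicat_real (I n) t * norm (\<phi> t - c n)) + (\<Sum>k<n. C k * (indicat_real (I k) t * norm (\<phi> t - c n)))"
        by (simp only: distrib_right sum_distrib_right mult.assoc)
      finally show ?thesis by (simp only: indicator_simps(1)[OF True] mult_1_left)
    next
      case False
      have "0 \<le> 4 * 2 ^ n * (indicat_real (I n) t * norm (\<phi> t - c n)) + (\<Sum>k<n. C k * (indicat_real (I k) t * norm (\<phi> t - c n)))"
        by (intro add_nonneg_nonneg sum_nonneg mult_nonneg_nonneg) (auto simp: C_def)
      then show ?thesis using False by simp
    qed
  qed
  also have "\<dots> = 4 * 2 ^ n * A n + (\<Sum>k<n. C k * A k)"
  proof -
    have ik: "integrable lborel (\<lambda>t. indicat_real (I k) t * norm (\<phi> t - c n))" for k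
      using int[of k "c n"] by (simp add: set_integrable_def)
    have Ak: "A k = (\<integral>t. indicat_real (I k) t * norm (\<phi> t - c n) \<partial>lborel)" for k
      by (simp add: A_def set_lebesgue_integral_def)
    have "(\<integral>t. (\<Sum>k<n. C k * (indicat_real (I k) t * norm (\<phi> t - c n))) \<partial>lborel) = (\<Sum>k<n. C k * A k)"
      unfolding Ak integral_mult_right_zero[symmetric]
      by (rule Bochner_Integration.integral_sum) (intro Bochner_Integration.integrable_mult_right ik)
    moreover have "(\<integral>t. 4 * 2 ^ n * (indicat_real (I n) t * norm (\<phi> t - c n)) \<partial>lborel) = 4 * 2 ^ n * A n"
      unfolding Ak by (rule integral_mult_right_zero)
    ultimately show ?thesis
      by (subst Bochner_Integration.integral_add) (auto intro!: Bochner_Integration.integrable_sum Bochner_Integration.integrable_mult_right ik)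
  qed
  also have "\<dots> \<le> 4 * 2 ^ n * (M * h n) + (\<Sum>k<n. C k * (M * h k * (1 + 3 * real (n - k))))"
    using A[of n] by (intro add_mono mult_left_mono sum_mono A) (auto simp: C_def)
  also have "\<dots> = 2 * pi * (M * (4 + 32 / 2 ^ n * (\<Sum>k<n. 2 ^ k * (1 + 3 * real (n - k)))))"
  proof -
    have "C k * (M * h k * (1 + 3 * real (n - k))) = 2 * pi * (M * (32 / 2 ^ n * (2 ^ k * (1 + 3 * real (n - k)))))" for k
    proof -
      have "(4::real) ^ k = 2 ^ k * 2 ^ k" by (simp flip: power_mult_distrib)
      then show ?thesis by (simp add: C_def h_def field_simps)
    qed
    then have "(\<Sum>k<n. C k * (M * h k * (1 + 3 * real (n - k)))) = 2 * pi * (M * (32 / 2 ^ n * (\<Sum>k<n. 2 ^ k * (1 + 3 * real (n - k)))))"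
      by (simp only: sum_distrib_left)
    moreover have "4 * 2 ^ n * (M * h n) = 2 * pi * (M * 4)" by (simp add: h_def)
    ultimately show ?thesis by (simp only: distrib_left)
  qed
  also have "\<dots> \<le> 2 * pi * (M * (4 + 32 / 2 ^ n * (7 * 2 ^ n)))"
    using M sum_dyadic[of n] by (intro mult_left_mono add_left_mono) auto
  \<comment> \<open>228 = 4 + 32 * 7: the innermost arc and the dyadic sum.\<close>
  also have "\<dots> = 2 * pi * (228 * M)" by simp
  finally show ?thesis by blast
qed

section \<open>Convolution kernels and mean oscillation\<close>

text \<open>Minkowski's inequality: an average of translates, centred at the average of their
  centres, oscillates no more than the translates do. Tonelli exchanges the integrals after passing
  to norms.\<close>

lemma averaged_mean_oscillation:
  fixes g :: "real \<Rightarrow> complex" and k :: "real \<Rightarrow> real" and \<gamma> :: "real \<Rightarrow> complex"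
  assumes g[measurable]: "g \<in> borel_measurable borel" and \<gamma>[measurable]: "\<gamma> \<in> borel_measurable borel"
    and k: "\<And>s. 0 \<le> k s" "integrable lborel k" "(\<integral>s. k s \<partial>lborel) = 1"
    and kg: "\<And>t. integrable lborel (\<lambda>s. k s *\<^sub>R g (t + s))"
    and k\<gamma>: "integrable lborel (\<lambda>s. k s *\<^sub>R \<gamma> s)"
    and int: "\<And>s. set_integrable lborel A (\<lambda>t. norm (g (t + s) - \<gamma> s))"
    and osc: "\<And>s. (LINT t:A|lborel. norm (g (t + s) - \<gamma> s)) \<le> B"
    and A[measurable]: "A \<in> sets borel" and B: "0 \<le> B"
  shows "(LINT t:A|lborel. norm ((\<integral>s. k s *\<^sub>R g (t + s) \<partial>lborel) - (\<integral>s. k s *\<^sub>R \<gamma> s \<partial>lborel))) \<le> B"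
proof -
  have [measurable]: "k \<in> borel_measurable borel" using borel_measurable_integrable[OF k(2)] by simp
  define \<sigma> where "\<sigma> t = (\<integral>s. k s *\<^sub>R g (t + s) \<partial>lborel) - (\<integral>s. k s *\<^sub>R \<gamma> s \<partial>lborel)" for t
  have \<sigma>: "\<sigma> t = (\<integral>s. k s *\<^sub>R (g (t + s) - \<gamma> s) \<partial>lborel)" for t
    unfolding \<sigma>_def scaleR_diff_right by (rule Bochner_Integration.integral_diff[symmetric, OF kg k\<gamma>])
  have inn: "(\<integral>\<^sup>+t. ennreal (indicat_real A t * norm (g (t + s) - \<gamma> s)) \<partial>lborel) \<le> ennreal B" for s
  proof -
    have "(\<integral>\<^sup>+t. ennreal (indicat_real A t * norm (g (t + s) - \<gamma> s)) \<partial>lborel)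
        = ennreal (LINT t:A|lborel. norm (g (t + s) - \<gamma> s))"
      unfolding set_lebesgue_integral_def real_scaleR_def
      by (rule nn_integral_eq_integral) (use int[of s] in \<open>auto simp: set_integrable_def\<close>)
    then show ?thesis using osc[of s] by (simp add: ennreal_leI)
  qed
  have "(\<integral>\<^sup>+t. ennreal (indicat_real A t * norm (\<sigma> t)) \<partial>lborel)
      \<le> (\<integral>\<^sup>+t. (\<integral>\<^sup>+s. ennreal (indicat_real A t * (k s * norm (g (t + s) - \<gamma> s))) \<partial>lborel) \<partial>lborel)"
  proof (rule nn_integral_mono)
    fix t
    have i: "integrable lborel (\<lambda>s. k s *\<^sub>R (g (t + s) - \<gamma> s))"
      unfolding scaleR_diff_right by (rule Bochner_Integration.integrable_diff[OF kg k\<gamma>])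
    have "ennreal (norm (\<sigma> t)) \<le> (\<integral>\<^sup>+s. ennreal (k s * norm (g (t + s) - \<gamma> s)) \<partial>lborel)"
      unfolding \<sigma> using integral_norm_bound_ennreal[OF i] k(1) by simp
    then show "ennreal (indicat_real A t * norm (\<sigma> t)) \<le> (\<integral>\<^sup>+s. ennreal (indicat_real A t * (k s * norm (g (t + s) - \<gamma> s))) \<partial>lborel)"
      by (cases "t \<in> A") auto
  qed
  also have "\<dots> = (\<integral>\<^sup>+s. (\<integral>\<^sup>+t. ennreal (indicat_real A t * (k s * norm (g (t + s) - \<gamma> s))) \<partial>lborel) \<partial>lborel)"
    by (rule lborel_pair.Fubini') measurable
  also have "\<dots> \<le> (\<integral>\<^sup>+s. ennreal (k s) * ennreal B \<partial>lborel)"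
  proof (rule nn_integral_mono)
    fix s
    have "(\<integral>\<^sup>+t. ennreal (indicat_real A t * (k s * norm (g (t + s) - \<gamma> s))) \<partial>lborel)
        = (\<integral>\<^sup>+t. ennreal (k s) * ennreal (indicat_real A t * norm (g (t + s) - \<gamma> s)) \<partial>lborel)"
      by (intro nn_integral_cong) (simp add: k(1) ennreal_mult[symmetric] mult.left_commute)
    also have "\<dots> = ennreal (k s) * (\<integral>\<^sup>+t. ennreal (indicat_real A t * norm (g (t + s) - \<gamma> s)) \<partial>lborel)"
      by (rule nn_integral_cmult) measurable
    also have "\<dots> \<le> ennreal (k s) * ennreal B" by (intro mult_left_mono inn) simp
    finally show "(\<integral>\<^sup>+t. ennreal (indicat_real A t * (k s * norm (g (t + s) - \<gamma> s))) \<partial>lborel) \<le> ennreal (k s) * ennreal B" .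
  qed
  also have "\<dots> = (\<integral>\<^sup>+s. ennreal (k s) \<partial>lborel) * ennreal B" by (rule nn_integral_multc) measurable
  also have "(\<integral>\<^sup>+s. ennreal (k s) \<partial>lborel) = ennreal 1"
    using nn_integral_eq_integral[OF k(2)] k(1,3) by simp
  finally have "(\<integral>\<^sup>+t. ennreal (indicat_real A t * norm (\<sigma> t)) \<partial>lborel) \<le> ennreal B" by simp
  then have "(\<integral>t. indicat_real A t * norm (\<sigma> t) \<partial>lborel) \<le> B"
    by (rule integral_real_bounded[OF B])
  then show ?thesis by (simp add: set_lebesgue_integral_def \<sigma>_def)
qed

section \<open>Fejer means\<close>

text \<open>A squared modulus, so that positivity is immediate; \<open>fejer_expand\<close> recovers
  the trigonometric polynomial.\<close>

definition fejer :: "nat \<Rightarrow> real \<Rightarrow> real" where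
  "fejer N s = (norm (\<Sum>k<N. cis (real k * s)))\<^sup>2 / real N"

lemma fejer_nonneg: "0 \<le> fejer N s"
  by (simp add: fejer_def)

lemma fejer_le: "fejer N s \<le> real N"
proof -
  have "norm (\<Sum>k<N. cis (real k * s)) \<le> (\<Sum>k<N. norm (cis (real k * s)))" by (rule norm_sum)
  then have "(norm (\<Sum>k<N. cis (real k * s)))\<^sup>2 \<le> (real N)\<^sup>2" by (intro power_mono) auto
  then show ?thesis by (cases "N = 0") (auto simp: fejer_def power2_eq_square divide_le_eq)
qed

lemma continuous_fejer [continuous_intros]: "continuous_on A (fejer N)"
  unfolding fejer_def[abs_def] divide_inverse by (intro continuous_intros)

lemma fejer_expand:
  "complex_of_real (fejer N s) = (\<Sum>j<N. \<Sum>k<N. cis (real_of_int (int j - int k) * s)) / of_nat N"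
proof -
  have "complex_of_real ((norm (\<Sum>k<N. cis (real k * s)))\<^sup>2) = (\<Sum>j<N. cis (real j * s)) * (\<Sum>k<N. cnj (cis (real k * s)))"
    by (simp only: complex_norm_square cnj_sum)
  also have "\<dots> = (\<Sum>j<N. \<Sum>k<N. cis (real_of_int (int j - int k) * s))"
    unfolding sum_product by (intro sum.cong refl) (simp add: cis_cnj cis_mult left_diff_distrib)
  finally show ?thesis unfolding fejer_def of_real_divide of_real_of_nat_eq by simp
qed

lemma integrable_mult_cis:
  assumes "integrable Circ g"
  shows "integrable Circ (\<lambda>s. cis (real_of_int m * s) * g s)"
proof (rule Bochner_Integration.integrable_bound[OF assms])
  have "(\<lambda>s. cis (real_of_int m * s)) \<in> borel_measurable Circ"
    by (intro measurable_Circ borel_measurable_continuous_onI continuous_intros)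
  then show "(\<lambda>s. cis (real_of_int m * s) * g s) \<in> borel_measurable Circ"
    using borel_measurable_times[OF _ borel_measurable_integrable[OF assms]] by blast
qed (simp add: norm_mult)

lemma integral_cis_translate:
  assumes per: "\<And>t. g (t + 2 * pi) = g t" and int: "integrable Circ g"
  shows "integrable Circ (\<lambda>s. g (t + s))"
    and "(\<integral>s. cis (real_of_int m * s) * g (t + s) \<partial>Circ) = 2 * pi * (cis (real_of_int (- m) * t) * fourier_coeff g (- m))"
proof -
  have gi: "set_integrable lborel {0..2*pi} g" using int unfolding integrable_Circ_iff .
  note sh = periodic_integral_shift[of _ t]
  show "integrable Circ (\<lambda>s. g (t + s))"
    using set_integral_translate(1)[of 0 "2*pi" g t] sh(1)[OF per gi]
    by (simp add: integrable_Circ_iff add.commute)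
  define G where "G x = cis (real_of_int m * (x - t)) * g x" for x
  have Geq: "G x = cis (real_of_int (- m) * t) * (cis (real_of_int m * x) * g x)" for x
    by (simp add: G_def cis_mult right_diff_distrib flip: mult.assoc)
  have Gper: "G (x + 2 * pi) = G x" for x
  proof -
    have "cis (real_of_int m * (x + 2 * pi)) = cis (real_of_int m * x)"
      using cis_multiple_2pi[of "real_of_int m"] by (simp add: distrib_left cis_mult[symmetric] mult_ac)
    then show ?thesis by (simp add: Geq per)
  qed
  have Gi: "set_integrable lborel {0..2*pi} G"
    unfolding integrable_Circ_iff[symmetric] Geq
    by (intro Bochner_Integration.integrable_mult_right integrable_mult_cis int)
  have "(\<integral>s. cis (real_of_int m * s) * g (t + s) \<partial>Circ) = (LINT s:{0..2*pi}|lborel. G (s + t))"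
    unfolding integral_Circ_eq by (simp add: G_def add.commute)
  also have "\<dots> = (LINT s:{0..2*pi}|lborel. G s)"
    using set_integral_translate(2)[of 0 "2*pi" G t] sh(2)[OF Gper Gi] by (simp add: add.commute)
  also have "\<dots> = cis (real_of_int (- m) * t) * (\<integral>s. cis (real_of_int m * s) * g s \<partial>Circ)"
    unfolding integral_Circ_eq[symmetric] Geq by (rule integral_mult_right_zero)
  also have "(\<integral>s. cis (real_of_int m * s) * g s \<partial>Circ) = 2 * pi * fourier_coeff g (- m)"
    by (simp add: fourier_coeff_def integral_Circ_eq mult.commute)
  finally show "(\<integral>s. cis (real_of_int m * s) * g (t + s) \<partial>Circ) = 2 * pi * (cis (real_of_int (- m) * t) * fourier_coeff g (- m))"
    by (simp add: mult_ac)
qed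

lemma integral_fejer_translate:
  assumes per: "\<And>t. g (t + 2 * pi) = g t" and int: "integrable Circ g"
  shows "(\<integral>s. fejer N s *\<^sub>R g (t + s) \<partial>Circ) =
    2 * pi * (\<Sum>j<N. \<Sum>k<N. cis (real_of_int (int k - int j) * t) * fourier_coeff g (int k - int j)) / of_nat N"
proof -
  have i: "integrable Circ (\<lambda>s. cis (real_of_int (int j - int k) * s) * g (t + s))" for j k
    by (rule integrable_mult_cis[OF integral_cis_translate(1)[OF per int]])
  have "(\<integral>s. fejer N s *\<^sub>R g (t + s) \<partial>Circ) =
      (\<integral>s. (\<Sum>j<N. \<Sum>k<N. cis (real_of_int (int j - int k) * s) * g (t + s)) / of_nat N \<partial>Circ)"
    unfolding scaleR_conv_of_real fejer_expand sum_distrib_right[symmetric] times_divide_eq_left ..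
  also have "\<dots> = (\<Sum>j<N. \<Sum>k<N. (\<integral>s. cis (real_of_int (int j - int k) * s) * g (t + s) \<partial>Circ)) / of_nat N"
    unfolding integral_divide_zero
    by (subst Bochner_Integration.integral_sum; (intro Bochner_Integration.integrable_sum i)?)
      (subst Bochner_Integration.integral_sum; (intro i refl)?)
  also have "\<dots> = (\<Sum>j<N. \<Sum>k<N. 2 * pi * (cis (real_of_int (int k - int j) * t) * fourier_coeff g (int k - int j))) / of_nat N"
    unfolding integral_cis_translate(2)[OF per int] minus_diff_eq ..
  also have "\<dots> = 2 * pi * (\<Sum>j<N. \<Sum>k<N. cis (real_of_int (int k - int j) * t) * fourier_coeff g (int k - int j)) / of_nat N"
    by (simp only: sum_distrib_left)
  finally show ?thesis .
qed

lemma integral_fejer: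
  assumes "N > 0"
  shows "(\<integral>s. fejer N s \<partial>Circ) = 2 * pi"
proof -
  have "fourier_coeff (\<lambda>_. 1) n = (if n = 0 then 1 else 0)" for n
    using integral_Circ_cis[of "- n"] by (simp add: fourier_coeff_def integral_Circ_eq)
  then have "(\<Sum>j<N. \<Sum>k<N. cis (real_of_int (int k - int j) * 0) * fourier_coeff (\<lambda>_. 1) (int k - int j)) = (\<Sum>j<N. \<Sum>k<N. if k = j then 1 else 0)"
    by (intro sum.cong refl) auto
  also have "\<dots> = of_nat N" by simp
  finally have "(\<integral>s. fejer N s *\<^sub>R (1::complex) \<partial>Circ) = 2 * pi"
    using integral_fejer_translate[of "\<lambda>_. 1" N 0] assms by simp
  then have "complex_of_real (\<integral>s. fejer N s \<partial>Circ) = complex_of_real (2 * pi)"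
    by (simp add: scaleR_conv_of_real)
  then show ?thesis by (simp only: of_real_eq_iff)
qed

text \<open>Sums along diagonals: the difference m occurs N - m times, which is where the Cesaro
  weights come from.\<close>

lemma sum_toeplitz:
  fixes a :: "nat \<Rightarrow> 'a :: comm_ring_1"
  shows "(\<Sum>j<N. \<Sum>k<N. if j \<le> k then a (k - j) else 0) = (\<Sum>m<N. of_nat (N - m) * a m)"
proof (induction N)
  case (Suc N)
  have "(\<Sum>j<Suc N. a (N - j)) = (\<Sum>m<Suc N. a m)"
    using sum.nat_diff_reindex[of a "Suc N"] by simp
  then have a: "(\<Sum>j<N. a (N - j)) + a 0 = (\<Sum>m<Suc N. a m)" by simp
  have "(\<Sum>j<Suc N. \<Sum>k<Suc N. if j \<le> k then a (k - j) else 0) =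
      (\<Sum>j<N. \<Sum>k<N. if j \<le> k then a (k - j) else 0) + ((\<Sum>j<N. a (N - j)) + a 0)"
    by (simp add: sum.distrib)
  then have "(\<Sum>j<Suc N. \<Sum>k<Suc N. if j \<le> k then a (k - j) else 0) = (\<Sum>m<N. of_nat (N - m) * a m) + (\<Sum>m<Suc N. a m)"
    unfolding Suc a .
  moreover have "(\<Sum>m<N. of_nat (N - m) * a m) + (\<Sum>m<N. a m) = (\<Sum>m<N. of_nat (Suc N - m) * a m)"
    unfolding sum.distrib[symmetric] by (intro sum.cong refl) (simp add: Suc_diff_le algebra_simps)
  ultimately show ?case by simp
qed simp

definition fejer_mean :: "nat \<Rightarrow> (nat \<Rightarrow> complex) \<Rightarrow> complex poly" where
  "fejer_mean N u = fpoly N (\<lambda>m. of_nat (N - m) / of_nat N * u m)"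

lemma integral_fejer_boundary_fn:
  assumes g: "boundary_fn u g" and int: "integrable Circ g"
  shows "(\<integral>s. fejer N s *\<^sub>R g (t + s) \<partial>Circ) = 2 * pi * poly (fejer_mean N u) (cis t)"
proof -
  have per: "g (t + 2 * pi) = g t" for t using g by (auto simp: boundary_fn_def)
  \<comment> \<open>A boundary function of an H^2 element has no negative frequencies, so only the
    pairs with \<open>j \<le> k\<close> survive.\<close>
  have "(\<Sum>j<N. \<Sum>k<N. cis (real_of_int (int k - int j) * t) * fourier_coeff g (int k - int j))
      = (\<Sum>j<N. \<Sum>k<N. if j \<le> k then u (k - j) * cis (real (k - j) * t) else 0)"
    using g by (intro sum.cong refl) (auto simp: boundary_fn_def of_nat_diff nat_diff_distrib mult.commute)
  also have "\<dots> = (\<Sum>m<N. of_nat (N - m) * (u m * cis (real m * t)))"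
    by (rule sum_toeplitz[of "\<lambda>m. u m * cis (real m * t)"])
  finally show ?thesis
    unfolding integral_fejer_translate[OF per int] fejer_mean_def poly_fpoly_cis
    by (simp add: sum_divide_distrib sum_distrib_left mult_ac)
qed

section \<open>Boundedness of Hankel operators with symbol in BMOA\<close>

lemma fejer_mean_oscillation:
  assumes g: "boundary_fn u g" and int: "integrable Circ g" and M: "0 \<le> M" and N: "0 < N"
    and bmo: "\<And>a h. 0 < h \<Longrightarrow> h \<le> 2 * pi \<Longrightarrow>
      (LINT t:{a..a+h}|lborel. norm (g t - (LINT x:{a..a+h}|lborel. g x) / h)) \<le> M * h"
    and h: "0 < h" "h \<le> 2 * pi"
  shows "\<exists>c. (LINT t:{a..a+h}|lborel. norm (poly (fejer_mean N u) (cis t) - c)) \<le> M * h"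
proof -
  have gm[measurable]: "g \<in> borel_measurable borel" and per: "g (t + 2 * pi) = g t" for t
    using g by (auto simp: boundary_fn_def)
  have gi: "set_integrable lborel {0..2*pi} g" using int unfolding integrable_Circ_iff .
  have gin: "set_integrable lborel {0..2*pi} (\<lambda>t. norm (g t))" using set_integrable_norm[OF gi] .
  have gs: "set_integrable lborel {b..b+h} g" for b
    by (rule set_integrable_subset[OF periodic_integral_shift(1)[OF per gi, of b]]) (use h in auto)
  \<comment> \<open>The mean of \<open>g\<close> over the arc translated by \<open>s\<close>: the
    centre at which the oscillation bound holds for that translate.\<close>
  define \<gamma> where "\<gamma> s = (LINT x:{a..a+h}|lborel. g (x + s)) / of_real h" for s
  have \<gamma>eq: "\<gamma> s = (LINT x:{a+s..a+s+h}|lborel. g x) / of_real h" for s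
    unfolding \<gamma>_def set_integral_translate(2) by (simp add: add_ac)
  have \<gamma>m: "\<gamma> \<in> borel_measurable borel"
    unfolding \<gamma>_def[abs_def] set_lebesgue_integral_def by measurable
  have \<gamma>b: "norm (\<gamma> s) \<le> (\<integral>t. norm (g t) \<partial>Circ) / h" for s
  proof -
    have "norm (LINT x:{a+s..a+s+h}|lborel. g x) \<le> (LINT x:{a+s..a+s+h}|lborel. norm (g x))"
      by (rule set_integral_norm_bound[OF gs])
    also have "\<dots> \<le> (LINT x:{a+s..a+s+2*pi}|lborel. norm (g x))"
      unfolding set_lebesgue_integral_def
    proof (rule integral_mono)
      show "integrable lborel (\<lambda>x. indicat_real {a+s..a+s+h} x *\<^sub>R norm (g x))"
        using set_integrable_norm[OF gs[of "a+s"]] by (simp add: set_integrable_def)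
      show "integrable lborel (\<lambda>x. indicat_real {a+s..a+s+2*pi} x *\<^sub>R norm (g x))"
        using periodic_integral_shift(1)[of "\<lambda>t. norm (g t)" "a + s"] gin by (simp add: per set_integrable_def)
    qed (use h in \<open>auto simp: indicator_def\<close>)
    also have "\<dots> = (\<integral>t. norm (g t) \<partial>Circ)"
      using periodic_integral_shift(2)[of "\<lambda>t. norm (g t)" "a + s"] gin by (simp add: per integral_Circ_eq)
    finally show ?thesis unfolding \<gamma>eq using h by (simp add: norm_divide divide_right_mono)
  qed
  \<comment> \<open>The Fejer kernel cut to one period and normalised to a probability density on
    the line.\<close>
  define k where "k s = indicat_real {0..2*pi} s * fejer N s / (2 * pi)" for s
  have [measurable]: "fejer N \<in> borel_measurable borel"
    by (intro borel_measurable_continuous_onI continuous_intros)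
  have km[measurable]: "k \<in> borel_measurable borel" unfolding k_def[abs_def] by measurable
  have k0: "0 \<le> k s" for s by (simp add: k_def fejer_nonneg)
  have fi: "integrable Circ (fejer N)" by (intro integrable_Circ_continuous continuous_intros)
  have ki: "integrable lborel k"
    using fi unfolding integrable_Circ_iff set_integrable_def k_def[abs_def] by simp
  have k1: "(\<integral>s. k s \<partial>lborel) = 1"
    using integral_fejer[OF N] unfolding integral_Circ_eq set_lebesgue_integral_def k_def[abs_def] by simp
  have kg: "integrable lborel (\<lambda>s. k s *\<^sub>R g (t + s))" for t
  proof (rule Bochner_Integration.integrable_bound)
    show "integrable lborel (\<lambda>s. (N / (2 * pi)) *\<^sub>R (indicat_real {0..2*pi} s *\<^sub>R g (t + s)))"
      using integral_cis_translate(1)[OF per int, of t] unfolding integrable_Circ_iff set_integrable_def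
      by (rule Bochner_Integration.integrable_scaleR_right)
    show "AE s in lborel. norm (k s *\<^sub>R g (t + s)) \<le> norm ((N / (2 * pi)) *\<^sub>R (indicat_real {0..2*pi} s *\<^sub>R g (t + s)))"
    proof (rule AE_I2)
      fix s
      have "k s \<le> N / (2 * pi) * indicat_real {0..2*pi} s"
        using fejer_le[of N s] by (auto simp: k_def indicator_def divide_right_mono)
      then have "k s * norm (g (t + s)) \<le> N / (2 * pi) * indicat_real {0..2*pi} s * norm (g (t + s))"
        by (rule mult_right_mono) simp
      then show "norm (k s *\<^sub>R g (t + s)) \<le> norm ((N / (2 * pi)) *\<^sub>R (indicat_real {0..2*pi} s *\<^sub>R g (t + s)))"
        using k0[of s] by (simp add: abs_mult mult.assoc)
    qed
  qed measurable
  have k\<gamma>: "integrable lborel (\<lambda>s. k s *\<^sub>R \<gamma> s)"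
  proof (rule Bochner_Integration.integrable_bound)
    show "integrable lborel (\<lambda>s. k s * ((\<integral>t. norm (g t) \<partial>Circ) / h))"
      by (rule Bochner_Integration.integrable_mult_left[OF ki])
    show "AE s in lborel. norm (k s *\<^sub>R \<gamma> s) \<le> norm (k s * ((\<integral>t. norm (g t) \<partial>Circ) / h))"
    proof (rule AE_I2)
      fix s
      have "norm (\<gamma> s) \<le> \<bar>(\<integral>t. norm (g t) \<partial>Circ) / h\<bar>" using \<gamma>b[of s] by linarith
      then show "norm (k s *\<^sub>R \<gamma> s) \<le> norm (k s * ((\<integral>t. norm (g t) \<partial>Circ) / h))"
        unfolding norm_scaleR real_norm_def abs_mult by (rule mult_left_mono) simp
    qed
    show "(\<lambda>s. k s *\<^sub>R \<gamma> s) \<in> borel_measurable lborel" using \<gamma>m by measurable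
  qed
  have nint: "set_integrable lborel {a..a+h} (\<lambda>t. norm (g (t + s) - \<gamma> s))" for s
  proof (rule set_integrable_norm, rule set_integral_diff(1))
    show "set_integrable lborel {a..a+h} (\<lambda>t. g (t + s))"
      using gs[of "a + s"] unfolding set_integral_translate(1) by (simp add: add_ac)
    show "set_integrable lborel {a..a+h} (\<lambda>t. \<gamma> s)"
      by (rule borel_integrable_atLeastAtMost') (rule continuous_on_const)
  qed
  have osc: "(LINT t:{a..a+h}|lborel. norm (g (t + s) - \<gamma> s)) \<le> M * h" for s
  proof -
    have "(LINT t:{a..a+h}|lborel. norm (g (t + s) - \<gamma> s)) = (LINT t:{a+s..a+s+h}|lborel. norm (g t - \<gamma> s))"
      using set_integral_translate(2)[of a "a + h" "\<lambda>t. norm (g t - \<gamma> s)" s] by (simp add: add_ac)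
    also have "\<dots> \<le> M * h" using bmo[OF h, of "a + s"] unfolding \<gamma>eq by simp
    finally show ?thesis .
  qed
  have \<sigma>: "(\<integral>s. k s *\<^sub>R g (t + s) \<partial>lborel) = poly (fejer_mean N u) (cis t)" for t
  proof -
    have "(\<integral>s. k s *\<^sub>R g (t + s) \<partial>lborel) = (\<integral>s. (1 / (2 * pi)) *\<^sub>R (indicat_real {0..2*pi} s *\<^sub>R (fejer N s *\<^sub>R g (t + s))) \<partial>lborel)"
      by (simp add: k_def)
    also have "\<dots> = (1 / (2 * pi)) *\<^sub>R (\<integral>s. fejer N s *\<^sub>R g (t + s) \<partial>Circ)"
      unfolding integral_scaleR_right integral_Circ_eq set_lebesgue_integral_def ..
    also have "\<dots> = poly (fejer_mean N u) (cis t)"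
      unfolding integral_fejer_boundary_fn[OF g int] by (simp add: scaleR_conv_of_real)
    finally show ?thesis .
  qed
  have "(LINT t:{a..a+h}|lborel. norm ((\<integral>s. k s *\<^sub>R g (t + s) \<partial>lborel) - (\<integral>s. k s *\<^sub>R \<gamma> s \<partial>lborel))) \<le> M * h"
    by (rule averaged_mean_oscillation[OF gm \<gamma>m k0 ki k1 kg k\<gamma> nint osc]) (use M h in auto)
  then show ?thesis unfolding \<sigma> by blast
qed

section \<open>From polynomial symbols to BMOA symbols\<close>

lemma hankel_bound_add:
  assumes "hankel_bound u K" "hankel_bound v L"
  shows "hankel_bound (\<lambda>j. u j + v j) (K + L)"
  unfolding hankel_bound_def
proof (intro conjI allI)
  show "0 \<le> K + L" using assms by (simp add: hankel_bound_def)
  fix N and f h :: "nat \<Rightarrow> complex"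
  let ?B = "\<lambda>w :: nat \<Rightarrow> complex. \<Sum>n<N. \<Sum>k<N. w (n + k) * f k * h n"
  let ?f = "sqrt (\<Sum>n<N. (norm (f n))\<^sup>2)" and ?h = "sqrt (\<Sum>n<N. (norm (h n))\<^sup>2)"
  have "?B (\<lambda>j. u j + v j) = ?B u + ?B v" by (simp add: distrib_right sum.distrib)
  then have "norm (?B (\<lambda>j. u j + v j)) \<le> norm (?B u) + norm (?B v)" by (simp add: norm_triangle_ineq)
  also have "\<dots> \<le> K * ?f * ?h + L * ?f * ?h" using assms by (intro add_mono) (simp_all add: hankel_bound_def)
  also have "\<dots> = (K + L) * ?f * ?h" by (simp add: distrib_right)
  finally show "norm (?B (\<lambda>j. u j + v j)) \<le> (K + L) * ?f * ?h" .
qed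

text \<open>Restores the constant term of the symbol, which is removed beforehand because the
  subharmonic estimate asks for u(0) = 0.\<close>

lemma hankel_bound_single: "hankel_bound (\<lambda>j. if j = 0 then a else 0) (norm a)"
  unfolding hankel_bound_def
proof (intro conjI allI)
  fix N and f h :: "nat \<Rightarrow> complex"
  let ?f = "sqrt (\<Sum>n<N. (norm (f n))\<^sup>2)" and ?h = "sqrt (\<Sum>n<N. (norm (h n))\<^sup>2)"
  show "norm (\<Sum>n<N. \<Sum>k<N. (if n + k = 0 then a else 0) * f k * h n) \<le> norm a * ?f * ?h"
  proof (cases "N = 0")
    case False
    have le: "norm (x 0) \<le> sqrt (\<Sum>n<N. (norm (x n))\<^sup>2)" for x :: "nat \<Rightarrow> complex"
      using False by (intro real_le_rsqrt member_le_sum[of 0 "{..<N}" "\<lambda>n. (norm (x n))\<^sup>2"]) auto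
    have "(\<Sum>n<N. \<Sum>k<N. (if n + k = 0 then a else 0) * f k * h n) = (\<Sum>n<N. if n = 0 then (\<Sum>k<N. if k = 0 then a * f 0 * h 0 else 0) else 0)"
      by (intro sum.cong refl) (auto intro!: sum.cong simp del: sum.delta sum.delta')
    also have "\<dots> = a * f 0 * h 0" using False by simp
    finally show ?thesis using le[of f] le[of h] by (simp add: norm_mult mult.assoc mult_mono mult_left_mono sum_nonneg)
  qed simp
qed simp

lemma hankel_bound_tendsto:
  assumes lim: "\<And>j. (\<lambda>n. u n j) \<longlonglongrightarrow> v j" and bd: "eventually (\<lambda>n. hankel_bound (u n) K) sequentially"
  shows "hankel_bound v K"
  unfolding hankel_bound_def
proof (intro conjI allI)
  obtain n where "hankel_bound (u n) K" using eventually_happens[OF bd] by auto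
  then show "0 \<le> K" by (simp add: hankel_bound_def)
  fix N f h
  show "norm (\<Sum>n<N. \<Sum>k<N. v (n + k) * f k * h n) \<le> K * sqrt (\<Sum>n<N. (norm (f n))\<^sup>2) * sqrt (\<Sum>n<N. (norm (h n))\<^sup>2)"
  proof (rule tendsto_upperbound)
    show "(\<lambda>i. norm (\<Sum>n<N. \<Sum>k<N. u i (n + k) * f k * h n)) \<longlonglongrightarrow> norm (\<Sum>n<N. \<Sum>k<N. v (n + k) * f k * h n)"
      by (intro tendsto_intros lim)
    show "eventually (\<lambda>i. norm (\<Sum>n<N. \<Sum>k<N. u i (n + k) * f k * h n) \<le> K * sqrt (\<Sum>n<N. (norm (f n))\<^sup>2) * sqrt (\<Sum>n<N. (norm (h n))\<^sup>2)) sequentially"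
      using bd by eventually_elim (simp add: hankel_bound_def)
  qed simp
qed

lemma hankel_bound_of_poly_oscillation:
  fixes p :: "complex poly"
  assumes M: "0 < M"
    and osc: "\<And>a h. 0 < h \<Longrightarrow> h \<le> 2 * pi \<Longrightarrow> \<exists>c. (LINT t:{a..a+h}|lborel. norm (poly p (cis t) - c)) \<le> M * h"
  shows "hankel_bound (coeff (p - [:coeff p 0:])) (48 * (456 * M) + 1)"
proof (rule hankel_bound_of_L1_garsia)
  fix w :: complex assume w: "norm w < 1"
  have per: "poly p (cis (t + 2 * pi)) = poly p (cis t)" for t by (simp add: cis_mult[symmetric])
  have "\<exists>c. (\<integral>t. poisson w t * norm (poly p (cis t) - c) \<partial>Circ) \<le> 2 * pi * (228 * M)"
    using M by (intro poisson_mean_oscillation[OF _ per _ osc w] continuous_intros) auto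
  then obtain c where c: "(\<integral>t. poisson w t * norm (poly p (cis t) - c) \<partial>Circ) \<le> 2 * pi * (228 * M)" by blast
  have ci: "integrable Circ (\<lambda>t. poisson w t * norm (poly p (cis t) - d))" for d
    by (intro integrable_Circ_continuous continuous_intros continuous_poisson w)
  have ci1: "integrable Circ (poisson w)"
    by (intro integrable_Circ_continuous continuous_poisson w)
  \<comment> \<open>\<open>p(w) - c\<close> is the Poisson average of p - c, so replacing the centre
    c by p(w) at most doubles the bound: 456 = 2 * 228.\<close>
  have "2 * pi * (poly p w - c) = (\<integral>t. poisson w t * poly (p - [:c:]) (cis t) \<partial>Circ)"
    unfolding poisson_integral_poly[OF w] by simp
  then have "2 * pi * norm (poly p w - c) = norm (\<integral>t. poisson w t * poly (p - [:c:]) (cis t) \<partial>Circ)"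
    by (metis norm_mult norm_of_real abs_of_pos pi_gt_zero zero_less_mult_iff zero_less_numeral)
  also have "\<dots> \<le> (\<integral>t. norm (poisson w t * poly (p - [:c:]) (cis t)) \<partial>Circ)"
    by (rule integral_norm_bound)
  also have "\<dots> = (\<integral>t. poisson w t * norm (poly p (cis t) - c) \<partial>Circ)"
    using poisson_nonneg[OF w] by (simp add: norm_mult)
  finally have cw: "2 * pi * norm (poly p w - c) \<le> 2 * pi * (228 * M)" using c by linarith
  have "(\<integral>t. poisson w t * norm (poly p (cis t) - poly p w) \<partial>Circ)
      \<le> (\<integral>t. poisson w t * norm (poly p (cis t) - c) + poisson w t * norm (poly p w - c) \<partial>Circ)"
  proof (rule integral_mono)
    show "poisson w t * norm (poly p (cis t) - poly p w) \<le> poisson w t * norm (poly p (cis t) - c) + poisson w t * norm (poly p w - c)" for t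
      unfolding distrib_left[symmetric] using poisson_nonneg[OF w, of t] norm_triangle_ineq4[of "poly p (cis t) - c" "poly p w - c"]
      by (intro mult_left_mono) auto
  qed (intro ci Bochner_Integration.integrable_add Bochner_Integration.integrable_mult_left ci1)+
  also have "\<dots> = (\<integral>t. poisson w t * norm (poly p (cis t) - c) \<partial>Circ) + 2 * pi * norm (poly p w - c)"
    by (subst Bochner_Integration.integral_add) (auto intro!: ci Bochner_Integration.integrable_mult_left ci1 simp: poisson_integral_1[OF w])
  also have "\<dots> \<le> 2 * pi * (228 * M) + 2 * pi * (228 * M)" by (rule add_mono[OF c cw])
  also have "\<dots> = 2 * pi * (456 * M)" by simp
  finally show "(\<integral>t. poisson w t * norm (poly (p - [:coeff p 0:]) (cis t) - poly (p - [:coeff p 0:]) w) \<partial>Circ) \<le> 2 * pi * (456 * M)"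
    by simp
qed (use M in auto)

theorem hankel_bound_of_BMOA:
  assumes "BMOA u"
  obtains K where "hankel_bound u K"
proof -
  obtain g where g: "boundary_fn u g" and "BMO_circle g" using assms by (auto simp: BMOA_def)
  then obtain M0 where M0: "\<And>a h. 0 < h \<Longrightarrow> h \<le> 2 * pi \<Longrightarrow>
      (LINT t:{a..a+h}|lborel. norm (g t - (LINT x:{a..a+h}|lborel. g x) / h)) / h \<le> M0"
    unfolding BMO_circle_def by blast
  define M where "M = max M0 0 + 1"
  have M: "0 < M" by (simp add: M_def)
  have bmo: "(LINT t:{a..a+h}|lborel. norm (g t - (LINT x:{a..a+h}|lborel. g x) / h)) \<le> M * h" if "0 < h" "h \<le> 2 * pi" for a h
  proof -
    have "(LINT t:{a..a+h}|lborel. norm (g t - (LINT x:{a..a+h}|lborel. g x) / h)) / h \<le> M"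
      using M0[OF that, of a] by (simp add: M_def)
    then show ?thesis using that by (simp add: pos_divide_le_eq)
  qed
  have gm: "g \<in> borel_measurable Circ" and g2: "integrable Circ (\<lambda>t. (norm (g t))\<^sup>2)"
    using g by (auto simp: boundary_fn_def integrable_Circ_iff intro: measurable_Circ)
  have "integrable Circ (\<lambda>t. norm (g t))"
    by (rule Circ.square_integrable_imp_integrable) (use gm g2 in auto)
  then have int: "integrable Circ g" using gm by (simp add: integrable_norm_iff)
  define K where "K = 48 * (456 * M) + 1"
  have hb: "hankel_bound (coeff (fejer_mean N u - [:coeff (fejer_mean N u) 0:])) K" if N: "0 < N" for N
    unfolding K_def
    by (rule hankel_bound_of_poly_oscillation[OF M fejer_mean_oscillation[OF g int _ N bmo]]) (use M in auto)
  have "hankel_bound (\<lambda>j. if j = 0 then 0 else u j) K"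
  proof (rule hankel_bound_tendsto)
    show "\<forall>\<^sub>F N in sequentially. hankel_bound (coeff (fejer_mean N u - [:coeff (fejer_mean N u) 0:])) K"
      using eventually_gt_at_top[of 0] by eventually_elim (rule hb)
    fix j
    show "(\<lambda>N. coeff (fejer_mean N u - [:coeff (fejer_mean N u) 0:]) j) \<longlonglongrightarrow> (if j = 0 then 0 else u j)"
    proof (cases "j = 0")
      case False
      \<comment> \<open>The Fejer weight (N - j)/N, valid once N > j, tends to 1.\<close>
      have "(\<lambda>N. (1 - of_nat j * (1 / of_nat N)) * u j) \<longlonglongrightarrow> (1 - of_nat j * 0) * u j"
        by (intro tendsto_intros lim_1_over_n)
      moreover have "\<forall>\<^sub>F N in sequentially. (1 - of_nat j * (1 / of_nat N)) * u j = coeff (fejer_mean N u - [:coeff (fejer_mean N u) 0:]) j"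
        using eventually_gt_at_top[of j]
      proof eventually_elim
        case (elim N)
        then show ?case using False
          by (cases j) (simp_all add: fejer_mean_def coeff_fpoly of_nat_diff divide_simps del: of_nat_Suc)
      qed
      ultimately have "(\<lambda>N. coeff (fejer_mean N u - [:coeff (fejer_mean N u) 0:]) j) \<longlonglongrightarrow> (1 - of_nat j * 0) * u j"
        by (rule Lim_transform_eventually)
      then show ?thesis using False by simp
    qed simp
  qed
  from hankel_bound_add[OF this hankel_bound_single[of "u 0"]]
  have "hankel_bound (\<lambda>j. (if j = 0 then 0 else u j) + (if j = 0 then u 0 else 0)) (K + norm (u 0))" .
  also have "(\<lambda>j. (if j = 0 then 0 else u j) + (if j = 0 then u 0 else 0)) = u" by auto
  finally show ?thesis by (rule that)
qed

theorem mainTheorem17: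
  fixes u :: "nat \<Rightarrow> complex" and s :: real
  assumes "BMOA u" and "s > 0" and "ker_star u s \<noteq> {\<lambda>n. 0}"
  shows "\<exists>\<theta> p. inner_fn \<theta> \<and> isometric_multiplier p (RanH \<theta>) \<and>
           ker_star u s = Cc ` (mult p ` RanH \<theta>) \<and>
           ker_nostar u s = mult p ` RanH \<theta> \<and>
           (\<forall>f\<in>RanH \<theta>. Gop u (Cc (mult p f)) = (\<lambda>n. complex_of_real s * mult p (theta_bar \<theta> f) n))"
proof -
  have u: "u \<in> H2" using assms(1) by (simp add: BMOA_def)
  obtain K where K: "hankel_bound u K" using hankel_bound_of_BMOA[OF assms(1)] .
  obtain \<theta> p where *: "inner2 \<theta>" "isometric_multiplier p (RanH (coef \<theta>))"
    "ker_star u s = Cc ` (mult p ` RanH (coef \<theta>))" "ker_nostar u s = mult p ` RanH (coef \<theta>)"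
    "\<And>f. f \<in> RanH (coef \<theta>) \<Longrightarrow> Gop u (Cc (mult p f)) = (\<lambda>n. complex_of_real s * mult p (theta_bar (coef \<theta>) f) n)"
    using schmidt_subspaces_of_bounded_hankel[OF u K assms(2,3)] by metis
  show ?thesis using inner2_imp_inner_fn[OF *(1)] *(2-5) by blast
qed

end
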